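(* Let $n\geqslant2$, $p\geqslant1$, let $Q:\mathbb{B}^n\to[0,\infty]$ be a Lebesgue measurable function, and let $f:\mathbb{B}^n\to\mathbb{B}^n$ be an open discrete ring $(p,Q)$-mapping. Suppose that $q_0(r)\neq\infty$ for a.e. $r\in(0,1)$ and that, for some constant $c>0$, $$\int_{r<|x|<1}Q(x)\,\psi^p(|x|)\,dm(x)\leqslant c\,J^{\alpha}(r)\qquad\text{for all } r\in(0,1),$$ where $\alpha\leqslant p$ and $\psi$ is a nonnegative Lebesgue measurable function on $(0,\infty)$ such that $$0<J(r):=\int_r^1\psi(t)\,dt<\infty\qquad\text{for all } r\in(0,1).$$ Then, for every $r\in(0,1)$: if $1<p<n$, $$m(f(B(0,r)))\leqslant\Omega_n\left(1+\beta J^{\frac{p-\alpha}{p-1}}(r)\right)^{-\frac{n(p-1)}{n-p}},\qquad \beta=\frac{n-p}{p-1}\left(\frac{\omega_{n-1}}{c}\right)^{\frac{1}{p-1}};$$ and if $p=n$, $$m(f(B(0,r)))\leqslant\Omega_n\exp\left\{-\gamma J^{\frac{n-\alpha}{n-1}}(r)\right\},\qquad \gamma=n\left(\frac{\omega_{n-1}}{c}\right)^{\frac{1}{n-1}}.$$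
   Context: Notation: $m$ is Lebesgue measure in $\mathbb{R}^n$; $B(x_0,r)=\{x\in\mathbb{R}^n:|x-x_0|<r\}$, $S(x_0,r)=\{x\in\mathbb{R}^n:|x-x_0|=r\}$, $A(r_1,r_2,x_0)=\{x\in\mathbb{R}^n:r_1<|x-x_0|<r_2\}$, $\mathbb{B}^n=B(0,1)$, $\Omega_n=m(\mathbb{B}^n)$, $\omega_{n-1}$ is the area of the unit sphere $S(0,1)$. Mappings are continuous. A mapping is open if images of open sets are open, and discrete if the preimage of every point consists of isolated points. With $\mathcal{H}^{n-1}$ the $(n-1)$-dimensional Hausdorff measure, $$q_{0}(r)=\frac{1}{\omega_{n-1}r^{n-1}}\int_{S(0,r)}Q(x)\,d\mathcal{H}^{n-1}.$$ A curve is a continuous map of an interval; for a family of curves $\Gamma$, $f(\Gamma)=\{f\circ\gamma:\gamma\in\Gamma\}$. $\Gamma(E,F,G)$ is the family of all curves $\gamma:[a,b]\to\overline{\mathbb{R}^n}=\mathbb{R}^n\cup\{\infty\}$ with $\gamma(a)\in E$, $\gamma(b)\in F$ and $\gamma(t)\in G$ for $t\in(a,b)$. A Borel function $\rho:\mathbb{R}^n\to[0,\infty]$ is admissible for $\Gamma$ if $\int_\gamma\rho\,|dx|\geqslant 1$ for all (locally rectifiable) $\gamma\in\Gamma$. The $p$-modulus ($p\geqslant1$) is $M_p(\Gamma)=\inf_\rho\int_{\mathbb{R}^n}\rho^p\,dm$, the infimum being over all admissible $\rho$. Let $D$ be a domain in $\mathbb{R}^n$, $Q:D\to[0,\infty]$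 Lebesgue measurable and $x_0\in D$. A mapping $f$ defined on $D$ is a ring $(p,Q)$-mapping at $x_0$ if for all $0<r_1<r_2<\mathrm{dist}(x_0,\partial D)$, with $S_i=S(x_0,r_i)$ and $A=A(r_1,r_2,x_0)$, $$M_p\big(f(\Gamma(S_1,S_2,A))\big)\leqslant\int_A Q(x)\,\eta^p(|x-x_0|)\,dm(x)$$ for every Lebesgue measurable $\eta:(r_1,r_2)\to[0,\infty]$ with $\int_{r_1}^{r_2}\eta(r)\,dr\geqslant1$. It is a ring $(p,Q)$-mapping (in $D$) if this holds at every point $x_0\in D$. Conventions: $a/\infty=0$ for $a\neq\infty$, $a/0=\infty$ for $a>0$, $0\cdot\infty=0$. *)

theory Defs
  imports "HOL-Analysis.Analysis"
begin

section \<open>Powers of extended nonnegative reals\<close>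

text \<open>Only meant for \<open>p > 0\<close>.\<close>

definition epowr :: "ennreal \<Rightarrow> real \<Rightarrow> ennreal"  (infixr \<open>epowr\<close> 80) where
  "a epowr p = (if a = \<infinity> then \<infinity> else ennreal (enn2real a powr p))"


section \<open>Hausdorff measure\<close>

text \<open>The normalisation is the one for which the \<open>k\<close>-dimensional measure is Lebesgue measure on
  a \<open>k\<close>-dimensional Euclidean space. The empty set is treated separately because of \<open>0 ^ 0 = 1\<close>
  for \<open>k = 0\<close>.\<close>

definition hausdorff_gauge :: "nat \<Rightarrow> 'a::metric_space set \<Rightarrow> ennreal" where
  "hausdorff_gauge k U =
     (if U = {} then 0 else ennreal (unit_ball_vol (real k) * (diameter U / 2) ^ k))"

definition hausdorff_pre :: "nat \<Rightarrow> real \<Rightarrow> 'a::metric_space set \<Rightarrow> ennreal" where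
  "hausdorff_pre k \<delta> E =
     (INF U \<in> {U :: nat \<Rightarrow> 'a set. E \<subseteq> (\<Union>i. U i) \<and> (\<forall>i. bounded (U i) \<and> diameter (U i) \<le> \<delta>)}.
        \<Sum>i. hausdorff_gauge k (U i))"

definition hausdorff_outer :: "nat \<Rightarrow> 'a::metric_space set \<Rightarrow> ennreal" where
  "hausdorff_outer k E = (SUP \<delta> \<in> {0<..}. hausdorff_pre k \<delta> E)"

text \<open>The sigma-algebra consists of all Caratheodory-measurable sets, so the measure is complete.\<close>

definition hausdorff_measure :: "nat \<Rightarrow> 'a::metric_space measure" where
  "hausdorff_measure k =
     measure_of UNIV (lambda_system UNIV UNIV (hausdorff_outer k)) (hausdorff_outer k)"

lemma hausdorff_pre_empty: "\<delta> > 0 \<Longrightarrow> hausdorff_pre k \<delta> {} = 0"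
  unfolding hausdorff_pre_def
  by (intro antisym INF_lower2[of "\<lambda>_. {}"]) (auto simp: hausdorff_gauge_def)

lemma hausdorff_pre_mono: "E \<subseteq> F \<Longrightarrow> hausdorff_pre k \<delta> E \<le> hausdorff_pre k \<delta> F"
  unfolding hausdorff_pre_def by (rule INF_superset_mono) auto

lemma hausdorff_pre_subadditive:
  fixes A :: "nat \<Rightarrow> 'a::metric_space set"
  shows "hausdorff_pre k \<delta> (\<Union>i. A i) \<le> (\<Sum>i. hausdorff_pre k \<delta> (A i))"
proof (cases "(\<Sum>i. hausdorff_pre k \<delta> (A i)) < \<infinity>")
  case False
  then show ?thesis by (simp add: less_top[symmetric])
next
  case True
  have fin: "hausdorff_pre k \<delta> (A i) \<noteq> \<infinity>" for i
    using ennreal_suminf_lessD[OF True, of i] by simp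
  show ?thesis
  proof (rule ennreal_le_epsilon)
    fix e :: real
    assume e: "0 < e"
    let ?C = "\<lambda>i. {U :: nat \<Rightarrow> 'a set. A i \<subseteq> (\<Union>j. U j) \<and>
                 (\<forall>j. bounded (U j) \<and> diameter (U j) \<le> \<delta>)}"
    have "\<exists>U\<in>?C i. (\<Sum>j. hausdorff_gauge k (U j)) < hausdorff_pre k \<delta> (A i) + ennreal (e * (1/2) ^ Suc i)" for i
    proof -
      have "hausdorff_pre k \<delta> (A i) < hausdorff_pre k \<delta> (A i) + ennreal (e * (1/2) ^ Suc i)"
        using fin[of i] e ennreal_add_left_cancel_less[of _ 0] by fastforce
      then show ?thesis
        unfolding hausdorff_pre_def INF_less_iff .
    qed
    then have "\<forall>i. \<exists>U. U \<in> ?C i \<and>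
        (\<Sum>j. hausdorff_gauge k (U j)) < hausdorff_pre k \<delta> (A i) + ennreal (e * (1/2) ^ Suc i)"
      unfolding Bex_def by (rule allI)
    from choice[OF this] obtain U where UU: "\<forall>i. U i \<in> ?C i \<and>
        (\<Sum>j. hausdorff_gauge k (U i j)) < hausdorff_pre k \<delta> (A i) + ennreal (e * (1/2) ^ Suc i)"
      by (elim exE)
    have U: "U i \<in> ?C i" for i
      using UU by (elim allE conjE)
    have less: "(\<Sum>j. hausdorff_gauge k (U i j)) < hausdorff_pre k \<delta> (A i) + ennreal (e * (1/2) ^ Suc i)" for i
      using UU by (elim allE conjE)
    define V where "V m = U (fst (prod_decode m)) (snd (prod_decode m))" for m
    have V_cover: "(\<Union>i. A i) \<subseteq> (\<Union>m. V m)"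
    proof
      fix x
      assume "x \<in> (\<Union>i. A i)"
      then obtain i where "x \<in> A i" by blast
      with U[of i] obtain j where "x \<in> U i j" by blast
      then have "x \<in> V (prod_encode (i, j))" by (simp add: V_def)
      then show "x \<in> (\<Union>m. V m)" by blast
    qed
    have V_small: "\<forall>m. bounded (V m) \<and> diameter (V m) \<le> \<delta>"
      using U unfolding V_def by blast
    have "hausdorff_pre k \<delta> (\<Union>i. A i) \<le> (\<Sum>m. hausdorff_gauge k (V m))"
      unfolding hausdorff_pre_def
      by (rule INF_lower) (use V_cover V_small in simp)
    also have "\<dots> = (\<Sum>m. (\<lambda>(i, j). hausdorff_gauge k (U i j)) (prod_decode m))"
      by (simp add: V_def case_prod_beta)
    also have "\<dots> = (\<Sum>i. \<Sum>j. hausdorff_gauge k (U i j))"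
      by (rule suminf_ennreal_2dimen) simp
    also have "\<dots> \<le> (\<Sum>i. hausdorff_pre k \<delta> (A i) + ennreal (e * (1/2) ^ Suc i))"
      by (rule suminf_le) (use less in \<open>auto intro: less_imp_le\<close>)
    also have "\<dots> = (\<Sum>i. hausdorff_pre k \<delta> (A i)) + (\<Sum>i. ennreal (e * (1/2) ^ Suc i))"
      by (rule suminf_add[symmetric]) auto
    also have "(\<Sum>i. ennreal (e * (1/2) ^ Suc i)) = ennreal e"
      using sums_mult[OF power_half_series, of e] e
      by (intro suminf_ennreal_eq) auto
    finally show "hausdorff_pre k \<delta> (\<Union>i. A i) \<le> (\<Sum>i. hausdorff_pre k \<delta> (A i)) + ennreal e" .
  qed
qed

lemma outer_measure_space_hausdorff_outer: "outer_measure_space UNIV (hausdorff_outer k)"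
  unfolding outer_measure_space_def positive_def increasing_def countably_subadditive_def
proof (intro conjI ballI allI impI)
  show "hausdorff_outer k {} = 0"
    by (simp add: hausdorff_outer_def hausdorff_pre_empty)
next
  fix E F :: "'a set"
  assume "E \<subseteq> F"
  then show "hausdorff_outer k E \<le> hausdorff_outer k F"
    unfolding hausdorff_outer_def by (intro SUP_mono') (rule hausdorff_pre_mono)
next
  fix A :: "nat \<Rightarrow> 'a set"
  show "hausdorff_outer k (\<Union>i. A i) \<le> (\<Sum>i. hausdorff_outer k (A i))"
    unfolding hausdorff_outer_def[of k "\<Union>i. A i"]
  proof (rule SUP_least)
    fix \<delta> :: real
    assume \<delta>: "\<delta> \<in> {0<..}"
    have "hausdorff_pre k \<delta> (\<Union>i. A i) \<le> (\<Sum>i. hausdorff_pre k \<delta> (A i))"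
      by (rule hausdorff_pre_subadditive)
    also have "\<dots> \<le> (\<Sum>i. hausdorff_outer k (A i))"
      unfolding hausdorff_outer_def using \<delta> by (intro suminf_le SUP_upper) auto
    finally show "hausdorff_pre k \<delta> (\<Union>i. A i) \<le> (\<Sum>i. hausdorff_outer k (A i))" .
  qed
qed

lemma
  fixes E :: "'a::metric_space set"
  shows space_hausdorff_measure: "space (hausdorff_measure k) = (UNIV :: 'a set)"
    and sets_hausdorff_measure:
      "sets (hausdorff_measure k) = lambda_system (UNIV :: 'a set) UNIV (hausdorff_outer k)"
    and emeasure_hausdorff_measure:
      "E \<in> sets (hausdorff_measure k) \<Longrightarrow> emeasure (hausdorff_measure k) E = hausdorff_outer k E"
proof -
  let ?L = "lambda_system (UNIV :: 'a set) UNIV (hausdorff_outer k)"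
  interpret sigma_algebra "UNIV :: 'a set" UNIV
    using sigma_algebra_Pow[of "UNIV :: 'a set"] by simp
  have ms: "measure_space UNIV ?L (hausdorff_outer k)"
    using outer_measure_space_hausdorff_outer by (rule caratheodory_lemma)
  then interpret L: sigma_algebra UNIV ?L
    by (simp add: measure_space_def)
  show "space (hausdorff_measure k) = (UNIV :: 'a set)"
    by (simp add: hausdorff_measure_def space_measure_of_conv)
  show *: "sets (hausdorff_measure k) = ?L"
    by (simp add: hausdorff_measure_def sets_measure_of_conv L.sigma_sets_eq)
  show "emeasure (hausdorff_measure k) E = hausdorff_outer k E"
    if "E \<in> sets (hausdorff_measure k)"
    using ms that unfolding * unfolding hausdorff_measure_def
    by (intro emeasure_measure_of_sigma) (auto simp: measure_space_def)
qed


section \<open>Spherical means\<close>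

definition unit_sphere_area :: "'a::euclidean_space itself \<Rightarrow> real" where
  "unit_sphere_area _ = measure (hausdorff_measure (DIM('a) - 1)) (sphere (0 :: 'a) 1)"

definition spherical_mean :: "('a::euclidean_space \<Rightarrow> ennreal) \<Rightarrow> real \<Rightarrow> ennreal" where
  "spherical_mean Q r =
     (\<integral>\<^sup>+x \<in> sphere 0 r. Q x \<partial>hausdorff_measure (DIM('a) - 1))
       / ennreal (unit_sphere_area TYPE('a) * r ^ (DIM('a) - 1))"


section \<open>Curves and line integrals\<close>

text \<open>A curve is a pair of its parameter interval and a map; the values of the map outside the
  interval are irrelevant.\<close>

type_synonym 'a curve = "real set \<times> (real \<Rightarrow> 'a)"

definition curve_length :: "(real \<Rightarrow> 'a::metric_space) \<Rightarrow> real \<Rightarrow> real \<Rightarrow> ennreal" where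
  "curve_length \<gamma> a b =
     (SUP ts \<in> {ts. sorted ts \<and> set ts \<subseteq> {a..b}}.
        ennreal (\<Sum>i < length ts - 1. dist (\<gamma> (ts ! i)) (\<gamma> (ts ! Suc i))))"

text \<open>The arc-length parametrisation of a rectifiable curve on \<open>{a..b}\<close>. It does not depend on
  the choice of \<open>t\<close>, because the curve is constant wherever its length function is.\<close>

definition arc_length_param :: "(real \<Rightarrow> 'a::metric_space) \<Rightarrow> real \<Rightarrow> real \<Rightarrow> real \<Rightarrow> 'a" where
  "arc_length_param \<gamma> a b s = \<gamma> (SOME t. t \<in> {a..b} \<and> curve_length \<gamma> a t = ennreal s)"

definition line_integral ::
  "('a::metric_space \<Rightarrow> ennreal) \<Rightarrow> (real \<Rightarrow> 'a) \<Rightarrow> real \<Rightarrow> real \<Rightarrow> ennreal" where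
  "line_integral \<rho> \<gamma> a b =
     (\<integral>\<^sup>+s \<in> {0..enn2real (curve_length \<gamma> a b)}. \<rho> (arc_length_param \<gamma> a b s) \<partial>lebesgue)"

text \<open>On a compact interval, local rectifiability is rectifiability and the supremum below is
  attained at the whole interval.\<close>

definition locally_rectifiable :: "'a::metric_space curve \<Rightarrow> bool" where
  "locally_rectifiable = (\<lambda>(I, \<gamma>). \<forall>a b. a \<le> b \<and> {a..b} \<subseteq> I \<longrightarrow> curve_length \<gamma> a b < \<infinity>)"

definition curve_integral :: "('a::metric_space \<Rightarrow> ennreal) \<Rightarrow> 'a curve \<Rightarrow> ennreal" where
  "curve_integral \<rho> =
     (\<lambda>(I, \<gamma>). SUP (a, b) \<in> {(a, b). a \<le> b \<and> {a..b} \<subseteq> I}. line_integral \<rho> \<gamma> a b)"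


section \<open>Moduli of curve families\<close>

definition admissible :: "'a::euclidean_space curve set \<Rightarrow> ('a \<Rightarrow> ennreal) set" where
  "admissible \<Gamma> =
     {\<rho> \<in> borel_measurable borel. \<forall>c\<in>\<Gamma>. locally_rectifiable c \<longrightarrow> curve_integral \<rho> c \<ge> 1}"

definition modulus :: "real \<Rightarrow> 'a::euclidean_space curve set \<Rightarrow> ennreal" where
  "modulus p \<Gamma> = (INF \<rho> \<in> admissible \<Gamma>. \<integral>\<^sup>+x. \<rho> x epowr p \<partial>lebesgue)"

text \<open>For subsets \<open>E\<close>, \<open>F\<close>, \<open>G\<close> of the space itself, a curve with values in the one-point
  compactification that joins \<open>E\<close> and \<open>F\<close> in \<open>G\<close> never passes through the point at infinity.\<close>

definition joining_curves ::
  "'a::topological_space set \<Rightarrow> 'a set \<Rightarrow> 'a set \<Rightarrow> 'a curve set" where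
  "joining_curves E F G =
     {({a..b}, \<gamma>) | a b \<gamma>. a \<le> b \<and> continuous_on {a..b} \<gamma> \<and>
        \<gamma> a \<in> E \<and> \<gamma> b \<in> F \<and> (\<forall>t \<in> {a<..<b}. \<gamma> t \<in> G)}"

definition image_curves :: "('a \<Rightarrow> 'b) \<Rightarrow> 'a curve set \<Rightarrow> 'b curve set" where
  "image_curves f \<Gamma> = (\<lambda>(I, \<gamma>). (I, f \<circ> \<gamma>)) ` \<Gamma>"


section \<open>Ring mappings\<close>

definition annulus :: "real \<Rightarrow> real \<Rightarrow> 'a::metric_space \<Rightarrow> 'a set" where
  "annulus r\<^sub>1 r\<^sub>2 x\<^sub>0 = {x. r\<^sub>1 < dist x x\<^sub>0 \<and> dist x x\<^sub>0 < r\<^sub>2}"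

text \<open>The distance to an empty boundary is infinite, whereas \<^const>\<open>infdist\<close> returns \<open>0\<close> there.\<close>

definition ring_mapping_at ::
  "real \<Rightarrow> ('a::euclidean_space \<Rightarrow> ennreal) \<Rightarrow> 'a set \<Rightarrow> ('a \<Rightarrow> 'a) \<Rightarrow> 'a \<Rightarrow> bool" where
  "ring_mapping_at p Q D f x\<^sub>0 \<longleftrightarrow>
     (\<forall>r\<^sub>1 r\<^sub>2. 0 < r\<^sub>1 \<and> r\<^sub>1 < r\<^sub>2 \<and> (frontier D = {} \<or> r\<^sub>2 < infdist x\<^sub>0 (frontier D)) \<longrightarrow>
       (\<forall>\<eta> \<in> borel_measurable (lebesgue_on {r\<^sub>1<..<r\<^sub>2}).
          (\<integral>\<^sup>+r \<in> {r\<^sub>1<..<r\<^sub>2}. \<eta> r \<partial>lebesgue) \<ge> 1 \<longrightarrow>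
          modulus p (image_curves f
              (joining_curves (sphere x\<^sub>0 r\<^sub>1) (sphere x\<^sub>0 r\<^sub>2) (annulus r\<^sub>1 r\<^sub>2 x\<^sub>0)))
            \<le> (\<integral>\<^sup>+x \<in> annulus r\<^sub>1 r\<^sub>2 x\<^sub>0. Q x * \<eta> (dist x x\<^sub>0) epowr p \<partial>lebesgue)))"

definition ring_mapping ::
  "real \<Rightarrow> ('a::euclidean_space \<Rightarrow> ennreal) \<Rightarrow> 'a set \<Rightarrow> ('a \<Rightarrow> 'a) \<Rightarrow> bool" where
  "ring_mapping p Q D f \<longleftrightarrow> (\<forall>x\<^sub>0\<in>D. ring_mapping_at p Q D f x\<^sub>0)"

definition discrete_map :: "'a::topological_space set \<Rightarrow> ('a \<Rightarrow> 'b) \<Rightarrow> bool" where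
  "discrete_map D f \<longleftrightarrow> (\<forall>y. discrete {x \<in> D. f x = y})"

end

theory Submission
  imports Defs "HOL-Complex_Analysis.Great_Picard"
begin

text \<open>With \<open>\<eta> = \<psi> / J\<close> on \<open>(r, s)\<close> and \<open>s \<rightarrow> 1\<close>, the ring inequality and the growth
  hypothesis bound the moduli of the image families by \<open>c * J(r) powr (\<alpha> - p)\<close>. Conversely they are
  at least the capacity of the spherical ring whose inner ball has the volume of \<open>f(B(0,r))\<close> and
  whose outer ball is the unit ball; solving for the volume gives both estimates.

  For the lower bound, an admissible metric \<open>\<rho>\<close> is averaged over small balls. The \<open>\<rho>\<close>-distance to
  the image of the inner ball, computed along curves parametrised by arc length, yields a potential
  \<open>w\<close>; that these curves have length at least one follows by lifting them through \<open>f\<close>. The inequality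
  between the energy of \<open>w\<close> and the capacity of the spherical ring avoids coarea and perimeters: by
  Brunn-Minkowski, the Hopf-Lax regularisation \<open>Q\<^sub>h w\<close> increases the integral at least as much as that
  of the rearrangement, while by Young's inequality the increase is at most \<open>h\<close> times the energy of
  \<open>\<rho>\<close> divided by \<open>p\<close>.

  Finally only \<open>\<omega> \<le> n * \<Omega>\<close> is needed of the Hausdorff measure of the sphere, and this upper bound
  follows from a Vitali covering by small caps.\<close>

section \<open>The Brunn-Minkowski inequality\<close>

text \<open>An admissible metric is controlled only along images of curves of the ring, and f need
  not be injective; an arbitrary path is tested by lifting it until the lift leaves the larger ball.
  Averaging answers the obstacle that such a metric is merely Borel and may be infinite: with finite
  energy its averages are bounded, so the potential is continuous. The price is a smaller core, of
  radius \<open>r\<^sub>0 < r\<^sub>1\<close>, and a factor ((\<epsilon> + R) / \<epsilon>) to the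
  power n * p, which tends to 1 as R \<rightarrow> 0.

  The spherical ring with core volume V has capacity n * \<Omega> * (n / k) powr (p - 1), where
  \<Omega> * k is the integral of (W / \<Omega>) powr (-q * (n - 1) / n) over V < W < \<Omega> and q
  = p / (p - 1). Displacing all volumes by the same amount makes the comparison exact for one small
  h: every term left carries the factor h, so no derivative in h is taken.

  The final bounds decrease as \<omega> grows, so the estimate \<omega> \<le> n * \<Omega> weakens
  them in the right direction.\<close>

definition minkowski_sum :: "'a::ab_group_add set \<Rightarrow> 'a set \<Rightarrow> 'a set" where
  "minkowski_sum A B = (\<Union>x\<in>A. \<Union>y\<in>B. {x + y})"

lemma minkowski_sum_commute: "minkowski_sum A B = minkowski_sum B A"
  unfolding minkowski_sum_def using add.commute by fastforce

lemma minkowski_sum_mono: "A \<subseteq> A' \<Longrightarrow> B \<subseteq> B' \<Longrightarrow> minkowski_sum A B \<subseteq> minkowski_sum A' B'"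
  unfolding minkowski_sum_def by blast

lemma open_minkowski_sum:
  fixes A :: "'a::real_normed_vector set"
  shows "open A \<Longrightarrow> open (minkowski_sum A B)"
  unfolding minkowski_sum_def by (rule open_sums) simp

lemma bounded_minkowski_sum:
  fixes A :: "'a::real_normed_vector set"
  assumes "bounded A" "bounded B"
  shows "bounded (minkowski_sum A B)"
proof -
  have "minkowski_sum A B = (\<lambda>(x, y). x + y) ` (A \<times> B)"
    unfolding minkowski_sum_def by auto
  then show ?thesis using bounded_plus[OF assms] by (simp add: case_prod_unfold)
qed

lemma fmeasurable_open_bounded:
  fixes A :: "'a::euclidean_space set"
  assumes "open A" "bounded A"
  shows "A \<in> fmeasurable lborel"
  by (rule fmeasurableI) (use assms emeasure_bounded_finite in auto)

lemma measure_open_pos: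
  fixes A :: "'a::euclidean_space set"
  assumes "open A" "bounded A" "A \<noteq> {}"
  shows "measure lborel A > 0"
proof -
  have "\<not> negligible A"
    using assms open_not_negligible by blast
  then have "emeasure lborel A \<noteq> 0"
    using assms by (simp add: negligible_iff_emeasure0)
  then show ?thesis
    using emeasure_bounded_finite[OF \<open>bounded A\<close>]
    by (simp add: measure_def enn2real_positive_iff zero_less_iff_neq_zero)
qed

section \<open>Cutting open sets by coordinate hyperplanes\<close>

lemma hyperplane_null_sets:
  fixes i :: "'a::euclidean_space"
  assumes "i \<in> Basis"
  shows "{x. x \<bullet> i = c} \<in> null_sets lborel"
proof -
  have "closed {x. x \<bullet> i = c}"
    by (intro closed_Collect_eq continuous_intros)
  then show ?thesis
    using negligible_standard_hyperplane[OF assms, of c]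
    by (simp add: null_setsI negligible_iff_emeasure0)
qed

lemma measure_halfspaces:
  fixes E :: "'a::euclidean_space set"
  assumes i: "i \<in> Basis" and E: "open E" "bounded E"
  shows "measure lborel E = measure lborel (E \<inter> {x. x \<bullet> i < c}) + measure lborel (E \<inter> {x. x \<bullet> i > c})"
proof -
  have o: "open {x. x \<bullet> i < c}" "open {x. x \<bullet> i > c}"
    by (intro open_Collect_less continuous_intros)+
  have "measure lborel E = measure lborel (E - {x. x \<bullet> i = c})"
    using hyperplane_null_sets[OF i, of c] E by (simp add: measure_Diff_null_set)
  also have "E - {x. x \<bullet> i = c} = (E \<inter> {x. x \<bullet> i < c}) \<union> (E \<inter> {x. x \<bullet> i > c})"
    by auto
  also have "measure lborel \<dots> = measure lborel (E \<inter> {x. x \<bullet> i < c}) + measure lborel (E \<inter> {x. x \<bullet> i > c})"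
    using E o by (intro measure_Un_AE AE_I2 fmeasurable_open_bounded) auto
  finally show ?thesis .
qed

text \<open>Since hyperplanes are null, dominated convergence makes the volume below height c
  continuous in c. For bounded E it runs from 0 to the full volume, and the intermediate value
  theorem applies.\<close>

lemma halfspace_measure_IVT:
  fixes E :: "'a::euclidean_space set"
  assumes i: "i \<in> Basis" and E: "open E" "bounded E" and \<theta>: "0 \<le> \<theta>" "\<theta> \<le> 1"
  obtains c where "measure lborel (E \<inter> {x. x \<bullet> i < c}) = \<theta> * measure lborel E"
proof -
  define g where "g c = measure lborel (E \<inter> {x. x \<bullet> i < c})" for c
  have o: "open {x. x \<bullet> i < c}" for c
    by (intro open_Collect_less continuous_intros)
  have g: "g c = (\<integral>x. indicator (E \<inter> {x. x \<bullet> i < c}) x \<partial>lborel)" for c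
    unfolding g_def using E o by simp
  have intE: "integrable lborel (\<lambda>x. indicator E x :: real)"
    using E emeasure_bounded_finite[OF E(2)] by (intro integrable_real_indicator) auto
  have cont: "isCont g c" for c
    unfolding continuous_at_sequentially
  proof (intro allI impI)
    fix u :: "nat \<Rightarrow> real"
    assume u: "u \<longlonglongrightarrow> c"
    show "(g \<circ> u) \<longlonglongrightarrow> g c"
      unfolding o_def g
    proof (rule integral_dominated_convergence[OF _ _ intE])
      have "AE x in lborel. x \<notin> {x. x \<bullet> i = c}"
        using AE_not_in[OF hyperplane_null_sets[OF i]] .
      then show "AE x in lborel. (\<lambda>k. indicator (E \<inter> {x. x \<bullet> i < u k}) x :: real)
           \<longlonglongrightarrow> indicator (E \<inter> {x. x \<bullet> i < c}) x"
      proof eventually_elim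
        case (elim x)
        then consider "x \<bullet> i < c" | "x \<bullet> i > c" by fastforce
        then have "\<forall>\<^sub>F k in sequentially. (x \<bullet> i < u k) = (x \<bullet> i < c)"
        proof cases
          case 1
          then show ?thesis using order_tendstoD(1)[OF u 1] by (auto elim!: eventually_mono)
        next
          case 2
          then show ?thesis using order_tendstoD(2)[OF u 2] by (auto elim!: eventually_mono)
        qed
        then show ?case
          by (intro tendsto_eventually) (auto elim!: eventually_mono simp: indicator_def)
      qed
    next
      have "E \<inter> {x. x \<bullet> i < v} \<in> sets lborel" for v
        using E o[of v] by simp
      note meas = borel_measurable_indicator[OF this]
      show "indicat_real (E \<inter> {x. x \<bullet> i < c}) \<in> borel_measurable lborel" by (rule meas)
      show "indicat_real (E \<inter> {x. x \<bullet> i < u n}) \<in> borel_measurable lborel" for n by (rule meas)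
    qed (simp add: indicator_def)
  qed
  obtain K where K: "K > 0" "\<And>x. x \<in> E \<Longrightarrow> norm x < K"
    using E(2) bounded_pos_less by blast
  then have ab: "\<bar>x \<bullet> i\<bar> < K" if "x \<in> E" for x
    using K(2)[OF that] Basis_le_norm[OF i, of x] by linarith
  have "E \<inter> {x. x \<bullet> i < -K} = {}" "E \<inter> {x. x \<bullet> i < K} = E"
    using ab by fastforce+
  then have "g (-K) = 0" "g K = measure lborel E"
    by (simp_all add: g_def)
  moreover have "\<theta> * measure lborel E \<le> measure lborel E" "0 \<le> \<theta> * measure lborel E"
    using \<theta> by (simp_all add: mult_left_le_one_le)
  ultimately have "\<exists>c\<ge>-K. c \<le> K \<and> g c = \<theta> * measure lborel E"
    using K cont by (intro IVT) auto
  then show ?thesis using that unfolding g_def by blast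
qed

lemma box_Int_halfspace:
  fixes i :: "'a::euclidean_space"
  assumes "i \<in> Basis"
  shows "\<exists>a' b'. box a b \<inter> {x. x \<bullet> i < c} = box a' b'"
    and "\<exists>a' b'. box a b \<inter> {x. x \<bullet> i > c} = box a' b'"
proof -
  have "box a b \<inter> {x. x \<bullet> i < c} = box a (b + (min (b \<bullet> i) c - b \<bullet> i) *\<^sub>R i)"
  proof (rule set_eqI)
    fix x
    have "x \<in> box a (b + (min (b \<bullet> i) c - b \<bullet> i) *\<^sub>R i) \<longleftrightarrow>
       (\<forall>j\<in>Basis. a \<bullet> j < x \<bullet> j \<and> x \<bullet> j < (if j = i then min (b \<bullet> i) c else b \<bullet> j))"
      unfolding mem_box using assms
      by (intro ball_cong refl) (auto simp: inner_simps inner_Basis)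
    then show "x \<in> box a b \<inter> {x. x \<bullet> i < c} \<longleftrightarrow> x \<in> box a (b + (min (b \<bullet> i) c - b \<bullet> i) *\<^sub>R i)"
      using assms by (auto simp: mem_box split: if_splits)
  qed
  then show "\<exists>a' b'. box a b \<inter> {x. x \<bullet> i < c} = box a' b'" by blast
  have "box a b \<inter> {x. x \<bullet> i > c} = box (a + (max (a \<bullet> i) c - a \<bullet> i) *\<^sub>R i) b"
  proof (rule set_eqI)
    fix x
    have "x \<in> box (a + (max (a \<bullet> i) c - a \<bullet> i) *\<^sub>R i) b \<longleftrightarrow>
       (\<forall>j\<in>Basis. (if j = i then max (a \<bullet> i) c else a \<bullet> j) < x \<bullet> j \<and> x \<bullet> j < b \<bullet> j)"
      unfolding mem_box using assms
      by (intro ball_cong refl) (auto simp: inner_simps inner_Basis)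
    then show "x \<in> box a b \<inter> {x. x \<bullet> i > c} \<longleftrightarrow> x \<in> box (a + (max (a \<bullet> i) c - a \<bullet> i) *\<^sub>R i) b"
      using assms by (auto simp: mem_box split: if_splits)
  qed
  then show "\<exists>a' b'. box a b \<inter> {x. x \<bullet> i > c} = box a' b'" by blast
qed

section \<open>The inequality for two boxes\<close>

lemma minkowski_sum_box:
  fixes a b c d :: "'a::euclidean_space"
  assumes "box a b \<noteq> {}" "box c d \<noteq> {}"
  shows "box (a + c) (b + d) \<subseteq> minkowski_sum (box a b) (box c d)"
proof
  fix z
  assume z: "z \<in> box (a + c) (b + d)"
  have ab: "a \<bullet> i < b \<bullet> i" and cd: "c \<bullet> i < d \<bullet> i" if "i \<in> Basis" for i
    using assms that by (auto simp: box_ne_empty)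
  \<comment> \<open>Each coordinate of z is split at the same relative position along the two edges,
    so both summands are interior points.\<close>
  define t where "t i = (z \<bullet> i - (a + c) \<bullet> i) / ((b + d) \<bullet> i - (a + c) \<bullet> i)" for i
  have t: "0 < t i" "t i < 1" if "i \<in> Basis" for i
    using ab[OF that] cd[OF that] z that unfolding t_def
    by (auto simp: mem_box inner_simps field_simps)
  define x where "x = (\<Sum>i\<in>Basis. (a \<bullet> i + t i * (b \<bullet> i - a \<bullet> i)) *\<^sub>R i)"
  have x: "x \<bullet> i = a \<bullet> i + t i * (b \<bullet> i - a \<bullet> i)" if "i \<in> Basis" for i
    using that by (simp add: x_def)
  have zx: "(z - x) \<bullet> i = c \<bullet> i + t i * (d \<bullet> i - c \<bullet> i)" if "i \<in> Basis" for i
  proof -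
    have "t i * ((b + d) \<bullet> i - (a + c) \<bullet> i) = z \<bullet> i - (a + c) \<bullet> i"
      using ab[OF that] cd[OF that] by (simp add: t_def inner_simps)
    then show ?thesis by (simp add: x[OF that] inner_simps algebra_simps)
  qed
  have conv: "p < p + t i * (q - p) \<and> p + t i * (q - p) < q" if "i \<in> Basis" "p < q" for i p q
  proof -
    have "0 < t i * (q - p)" "0 < (1 - t i) * (q - p)"
      using t[OF that(1)] that(2) by simp_all
    then show ?thesis by (simp add: algebra_simps)
  qed
  have "x \<in> box a b" "z - x \<in> box c d"
    unfolding mem_box using x zx conv ab cd by simp_all
  moreover have "z = x + (z - x)" by simp
  ultimately show "z \<in> minkowski_sum (box a b) (box c d)"
    unfolding minkowski_sum_def by blast
qed

lemma measure_box_nonempty: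
  fixes a b :: "'a::euclidean_space"
  assumes "box a b \<noteq> {}"
  shows "measure lborel (box a b) = (\<Prod>i\<in>Basis. b \<bullet> i - a \<bullet> i)"
  using assms unfolding box_ne_empty
  by (simp add: measure_def less_imp_le inner_diff_left prod_nonneg)

text \<open>Brunn-Minkowski for boxes with edge lengths x and y. The inequality of arithmetic and
  geometric means is applied to the ratios x i / (x i + y i) and to y i / (x i + y i); the two
  arithmetic means add up to one.\<close>

lemma prod_add_root_ge:
  fixes x y :: "'i \<Rightarrow> real"
  assumes S: "finite S" "S \<noteq> {}" and x: "\<And>i. i \<in> S \<Longrightarrow> x i > 0" and y: "\<And>i. i \<in> S \<Longrightarrow> y i > 0"
  shows "(\<Prod>i\<in>S. x i) powr (1 / card S) + (\<Prod>i\<in>S. y i) powr (1 / card S)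
      \<le> (\<Prod>i\<in>S. x i + y i) powr (1 / card S)"
proof -
  let ?N = "1 / real (card S)"
  have s: "x i + y i > 0" if "i \<in> S" for i
    using x[OF that] y[OF that] by simp
  have P: "(\<Prod>i\<in>S. x i + y i) > 0"
    using s by (intro prod_pos) auto
  have le: "(\<Prod>i\<in>S. u i) powr ?N \<le> (\<Sum>i\<in>S. u i / (x i + y i)) * ?N * (\<Prod>i\<in>S. x i + y i) powr ?N"
    if u: "\<And>i. i \<in> S \<Longrightarrow> u i > 0" for u
  proof -
    have "(\<Prod>i\<in>S. u i / (x i + y i)) powr ?N \<le> (\<Sum>i\<in>S. (u i / (x i + y i)) / card S)"
      using S u s by (intro arith_geom_mean) (auto simp: less_imp_le)
    also have "\<dots> = (\<Sum>i\<in>S. u i / (x i + y i)) * ?N"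
      by (simp add: sum_divide_distrib)
    finally have "(\<Prod>i\<in>S. u i / (x i + y i)) powr ?N * (\<Prod>i\<in>S. x i + y i) powr ?N
       \<le> (\<Sum>i\<in>S. u i / (x i + y i)) * ?N * (\<Prod>i\<in>S. x i + y i) powr ?N"
      by (intro mult_right_mono) auto
    moreover have "(\<Prod>i\<in>S. u i / (x i + y i)) powr ?N * (\<Prod>i\<in>S. x i + y i) powr ?N
        = (\<Prod>i\<in>S. u i) powr ?N"
    proof -
      have "(\<Prod>i\<in>S. u i / (x i + y i)) * (\<Prod>i\<in>S. x i + y i) = (\<Prod>i\<in>S. u i)"
        using P by (simp add: prod_dividef)
      moreover have "(\<Prod>i\<in>S. u i / (x i + y i)) \<ge> 0"
        using u s by (intro prod_nonneg) (auto simp: less_imp_le)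
      ultimately show ?thesis
        using P by (simp flip: powr_mult)
    qed
    ultimately show ?thesis by simp
  qed
  have "(\<Prod>i\<in>S. x i) powr ?N + (\<Prod>i\<in>S. y i) powr ?N
     \<le> ((\<Sum>i\<in>S. x i / (x i + y i)) + (\<Sum>i\<in>S. y i / (x i + y i))) * ?N * (\<Prod>i\<in>S. x i + y i) powr ?N"
    using le[of x] le[of y] x y by (simp add: algebra_simps)
  also have "(\<Sum>i\<in>S. x i / (x i + y i)) + (\<Sum>i\<in>S. y i / (x i + y i)) = (\<Sum>i\<in>S. 1)"
    unfolding sum.distrib[symmetric] using s
    by (intro sum.cong) (auto simp flip: add_divide_distrib, metis less_irrefl)
  finally show ?thesis using S by simp
qed

section \<open>Finite unions of disjoint boxes, by induction on their number\<close>

definition box_family :: "'a::euclidean_space set set \<Rightarrow> bool" where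
  "box_family \<A> \<longleftrightarrow> finite \<A> \<and> disjoint \<A> \<and> (\<forall>X\<in>\<A>. X \<noteq> {} \<and> (\<exists>a b. X = box a b))"

lemma box_family_open_bounded:
  assumes "box_family \<A>" shows "open (\<Union>\<A>)" "bounded (\<Union>\<A>)"
  using assms unfolding box_family_def by (auto intro!: open_Union bounded_Union)

text \<open>\<open>H\<close> will be an open coordinate half-space. It leaves each box in one piece,
  so the cardinality never grows; discarding empty pieces makes it drop as soon as one box lies
  outside \<open>H\<close>.\<close>

lemma box_family_Int:
  assumes \<A>: "box_family \<A>" and H: "\<And>a b. \<exists>a' b'. box a b \<inter> H = box a' b'"
  defines "\<B> \<equiv> (\<lambda>X. X \<inter> H) ` \<A> - {{}}"
  shows "box_family \<B>" "\<Union>\<B> = \<Union>\<A> \<inter> H" "card \<B> \<le> card \<A>"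
    and "X \<in> \<A> \<Longrightarrow> X \<inter> H = {} \<Longrightarrow> card \<B> < card \<A>"
proof -
  have fin: "finite \<A>" using \<A> by (simp add: box_family_def)
  show "box_family \<B>"
    unfolding box_family_def
  proof (intro conjI ballI)
    show "disjoint \<B>"
      using \<A> unfolding box_family_def disjoint_def \<B>_def by blast
    fix X assume "X \<in> \<B>"
    then obtain Y where "Y \<in> \<A>" "X = Y \<inter> H" by (auto simp: \<B>_def)
    then show "\<exists>a b. X = box a b"
      using \<A> H unfolding box_family_def by metis
  qed (use fin in \<open>auto simp: \<B>_def\<close>)
  show "\<Union>\<B> = \<Union>\<A> \<inter> H" by (auto simp: \<B>_def)
  have "card \<B> \<le> card ((\<lambda>X. X \<inter> H) ` \<A>)"
    unfolding \<B>_def using fin by (intro card_mono) auto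
  also have "\<dots> \<le> card \<A>" using fin by (rule card_image_le)
  finally show "card \<B> \<le> card \<A>" .
  assume X: "X \<in> \<A>" "X \<inter> H = {}"
  then have "\<B> \<subseteq> (\<lambda>X. X \<inter> H) ` (\<A> - {X})"
    by (auto simp: \<B>_def)
  then have "card \<B> \<le> card ((\<lambda>X. X \<inter> H) ` (\<A> - {X}))"
    using fin by (intro card_mono) auto
  also have "\<dots> \<le> card (\<A> - {X})" using fin by (intro card_image_le) auto
  also have "\<dots> < card \<A>" using fin X by (intro card_Diff1_less)
  finally show "card \<B> < card \<A>" .
qed

definition brunn_minkowski_for :: "'a::euclidean_space set \<Rightarrow> 'a set \<Rightarrow> bool" where
  "brunn_minkowski_for A B \<longleftrightarrow>
     measure lborel A powr (1 / DIM('a)) + measure lborel B powr (1 / DIM('a))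
       \<le> measure lborel (minkowski_sum A B) powr (1 / DIM('a))"

lemma brunn_minkowski_for_commute: "brunn_minkowski_for A B \<longleftrightarrow> brunn_minkowski_for B A"
  unfolding brunn_minkowski_for_def by (simp add: minkowski_sum_commute add.commute)

text \<open>The cutting step of Hadwiger and Ohmann.\<close>

lemma brunn_minkowski_cut:
  fixes A B :: "'a::euclidean_space set"
  assumes i: "i \<in> Basis"
    and A: "open A" "bounded A" and B: "open B" "bounded B"
    and a: "measure lborel (A \<inter> {x. x \<bullet> i < c}) = \<theta> * measure lborel A"
    and b: "measure lborel (B \<inter> {x. x \<bullet> i < d}) = \<theta> * measure lborel B"
    and \<theta>: "0 \<le> \<theta>" "\<theta> \<le> 1"
    and lower: "brunn_minkowski_for (A \<inter> {x. x \<bullet> i < c}) (B \<inter> {x. x \<bullet> i < d})"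
    and upper: "brunn_minkowski_for (A \<inter> {x. x \<bullet> i > c}) (B \<inter> {x. x \<bullet> i > d})"
  shows "brunn_minkowski_for A B"
proof -
  let ?N = "1 / real DIM('a)" and ?\<mu> = "measure lborel"
  let ?s = "?\<mu> A powr ?N + ?\<mu> B powr ?N"
  let ?L = "minkowski_sum (A \<inter> {x. x \<bullet> i < c}) (B \<inter> {x. x \<bullet> i < d})"
  let ?U = "minkowski_sum (A \<inter> {x. x \<bullet> i > c}) (B \<inter> {x. x \<bullet> i > d})"
  have o: "open {x. x \<bullet> i < c}" "open {x. x \<bullet> i > c}" for c
    by (intro open_Collect_less continuous_intros)+
  have a': "?\<mu> (A \<inter> {x. x \<bullet> i > c}) = (1 - \<theta>) * ?\<mu> A"
    and b': "?\<mu> (B \<inter> {x. x \<bullet> i > d}) = (1 - \<theta>) * ?\<mu> B"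
    using measure_halfspaces[OF i A, of c] measure_halfspaces[OF i B, of d] a b
    by (auto simp: algebra_simps)
  \<comment> \<open>The two pieces on one side make up the same proportion t of their sets. As n-th
    roots are homogeneous, the inequality for the pieces gives t times the full lower bound.\<close>
  have key: "t * ?s powr DIM('a) \<le> ?\<mu> M"
    if "0 \<le> t" "(t * ?\<mu> A) powr ?N + (t * ?\<mu> B) powr ?N \<le> ?\<mu> M powr ?N" for t M
  proof -
    have "t powr ?N * ?s \<le> ?\<mu> M powr ?N"
      using that by (simp add: powr_mult distrib_left)
    then have "(t powr ?N * ?s) powr DIM('a) \<le> (?\<mu> M powr ?N) powr DIM('a)"
      by (intro powr_mono2) auto
    then show ?thesis using that(1)
      by (simp add: powr_mult powr_powr)
  qed
  have L: "\<theta> * ?s powr DIM('a) \<le> ?\<mu> ?L"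
    using lower unfolding brunn_minkowski_for_def a b by (intro key \<theta>)
  have U: "(1 - \<theta>) * ?s powr DIM('a) \<le> ?\<mu> ?U"
    using upper unfolding brunn_minkowski_for_def a' b' using \<theta> by (intro key) auto
  have fmL: "?L \<in> fmeasurable lborel" and fmU: "?U \<in> fmeasurable lborel"
    using A B o by (auto intro!: fmeasurable_open_bounded open_minkowski_sum bounded_minkowski_sum)
  \<comment> \<open>The two sums lie strictly on opposite sides of the hyperplane at height c + d,
    so their volumes may be added.\<close>
  have disj: "?L \<inter> ?U = {}"
  proof (rule ccontr)
    assume "?L \<inter> ?U \<noteq> {}"
    then obtain x y x' y' where eq: "x + y = x' + y'"
      and "x \<bullet> i < c" "y \<bullet> i < d" "x' \<bullet> i > c" "y' \<bullet> i > d"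
      unfolding minkowski_sum_def by fastforce
    moreover have "x \<bullet> i + y \<bullet> i = x' \<bullet> i + y' \<bullet> i"
      using arg_cong[OF eq, of "\<lambda>z. z \<bullet> i"] by (simp add: inner_add_left)
    ultimately show False by linarith
  qed
  have "?s powr DIM('a) \<le> ?\<mu> ?L + ?\<mu> ?U"
    using L U by (simp add: algebra_simps)
  also have "\<dots> = ?\<mu> (?L \<union> ?U)"
    using disj fmL fmU by (subst measure_Un3) auto
  also have "\<dots> \<le> ?\<mu> (minkowski_sum A B)"
    using fmL fmU A B fmeasurableD[OF fmL] fmeasurableD[OF fmU]
    by (intro measure_mono_fmeasurable sets.Un Un_least minkowski_sum_mono fmeasurable_open_bounded
        open_minkowski_sum bounded_minkowski_sum) auto
  finally have "(?s powr DIM('a)) powr ?N \<le> ?\<mu> (minkowski_sum A B) powr ?N"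
    by (intro powr_mono2) auto
  then show ?thesis
    unfolding brunn_minkowski_for_def by (simp add: powr_powr)
qed

lemma box_family_separated:
  assumes \<A>: "box_family \<A>" and X: "X \<in> \<A>" and Y: "Y \<in> \<A>" and "X \<noteq> Y"
  obtains i c U V where "i \<in> Basis" "U \<in> \<A>" "V \<in> \<A>" "U \<subseteq> {x. x \<bullet> i < c}" "V \<subseteq> {x. x \<bullet> i > c}"
proof -
  obtain a b a' b' where eq: "X = box a b" "Y = box a' b'" and ne: "X \<noteq> {}" "Y \<noteq> {}"
    using \<A> X Y unfolding box_family_def by metis
  have "box a b \<inter> box a' b' = {}"
    using \<A> X Y \<open>X \<noteq> Y\<close> eq unfolding box_family_def disjoint_def by metis
  then obtain i where i: "i \<in> Basis" "b \<bullet> i \<le> a' \<bullet> i \<or> b' \<bullet> i \<le> a \<bullet> i"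
    using ne unfolding disjoint_interval eq by (metis box_ne_empty(2) not_le)
  show ?thesis
  proof (cases "b \<bullet> i \<le> a' \<bullet> i")
    case True
    then show ?thesis
      using i X Y by (intro that[of i X Y "b \<bullet> i"]) (auto simp: eq mem_box intro: order.strict_trans1)
  next
    case False
    then show ?thesis
      using i X Y by (intro that[of i Y X "b' \<bullet> i"]) (auto simp: eq mem_box intro: order.strict_trans1)
  qed
qed

text \<open>A hyperplane separating two boxes of \<A> removes at least one of them from each side,
  while cutting \<B> in the same proportion does not increase its cardinality; so both pairs of
  halves are smaller. The proportion lies strictly between 0 and 1, hence neither half of \<B> is
  empty.\<close>

lemma brunn_minkowski_boxes_step:
  fixes \<A> \<B> :: "'a::euclidean_space set set"
  assumes \<A>: "box_family \<A>" "\<A> \<noteq> {}" and \<B>: "box_family \<B>" "\<B> \<noteq> {}"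
    and two: "card \<A> \<ge> 2"
    and IH: "\<And>\<A>' \<B>' :: 'a set set. \<lbrakk>box_family \<A>'; \<A>' \<noteq> {}; box_family \<B>'; \<B>' \<noteq> {};
       card \<A>' + card \<B>' < card \<A> + card \<B>\<rbrakk> \<Longrightarrow> brunn_minkowski_for (\<Union>\<A>') (\<Union>\<B>')"
  shows "brunn_minkowski_for (\<Union>\<A>) (\<Union>\<B>)"
proof -
  let ?\<mu> = "measure (lborel :: 'a measure)"
  obtain X Y where XY: "X \<in> \<A>" "Y \<in> \<A>" "X \<noteq> Y"
    using two card_le_Suc0_iff_eq[of \<A>] \<A>(1) unfolding box_family_def by auto
  obtain i c U V where i: "i \<in> Basis" and UV: "U \<in> \<A>" "V \<in> \<A>"
      "U \<subseteq> {x. x \<bullet> i < c}" "V \<subseteq> {x. x \<bullet> i > c}"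
    by (rule box_family_separated[OF \<A>(1) XY])
  note oA = box_family_open_bounded[OF \<A>(1)] and oB = box_family_open_bounded[OF \<B>(1)]
  have ne: "\<Union>\<A> \<noteq> {}" "\<Union>\<B> \<noteq> {}" using \<A> \<B> unfolding box_family_def by auto
  have o: "open {x. x \<bullet> i < c}" "open {x. x \<bullet> i > c}" for c
    by (intro open_Collect_less continuous_intros)+
  have posA: "?\<mu> (\<Union>\<A>) > 0" and posB: "?\<mu> (\<Union>\<B>) > 0"
    using measure_open_pos oA oB ne by auto
  have "U \<noteq> {}" "V \<noteq> {}" using \<A>(1) UV unfolding box_family_def by auto
  then have "\<Union>\<A> \<inter> {x. x \<bullet> i < c} \<noteq> {}" "\<Union>\<A> \<inter> {x. x \<bullet> i > c} \<noteq> {}"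
    using UV by blast+
  then have pos: "?\<mu> (\<Union>\<A> \<inter> {x. x \<bullet> i < c}) > 0" "?\<mu> (\<Union>\<A> \<inter> {x. x \<bullet> i > c}) > 0"
    using oA o by (auto intro!: measure_open_pos)
  define \<theta> where "\<theta> = ?\<mu> (\<Union>\<A> \<inter> {x. x \<bullet> i < c}) / ?\<mu> (\<Union>\<A>)"
  have \<theta>: "0 < \<theta>" "\<theta> < 1"
    using pos measure_halfspaces[OF i oA, of c] posA by (auto simp: \<theta>_def)
  obtain d where d: "?\<mu> (\<Union>\<B> \<inter> {x. x \<bullet> i < d}) = \<theta> * ?\<mu> (\<Union>\<B>)"
    using halfspace_measure_IVT[OF i oB] \<theta> by (metis less_imp_le)
  have d': "?\<mu> (\<Union>\<B> \<inter> {x. x \<bullet> i > d}) = (1 - \<theta>) * ?\<mu> (\<Union>\<B>)"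
    using measure_halfspaces[OF i oB, of d] d by (auto simp: algebra_simps)
  have neB: "\<Union>\<B> \<inter> {x. x \<bullet> i < d} \<noteq> {}" "\<Union>\<B> \<inter> {x. x \<bullet> i > d} \<noteq> {}"
  proof -
    have "?\<mu> (\<Union>\<B> \<inter> {x. x \<bullet> i < d}) > 0" "?\<mu> (\<Union>\<B> \<inter> {x. x \<bullet> i > d}) > 0"
      unfolding d d' using \<theta> posB by simp_all
    then show "\<Union>\<B> \<inter> {x. x \<bullet> i < d} \<noteq> {}" "\<Union>\<B> \<inter> {x. x \<bullet> i > d} \<noteq> {}"
      by (metis less_irrefl measure_empty)+
  qed
  note H = box_Int_halfspace[OF i]
  let ?cut = "\<lambda>\<X> H. (\<lambda>X. X \<inter> H) ` \<X> - {{}}"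
  note A1 = box_family_Int[OF \<A>(1) H(1)] and A2 = box_family_Int[OF \<A>(1) H(2)]
  note B1 = box_family_Int[OF \<B>(1) H(1)] and B2 = box_family_Int[OF \<B>(1) H(2)]
  have lower: "brunn_minkowski_for (\<Union>\<A> \<inter> {x. x \<bullet> i < c}) (\<Union>\<B> \<inter> {x. x \<bullet> i < d})"
  proof -
    have "card (?cut \<A> {x. x \<bullet> i < c}) < card \<A>"
      by (rule A1(4)[OF UV(2)]) (use UV(4) in force)
    then have "brunn_minkowski_for (\<Union>(?cut \<A> {x. x \<bullet> i < c})) (\<Union>(?cut \<B> {x. x \<bullet> i < d}))"
      using B1(3)[of d] \<open>\<Union>\<A> \<inter> {x. x \<bullet> i < c} \<noteq> {}\<close> neB(1)
      by (intro IH A1(1) B1(1)) (auto simp: A1(2) B1(2))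
    then show ?thesis unfolding A1(2) B1(2) .
  qed
  have upper: "brunn_minkowski_for (\<Union>\<A> \<inter> {x. x \<bullet> i > c}) (\<Union>\<B> \<inter> {x. x \<bullet> i > d})"
  proof -
    have "card (?cut \<A> {x. x \<bullet> i > c}) < card \<A>"
      by (rule A2(4)[OF UV(1)]) (use UV(3) in force)
    then have "brunn_minkowski_for (\<Union>(?cut \<A> {x. x \<bullet> i > c})) (\<Union>(?cut \<B> {x. x \<bullet> i > d}))"
      using B2(3)[of d] \<open>\<Union>\<A> \<inter> {x. x \<bullet> i > c} \<noteq> {}\<close> neB(2)
      by (intro IH A2(1) B2(1)) (auto simp: A2(2) B2(2))
    then show ?thesis unfolding A2(2) B2(2) .
  qed
  show ?thesis
    using \<theta> posA by (intro brunn_minkowski_cut[OF i oA oB _ d _ _ lower upper]) (auto simp: \<theta>_def)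
qed

lemma brunn_minkowski_boxes:
  fixes \<A> \<B> :: "'a::euclidean_space set set"
  assumes "box_family \<A>" "\<A> \<noteq> {}" "box_family \<B>" "\<B> \<noteq> {}"
  shows "brunn_minkowski_for (\<Union>\<A>) (\<Union>\<B>)"
  using assms
proof (induction "card \<A> + card \<B>" arbitrary: \<A> \<B> rule: less_induct)
  case less
  have fin: "finite \<A>" "finite \<B>" using less.prems by (auto simp: box_family_def)
  then have "card \<A> > 0" "card \<B> > 0" using less.prems by (auto simp: card_gt_0_iff)
  then consider "card \<A> \<ge> 2" | "card \<B> \<ge> 2" | "card \<A> = 1" "card \<B> = 1" by linarith
  then show ?case
  proof cases
    case 1
    then show ?thesis
      using less by (intro brunn_minkowski_boxes_step[of \<A> \<B>]) auto
  next
    case 2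
    then have "brunn_minkowski_for (\<Union>\<B>) (\<Union>\<A>)"
      using less by (intro brunn_minkowski_boxes_step[of \<B> \<A>]) auto
    then show ?thesis by (simp add: brunn_minkowski_for_commute)
  next
    case 3
    then obtain X Y where XY: "\<A> = {X}" "\<B> = {Y}" by (auto simp: card_1_singleton_iff)
    then obtain a b c d where eq: "X = box a b" "Y = box c d" and ne: "box a b \<noteq> {}" "box c d \<noteq> {}"
      using less.prems unfolding box_family_def by auto
    have ne': "box (a + c) (b + d) \<noteq> {}"
      using ne unfolding box_ne_empty by (auto simp: inner_simps add_strict_mono)
    have "measure lborel (box a b) powr (1 / DIM('a)) + measure lborel (box c d) powr (1 / DIM('a))
       \<le> (\<Prod>i\<in>Basis. (b \<bullet> i - a \<bullet> i) + (d \<bullet> i - c \<bullet> i)) powr (1 / DIM('a))"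
      unfolding measure_box_nonempty[OF ne(1)] measure_box_nonempty[OF ne(2)]
      using ne unfolding box_ne_empty by (intro prod_add_root_ge) auto
    also have "(\<Prod>i\<in>Basis. (b \<bullet> i - a \<bullet> i) + (d \<bullet> i - c \<bullet> i)) = measure lborel (box (a + c) (b + d))"
      unfolding measure_box_nonempty[OF ne'] by (intro prod.cong) (auto simp: inner_simps)
    also have "measure lborel (box (a + c) (b + d)) powr (1 / DIM('a))
       \<le> measure lborel (minkowski_sum (box a b) (box c d)) powr (1 / DIM('a))"
      using minkowski_sum_box[OF ne]
      by (intro powr_mono2 measure_mono_fmeasurable fmeasurable_open_bounded
          open_minkowski_sum bounded_minkowski_sum) auto
    finally show ?thesis
      by (simp add: brunn_minkowski_for_def XY eq)
  qed
qed

text \<open>An open set is a countable union of closed boxes, finitely many of which already exceed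
  \<open>a\<close> in volume. A division of their union into nonoverlapping boxes is replaced by the
  interiors, at the cost of a null set of faces.\<close>

lemma open_approx_box_family:
  fixes E :: "'a::euclidean_space set"
  assumes E: "open E" "bounded E" and a: "a < measure lborel E"
  obtains \<A> where "box_family \<A>" "\<Union>\<A> \<subseteq> E" "a < measure lborel (\<Union>\<A>)"
proof -
  obtain \<D> where \<D>: "countable \<D>" "\<D> \<subseteq> Pow E" "\<And>X. X \<in> \<D> \<Longrightarrow> \<exists>a b. X = cbox a b" "\<Union>\<D> = E"
    using open_countable_Union_open_cbox[OF E(1)] by metis
  show ?thesis
  proof (cases "\<D> = {}")
    case True
    then have "E = {}" using \<D> by auto
    then show ?thesis using a by (intro that[of "{}"]) (auto simp: box_family_def)
  next
    case False
    define F where "F k = (\<Union>j\<le>k. from_nat_into \<D> j)" for k :: nat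
    have "(\<lambda>k. measure lborel (F k)) \<longlonglongrightarrow> measure lborel (\<Union>k. F k)"
    proof (rule Lim_measure_incseq)
      have "F k \<in> sets lborel" for k
        unfolding F_def using \<D>(3) from_nat_into[OF False]
          by (intro sets.finite_UN) (auto, metis borel_closed closed_cbox)
      then show "range F \<subseteq> sets lborel" by auto
      show "incseq F" unfolding F_def incseq_def by force
      have "(\<Union>k. F k) \<subseteq> E"
        unfolding F_def using \<D>(2) from_nat_into[OF False] by blast
      then have "bounded (\<Union>k. F k)"
        using bounded_subset[OF E(2)] by blast
      then show "emeasure lborel (\<Union>k. F k) \<noteq> \<infinity>"
        using emeasure_bounded_finite[of "\<Union>k. F k"] by simp
    qed
    moreover have "(\<Union>k. F k) = E"
    proof -
      have "(\<Union>k. F k) = (\<Union>k. from_nat_into \<D> k)" unfolding F_def by blast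
      also have "\<dots> = \<Union>\<D>" using range_from_nat_into[OF False \<D>(1)] by simp
      finally show ?thesis using \<D>(4) by simp
    qed
    ultimately have "\<forall>\<^sub>F k in sequentially. a < measure lborel (F k)"
      using a by (auto intro: order_tendstoD)
    then obtain k where k: "a < measure lborel (F k)"
      by (meson eventually_happens trivial_limit_sequentially)
    obtain \<P> where \<P>: "\<P> division_of F k"
      using elementary_unions_intervals[of "from_nat_into \<D> ` {..k}"] \<D>(3) from_nat_into[OF False]
      unfolding F_def by (metis (no_types, lifting) finite_atMost finite_imageI imageE)
    have fin: "finite \<P>" and cb: "\<And>X. X \<in> \<P> \<Longrightarrow> \<exists>a b. X = cbox a b"
      and un: "\<Union>\<P> = F k"
      and disj: "\<And>X Y. X \<in> \<P> \<Longrightarrow> Y \<in> \<P> \<Longrightarrow> X \<noteq> Y \<Longrightarrow> interior X \<inter> interior Y = {}"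
      using \<P> unfolding division_of_def by auto
    define \<A> where "\<A> = interior ` \<P> - {{}}"
    have A: "box_family \<A>"
      unfolding box_family_def
    proof (intro conjI ballI)
      show "disjoint \<A>"
        unfolding \<A>_def disjoint_def using disj by blast
      fix X assume "X \<in> \<A>"
      then show "\<exists>a b. X = box a b" unfolding \<A>_def using cb interior_cbox by (metis DiffD1 imageE)
    qed (use fin in \<open>auto simp: \<A>_def\<close>)
    have sub: "\<Union>\<A> \<subseteq> F k" unfolding un[symmetric] \<A>_def using interior_subset by blast
    moreover have "F k \<subseteq> E"
      unfolding F_def using \<D>(2) from_nat_into[OF False] by blast
    moreover have "measure lborel (F k) = measure lborel (\<Union>\<A>)"
    proof -
      let ?N = "\<Union>X\<in>\<P>. frontier X"
      have N: "negligible ?N"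
        using fin cb by (intro negligible_Union finite_imageI)
          (auto, metis negligible_convex_frontier convex_box(1))
      have Nc: "closed ?N" using fin by (intro closed_UN) auto
      have nul: "?N \<in> null_sets lborel"
        using N Nc by (intro null_setsI) (auto simp: negligible_iff_emeasure0 borel_closed)
      have "F k - ?N = \<Union>\<A> - ?N"
      proof (intro equalityI subsetI)
        fix x assume x: "x \<in> F k - ?N"
        then obtain X where "X \<in> \<P>" "x \<in> X" "x \<notin> frontier X" unfolding un[symmetric] by blast
        then have "x \<in> interior X" using closure_subset by (auto simp: frontier_def)
        then show "x \<in> \<Union>\<A> - ?N" using x \<open>X \<in> \<P>\<close> unfolding \<A>_def by blast
      qed (use sub in blast)
      moreover have "F k \<in> sets lborel"
        unfolding un[symmetric] using fin cb
        by (intro sets.finite_Union subsetI) (auto, metis borel_closed closed_cbox)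
      moreover have "\<Union>\<A> \<in> sets lborel" using box_family_open_bounded[OF A] by simp
      ultimately show ?thesis using nul measure_Diff_null_set by metis
    qed
    ultimately show ?thesis using that[OF A] k by auto
  qed
qed

text \<open>Box families inside A and B that carry more than the fraction t of the volumes give the
  inequality with this factor, because their sum lies in the sum of A and B. Then t tends to
  1.\<close>

theorem brunn_minkowski_open:
  fixes A B :: "'a::euclidean_space set"
  assumes A: "open A" "bounded A" "A \<noteq> {}" and B: "open B" "bounded B" "B \<noteq> {}"
  shows "measure lborel A powr (1 / DIM('a)) + measure lborel B powr (1 / DIM('a))
       \<le> measure lborel (minkowski_sum A B) powr (1 / DIM('a))"
proof -
  let ?N = "1 / real DIM('a)" and ?\<mu> = "measure (lborel :: 'a measure)"
  have pos: "?\<mu> A > 0" "?\<mu> B > 0" using measure_open_pos A B by auto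
  have *: "(t * ?\<mu> A) powr ?N + (t * ?\<mu> B) powr ?N \<le> ?\<mu> (minkowski_sum A B) powr ?N"
    if t: "0 < t" "t < 1" for t
  proof -
    have lt: "t * ?\<mu> A < ?\<mu> A" "t * ?\<mu> B < ?\<mu> B" using pos t by auto
    obtain \<A> where \<A>: "box_family \<A>" "\<Union>\<A> \<subseteq> A" "t * ?\<mu> A < ?\<mu> (\<Union>\<A>)"
      using open_approx_box_family[OF A(1,2) lt(1)] by metis
    obtain \<B> where \<B>: "box_family \<B>" "\<Union>\<B> \<subseteq> B" "t * ?\<mu> B < ?\<mu> (\<Union>\<B>)"
      using open_approx_box_family[OF B(1,2) lt(2)] by metis
    have "0 < t * ?\<mu> A" "0 < t * ?\<mu> B" using t pos by auto
    then have "?\<mu> (\<Union>\<A>) \<noteq> 0" "?\<mu> (\<Union>\<B>) \<noteq> 0"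
      using \<A>(3) \<B>(3) by linarith+
    then have "\<A> \<noteq> {}" "\<B> \<noteq> {}"
      by auto
    have "(t * ?\<mu> A) powr ?N + (t * ?\<mu> B) powr ?N \<le> ?\<mu> (\<Union>\<A>) powr ?N + ?\<mu> (\<Union>\<B>) powr ?N"
      using \<A>(3) \<B>(3) t pos by (intro add_mono powr_mono2) auto
    also have "\<dots> \<le> ?\<mu> (minkowski_sum (\<Union>\<A>) (\<Union>\<B>)) powr ?N"
      using brunn_minkowski_boxes[OF \<A>(1) \<open>\<A> \<noteq> {}\<close> \<B>(1) \<open>\<B> \<noteq> {}\<close>]
      unfolding brunn_minkowski_for_def .
    also have "\<dots> \<le> ?\<mu> (minkowski_sum A B) powr ?N"
      using A(1,2) B(1,2) \<A>(2) \<B>(2)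
        open_minkowski_sum[OF box_family_open_bounded(1)[OF \<A>(1)], of "\<Union>\<B>"]
      by (intro powr_mono2 measure_mono_fmeasurable minkowski_sum_mono fmeasurable_open_bounded
          open_minkowski_sum bounded_minkowski_sum) auto
    finally show ?thesis .
  qed
  have "((\<lambda>t. (t * ?\<mu> A) powr ?N + (t * ?\<mu> B) powr ?N) \<longlongrightarrow> (1 * ?\<mu> A) powr ?N + (1 * ?\<mu> B) powr ?N)
      (at_left 1)"
    using pos by (intro tendsto_intros) auto
  moreover have "\<forall>\<^sub>F t in at_left 1. (t * ?\<mu> A) powr ?N + (t * ?\<mu> B) powr ?N
       \<le> ?\<mu> (minkowski_sum A B) powr ?N"
    using * by (intro eventually_at_leftI[of 0]) auto
  ultimately show ?thesis
    using tendsto_upperbound[of _ _ "at_left (1::real)"] by fastforce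
qed

text \<open>Brunn-Minkowski with a ball of radius d as second summand. Volumes enter through strict
  comparisons with numbers because the rearrangement tests superlevel sets in this form. The case d
  = 0 is separate, the open ball being empty.\<close>

lemma measure_enlarge_ge:
  fixes E :: "'a::euclidean_space set"
  assumes E: "open E" "bounded E" and a: "0 < a" "ennreal a < emeasure lborel E" and d: "0 \<le> d"
    and b: "b powr (1 / DIM('a)) \<le> a powr (1 / DIM('a)) + unit_ball_vol DIM('a) powr (1 / DIM('a)) * d"
      "0 \<le> b"
  shows "ennreal b < emeasure lborel (\<Union>x\<in>E. cball x d)"
proof -
  let ?N = "1 / real DIM('a)" and ?\<mu> = "measure (lborel :: 'a measure)"
  have emE: "emeasure lborel E = ennreal (?\<mu> E)"
    using emeasure_bounded_finite[OF E(2)] by (simp add: emeasure_eq_ennreal_measure)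
  then have aE: "a < ?\<mu> E" using a by (simp add: ennreal_less_iff)
  show ?thesis
  proof (cases "d = 0")
    case True
    then have "b powr ?N \<le> a powr ?N" using b by simp
    then have "b \<le> a" using powr_less_mono2[of ?N a b] a(1) by (cases "a < b") auto
    then show ?thesis using True aE b by (simp add: emE ennreal_less_iff)
  next
    case False
    then have d': "d > 0" using d by simp
    let ?M = "minkowski_sum E (ball 0 d)"
    have ne: "E \<noteq> {}" using aE a by auto
    have M: "open ?M" "bounded ?M"
      using open_minkowski_sum[OF E(1)] bounded_minkowski_sum[OF E(2) bounded_ball] by blast+
    have "?\<mu> (ball 0 d) powr ?N = (unit_ball_vol DIM('a) * d powr DIM('a)) powr ?N"
      using d' by (simp add: content_ball powr_realpow)
    also have "\<dots> = unit_ball_vol DIM('a) powr ?N * d"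
      using d' by (simp add: powr_mult powr_powr)
    finally have ball: "?\<mu> (ball 0 d) powr ?N = unit_ball_vol DIM('a) powr ?N * d" .
    have "b powr ?N \<le> a powr ?N + unit_ball_vol DIM('a) powr ?N * d" using b by simp
    also have "\<dots> < ?\<mu> E powr ?N + unit_ball_vol DIM('a) powr ?N * d"
      using a aE by (simp add: powr_less_mono2)
    also have "\<dots> \<le> ?\<mu> ?M powr ?N"
      using brunn_minkowski_open[OF E ne open_ball bounded_ball, of 0 d] d' unfolding ball by simp
    finally have "b powr ?N < ?\<mu> ?M powr ?N" .
    then have "b < ?\<mu> ?M"
      by (rule contrapos_pp) (simp add: not_less powr_mono2)
    then have "ennreal b < ennreal (?\<mu> ?M)" using b by (simp add: ennreal_less_iff)
    also have "\<dots> = emeasure lborel ?M"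
      using emeasure_bounded_finite[OF M(2)] by (simp add: emeasure_eq_ennreal_measure)
    also have "\<dots> \<le> emeasure lborel (\<Union>x\<in>E. cball x d)"
    proof (rule emeasure_mono)
      show "?M \<subseteq> (\<Union>x\<in>E. cball x d)"
      proof
        fix z assume "z \<in> ?M"
        then obtain x y where "x \<in> E" "norm y < d" "z = x + y" unfolding minkowski_sum_def by auto
        then show "z \<in> (\<Union>x\<in>E. cball x d)" by (intro UN_I[of x]) (auto simp: dist_norm)
      qed
      have "(\<Union>x\<in>E. cball x d) = minkowski_sum E (cball 0 d)"
      proof (intro set_eqI iffI)
        fix z assume "z \<in> (\<Union>x\<in>E. cball x d)"
        then obtain x where x: "x \<in> E" "dist x z \<le> d" by auto
        then have "z - x \<in> cball 0 d" "z = x + (z - x)" by (simp_all add: dist_norm norm_minus_commute)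
        then show "z \<in> minkowski_sum E (cball 0 d)" unfolding minkowski_sum_def using x by blast
      next
        fix z assume "z \<in> minkowski_sum E (cball 0 d)"
        then obtain x y where "x \<in> E" "norm y \<le> d" "z = x + y" unfolding minkowski_sum_def by auto
        then show "z \<in> (\<Union>x\<in>E. cball x d)" by (intro UN_I[of x]) (auto simp: dist_norm)
      qed
      then show "(\<Union>x\<in>E. cball x d) \<in> sets lborel" using open_minkowski_sum[OF E(1)] by simp
    qed
    finally show ?thesis .
  qed
qed


section \<open>The capacity of a condenser in the unit ball\<close>

text \<open>The power function lies above its tangent at b. In \<open>displacement_cost\<close> this
  bounds the growth of a radius by that of the volume.\<close>

lemma Bernoulli_power_diff:
  fixes a b :: real
  assumes "0 \<le> b" "b \<le> a"
  shows "real n * b ^ (n - 1) * (a - b) \<le> a ^ n - b ^ n"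
proof (induction n)
  case (Suc n)
  have "b ^ n * (a - b) \<le> a ^ n * (a - b)"
    using assms by (intro mult_right_mono power_mono) auto
  moreover have "b * (real n * b ^ (n - 1) * (a - b)) \<le> b * (a ^ n - b ^ n)"
    using Suc assms by (intro mult_left_mono) auto
  moreover have "b * (real n * b ^ (n - 1) * (a - b)) = real n * b ^ n * (a - b)"
    by (cases n) (auto simp: algebra_simps)
  ultimately show ?case by (simp add: algebra_simps)
qed simp

lemma Young_scaled:
  fixes p q s u :: real
  assumes "p > 1" "q = p / (p - 1)" "s \<ge> 0" "u \<ge> 0"
  shows "s * u \<le> s powr p / p + u powr q / q"
proof -
  have q: "q > 1" "1 / p + 1 / q = 1"
    using assms(1) by (simp_all add: assms(2) field_simps)
  show ?thesis using Youngs_inequality[OF assms(1) q assms(3,4)] .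
qed

section \<open>Distribution function and decreasing rearrangement\<close>

definition volume_above :: "('a::euclidean_space \<Rightarrow> real) \<Rightarrow> real \<Rightarrow> ennreal" where
  "volume_above F t = emeasure lborel {x. F x > t}"

text \<open>The decreasing rearrangement of \<open>F\<close>, as a function of volume.\<close>

definition rearrangement :: "('a::euclidean_space \<Rightarrow> real) \<Rightarrow> real \<Rightarrow> ennreal" where
  "rearrangement F W = emeasure lborel {t. t > 0 \<and> volume_above F t > ennreal W}"

lemma volume_above_measurable [measurable]:
  assumes [measurable]: "F \<in> borel_measurable (borel :: 'a::euclidean_space measure)"
  shows "volume_above F \<in> borel_measurable borel"
proof -
  have "volume_above F = (\<lambda>t. \<integral>\<^sup>+x. indicator {tx. F (snd tx) > fst tx} (t, x) \<partial>lborel)"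
  proof
    fix t
    have "(\<integral>\<^sup>+x. indicator {tx. F (snd tx) > fst tx} (t, x) \<partial>lborel) = (\<integral>\<^sup>+x. indicator {x. F x > t} x \<partial>lborel)"
      by (intro nn_integral_cong) (auto simp: indicator_def)
    then show "volume_above F t = (\<integral>\<^sup>+x. indicator {tx. F (snd tx) > fst tx} (t, x) \<partial>lborel)"
      by (simp add: volume_above_def)
  qed
  moreover have "(\<lambda>t. \<integral>\<^sup>+x. indicator {tx. F (snd tx) > fst tx} (t, x) \<partial>lborel) \<in> borel_measurable (borel :: real measure)"
    by measurable
  ultimately show ?thesis by simp
qed

text \<open>Turns a possibly infinite volume into a length, so that Fubini can be applied a second
  time in \<open>nn_integral_rearrangement\<close>.\<close>

lemma emeasure_below_ennreal: "emeasure lborel {W. W > 0 \<and> ennreal W < a} = a"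
proof (cases a)
  case (real r)
  then have "{W. W > 0 \<and> ennreal W < a} = {0<..<r}" by (auto simp: ennreal_less_iff)
  then show ?thesis using real by simp
next
  case top
  then have "{W. W > 0 \<and> ennreal W < a} = {0<..}" by auto
  moreover have "emeasure lborel {0::real<..} = top"
  proof -
    have "of_nat n \<le> emeasure lborel {0::real<..}" for n
    proof -
      have "emeasure lborel {0<..<real n} \<le> emeasure lborel {0::real<..}"
        by (intro emeasure_mono) auto
      then show ?thesis by (simp add: ennreal_of_nat_eq_real_of_nat)
    qed
    then show ?thesis by (metis ennreal_Ex_less_of_nat linorder_not_less less_top)
  qed
  ultimately show ?thesis using top by simp
qed

lemma rearrangement_measurable [measurable]:
  assumes [measurable]: "F \<in> borel_measurable (borel :: 'a::euclidean_space measure)"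
  shows "rearrangement F \<in> borel_measurable borel"
proof -
  have "rearrangement F = (\<lambda>W. \<integral>\<^sup>+t. indicator {Wt. snd Wt > 0 \<and> volume_above F (snd Wt) > ennreal (fst Wt)} (W, t) \<partial>lborel)"
  proof
    fix W
    have "(\<integral>\<^sup>+t. indicator {Wt. snd Wt > 0 \<and> volume_above F (snd Wt) > ennreal (fst Wt)} (W, t) \<partial>lborel)
      = (\<integral>\<^sup>+t. indicator {t. t > 0 \<and> volume_above F t > ennreal W} t \<partial>lborel)"
      by (intro nn_integral_cong) (auto simp: indicator_def)
    then show "rearrangement F W = (\<integral>\<^sup>+t. indicator {Wt. snd Wt > 0 \<and> volume_above F (snd Wt) > ennreal (fst Wt)} (W, t) \<partial>lborel)"
      by (simp add: rearrangement_def)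
  qed
  moreover have "(\<lambda>W. \<integral>\<^sup>+t. indicator {Wt. snd Wt > 0 \<and> volume_above F (snd Wt) > ennreal (fst Wt)} (W, t) \<partial>lborel)
      \<in> borel_measurable (borel :: real measure)"
    by measurable
  ultimately show ?thesis by simp
qed

text \<open>The layer-cake formula used twice: both sides are the area of the set of pairs (t, W)
  with 0 < t and 0 < W < \<open>volume_above F t\<close>. Negative values of \<open>F\<close> vanish
  under \<open>ennreal\<close>.\<close>

lemma nn_integral_rearrangement:
  assumes [measurable]: "F \<in> borel_measurable (borel :: 'a::euclidean_space measure)"
  shows "(\<integral>\<^sup>+W\<in>{0<..}. rearrangement F W \<partial>lborel) = (\<integral>\<^sup>+x. ennreal (F x) \<partial>lborel)"
proof -
  have "(\<integral>\<^sup>+x. ennreal (F x) \<partial>lborel) = (\<integral>\<^sup>+x. \<integral>\<^sup>+t. indicator {z. fst z > 0 \<and> F (snd z) > fst z} (t, x) \<partial>lborel \<partial>lborel)"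
  proof (rule nn_integral_cong)
    fix x
    have "(\<integral>\<^sup>+t. indicator {z. fst z > 0 \<and> F (snd z) > fst z} (t, x) \<partial>lborel) = (\<integral>\<^sup>+t. indicator {0<..<F x} t \<partial>lborel)"
      by (intro nn_integral_cong) (auto simp: indicator_def)
    also have "\<dots> = ennreal (F x)"
      by (cases "F x \<ge> 0") (auto simp: ennreal_neg)
    finally show "ennreal (F x) = (\<integral>\<^sup>+t. indicator {z. fst z > 0 \<and> F (snd z) > fst z} (t, x) \<partial>lborel)" ..
  qed
  also have "\<dots> = (\<integral>\<^sup>+t. \<integral>\<^sup>+x. indicator {z. fst z > 0 \<and> F (snd z) > fst z} (t, x) \<partial>lborel \<partial>lborel)"
    by (rule lborel_pair.Fubini') measurable
  also have "\<dots> = (\<integral>\<^sup>+t. \<integral>\<^sup>+W. indicator {z. fst z > 0 \<and> snd z > 0 \<and> ennreal (snd z) < volume_above F (fst z)} (t, W) \<partial>lborel \<partial>lborel)"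
  proof (rule nn_integral_cong)
    fix t :: real
    have "(\<integral>\<^sup>+x. indicator {z. fst z > 0 \<and> F (snd z) > fst z} (t, x) \<partial>lborel) = (\<integral>\<^sup>+x. indicator {0<..} t * indicator {x. F x > t} x \<partial>lborel)"
      by (intro nn_integral_cong) (auto simp: indicator_def)
    also have "\<dots> = indicator {0<..} t * volume_above F t"
      by (simp add: nn_integral_cmult volume_above_def)
    also have "\<dots> = indicator {0<..} t * emeasure lborel {W. W > 0 \<and> ennreal W < volume_above F t}"
      by (simp add: emeasure_below_ennreal)
    also have "\<dots> = (\<integral>\<^sup>+W. indicator {0<..} t * indicator {W. W > 0 \<and> ennreal W < volume_above F t} W \<partial>lborel)"
      by (simp add: nn_integral_cmult)
    also have "\<dots> = (\<integral>\<^sup>+W. indicator {z. fst z > 0 \<and> snd z > 0 \<and> ennreal (snd z) < volume_above F (fst z)} (t, W) \<partial>lborel)"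
      by (intro nn_integral_cong) (auto simp: indicator_def)
    finally show "(\<integral>\<^sup>+x. indicator {z. fst z > 0 \<and> F (snd z) > fst z} (t, x) \<partial>lborel)
       = (\<integral>\<^sup>+W. indicator {z. fst z > 0 \<and> snd z > 0 \<and> ennreal (snd z) < volume_above F (fst z)} (t, W) \<partial>lborel)" .
  qed
  also have "\<dots> = (\<integral>\<^sup>+W. \<integral>\<^sup>+t. indicator {z. fst z > 0 \<and> snd z > 0 \<and> ennreal (snd z) < volume_above F (fst z)} (t, W) \<partial>lborel \<partial>lborel)"
    by (rule lborel_pair.Fubini'[symmetric]) measurable
  also have "\<dots> = (\<integral>\<^sup>+W\<in>{0<..}. rearrangement F W \<partial>lborel)"
  proof (rule nn_integral_cong)
    fix W :: real
    have "(\<integral>\<^sup>+t. indicator {z. fst z > 0 \<and> snd z > 0 \<and> ennreal (snd z) < volume_above F (fst z)} (t, W) \<partial>lborel)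
       = (\<integral>\<^sup>+t. indicator {0<..} W * indicator {t. t > 0 \<and> volume_above F t > ennreal W} t \<partial>lborel)"
      by (intro nn_integral_cong) (auto simp: indicator_def)
    also have "\<dots> = rearrangement F W * indicator {0<..} W"
      by (simp add: nn_integral_cmult rearrangement_def mult.commute)
    finally show "(\<integral>\<^sup>+t. indicator {z. fst z > 0 \<and> snd z > 0 \<and> ennreal (snd z) < volume_above F (fst z)} (t, W) \<partial>lborel)
       = rearrangement F W * indicator {0<..} W" .
  qed
  finally show ?thesis ..
qed

section \<open>Hopf-Lax regularisation of a condenser potential\<close>

text \<open>The solution at time h of the Hamilton-Jacobi equation with Hamiltonian |v|^p / p and
  datum w, for conjugate p and q. To first order it adds h |grad w|^p / p, and geometrically it
  enlarges superlevel sets by balls; the two views give the upper and the lower bound for its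
  integral.\<close>

definition hopf_lax :: "real \<Rightarrow> real \<Rightarrow> ('a::euclidean_space \<Rightarrow> real) \<Rightarrow> 'a \<Rightarrow> real" where
  "hopf_lax q h w x = (SUP y. w y - h * (dist x y / h) powr q / q)"

text \<open>\<sigma> stands for the modulus of the gradient at a finite scale: \<open>lip\<close>
  controls differences at distances below R. The volume of the plateau w = 1 strictly exceeds V,
  which leaves room to displace volumes upwards.\<close>

locale condenser_potential =
  fixes w \<sigma> :: "'a::euclidean_space \<Rightarrow> real" and p q R V :: real
  assumes p: "p > 1" and q_def: "q = p / (p - 1)"
    and w_cont: "continuous_on UNIV w" and w_bounds: "\<And>x. 0 \<le> w x" "\<And>x. w x \<le> 1"
    and w_supp: "\<And>x. norm x \<ge> 1 \<Longrightarrow> w x = 0"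
    and \<sigma>_meas [measurable]: "\<sigma> \<in> borel_measurable borel" and \<sigma>_nonneg: "\<And>x. \<sigma> x \<ge> 0"
    and R: "R > 0" and lip: "\<And>x y. dist x y < R \<Longrightarrow> w y - w x \<le> \<sigma> x * dist x y"
    and V: "V > 0" "ennreal V < emeasure lborel {x. w x = 1}"
begin

definition "\<Omega> = unit_ball_vol (real DIM('a))"

lemma \<Omega>_pos: "\<Omega> > 0" by (simp add: \<Omega>_def)

lemma emeasure_unit_ball: "emeasure lborel (ball (0::'a) 1) = ennreal \<Omega>"
  by (simp add: emeasure_ball \<Omega>_def)

lemma q_gt_1: "q > 1" using p by (simp add: q_def)

lemma w_meas [measurable]: "w \<in> borel_measurable borel"
  using w_cont by (rule borel_measurable_continuous_onI)

abbreviation cost :: "real \<Rightarrow> real \<Rightarrow> real" where "cost h d \<equiv> h * (d / h) powr q / q"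

lemma cost_nonneg: "h > 0 \<Longrightarrow> cost h d \<ge> 0"
  using q_gt_1 by simp

lemma cost_mono: "h > 0 \<Longrightarrow> 0 \<le> d \<Longrightarrow> d \<le> d' \<Longrightarrow> cost h d \<le> cost h d'"
  using q_gt_1 by (intro divide_right_mono mult_left_mono powr_mono2) auto

lemma hopf_lax_bdd: "h > 0 \<Longrightarrow> bdd_above (range (\<lambda>y. w y - cost h (dist x y)))"
  using cost_nonneg w_bounds(2) by (intro bdd_aboveI[of _ 1]) (auto, smt (verit))

lemma hopf_lax_ge: "h > 0 \<Longrightarrow> w y - cost h (dist x y) \<le> hopf_lax q h w x"
  unfolding hopf_lax_def using hopf_lax_bdd by (intro cSUP_upper) auto

lemma hopf_lax_ge_self: "h > 0 \<Longrightarrow> w x \<le> hopf_lax q h w x"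
  using hopf_lax_ge[of h x x] q_gt_1 by simp

text \<open>Superlevel sets are unions of open sets over all y, which settles measurability of this
  uncountable supremum.\<close>

lemma hopf_lax_meas:
  assumes "h > 0" shows "hopf_lax q h w \<in> borel_measurable borel"
proof (rule borel_measurableI_greater)
  fix t
  have "{x. t < hopf_lax q h w x} = (\<Union>y. {x. t < w y - cost h (dist x y)})"
    unfolding hopf_lax_def using less_cSUP_iff[OF _ hopf_lax_bdd[OF assms]] by auto
  moreover have "open (\<Union>y. {x. t < w y - cost h (dist x y)})"
    using q_gt_1 assms by (intro open_UN ballI open_Collect_less continuous_intros continuous_on_powr') auto
  ultimately show "{x \<in> space borel. t < hopf_lax q h w x} \<in> sets borel" by simp
qed

text \<open>By \<open>small\<close> and w \<le> 1, a competitor at distance at least R contributes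
  nothing positive. At smaller distances \<open>lip\<close> applies, and Young's inequality for
  \<sigma> x and dist x y / h leaves a term that the cost cancels exactly.\<close>

lemma hopf_lax_le:
  assumes h: "h > 0" and small: "cost h R \<ge> 1"
  shows "hopf_lax q h w x \<le> w x + h * (\<sigma> x powr p / p)"
  unfolding hopf_lax_def
proof (rule cSUP_least)
  fix y
  show "w y - cost h (dist x y) \<le> w x + h * (\<sigma> x powr p / p)"
  proof (cases "w y - cost h (dist x y) > 0")
    case True
    then have "cost h (dist x y) < 1" using w_bounds(2)[of y] by linarith
    then have "dist x y < R" using cost_mono[OF h, of R "dist x y"] R small by fastforce
    then have "w y - w x \<le> \<sigma> x * dist x y" by (rule lip)
    moreover have "\<sigma> x * (dist x y / h) \<le> \<sigma> x powr p / p + (dist x y / h) powr q / q"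
      using h by (intro Young_scaled p q_def \<sigma>_nonneg) auto
    then have "h * (\<sigma> x * (dist x y / h)) \<le> h * (\<sigma> x powr p / p + (dist x y / h) powr q / q)"
      using h by (intro mult_left_mono) auto
    then have "\<sigma> x * dist x y \<le> h * (\<sigma> x powr p / p) + cost h (dist x y)"
      using h by (simp add: distrib_left)
    ultimately show ?thesis by linarith
  next
    case False
    moreover have "h * (\<sigma> x powr p / p) \<ge> 0" using h p by simp
    ultimately show ?thesis using w_bounds(1)[of x] by linarith
  qed
qed simp

text \<open>If w exceeds t + cost at a point, taking this point as competitor shows that the
  regularisation exceeds t within distance d of it. So its superlevel set contains a
  d-neighbourhood, whose volume Brunn-Minkowski bounds from below.\<close>

lemma volume_above_hopf_lax:
  assumes h: "h > 0" and t: "t > 0" and d: "d \<ge> 0"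
    and W': "W' > 0" "ennreal W' < volume_above w (t + cost h d)"
    and W: "W \<ge> 0" "W powr (1 / DIM('a)) \<le> W' powr (1 / DIM('a)) + \<Omega> powr (1 / DIM('a)) * d"
  shows "ennreal W < volume_above (hopf_lax q h w) t"
proof -
  let ?E = "{x. w x > t + cost h d}"
  have "open ?E" using w_cont by (intro open_Collect_less continuous_intros)
  moreover have "?E \<subseteq> ball 0 1"
  proof
    fix x assume "x \<in> ?E"
    then have "w x > 0" using t cost_nonneg[OF h, of d] by simp
    then show "x \<in> ball 0 1" using w_supp[of x] by fastforce
  qed
  then have "bounded ?E" by (rule bounded_subset[OF bounded_ball])
  ultimately have "ennreal W < emeasure lborel (\<Union>x\<in>?E. cball x d)"
    using W' W d unfolding volume_above_def \<Omega>_def by (intro measure_enlarge_ge[where a = W']) auto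
  also have "\<dots> \<le> volume_above (hopf_lax q h w) t"
    unfolding volume_above_def
  proof (rule emeasure_mono)
    show "(\<Union>x\<in>?E. cball x d) \<subseteq> {x. t < hopf_lax q h w x}"
    proof clarsimp
      fix x y assume y: "t + cost h d < w y" and xy: "dist y x \<le> d"
      have "cost h (dist x y) \<le> cost h d" using xy by (intro cost_mono h) (auto simp: dist_commute)
      then have "t < w y - cost h (dist x y)" using y by simp
      then show "t < hopf_lax q h w x" using hopf_lax_ge[OF h, of y x] by simp
    qed
    have [measurable]: "hopf_lax q h w \<in> borel_measurable borel" by (rule hopf_lax_meas[OF h])
    show "{x. t < hopf_lax q h w x} \<in> sets lborel" by measurable
  qed
  finally show ?thesis .
qed

text \<open>Levels above the cost are lowered by it, and translation preserves the length of a set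
  of levels. The remaining levels lie in an interval as long as the cost.\<close>

lemma rearrangement_hopf_lax:
  assumes h: "h > 0" and d: "d \<ge> 0" and W': "W' > 0"
    and W: "W \<ge> 0" "W powr (1 / DIM('a)) \<le> W' powr (1 / DIM('a)) + \<Omega> powr (1 / DIM('a)) * d"
  shows "rearrangement w W' \<le> rearrangement (hopf_lax q h w) W + ennreal (cost h d)"
proof -
  let ?l = "cost h d"
  have [measurable]: "hopf_lax q h w \<in> borel_measurable borel" by (rule hopf_lax_meas[OF h])
  let ?T = "{t. t > 0 \<and> volume_above (hopf_lax q h w) t > ennreal W}"
  have T: "?T \<in> sets borel" by measurable
  have "{t. t > 0 \<and> volume_above w t > ennreal W'} \<subseteq> {0..?l} \<union> ((+) (-?l)) -` ?T"
  proof
    fix t assume t: "t \<in> {t. t > 0 \<and> volume_above w t > ennreal W'}"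
    show "t \<in> {0..?l} \<union> ((+) (-?l)) -` ?T"
    proof (cases "t \<le> ?l")
      case False
      then have "ennreal W < volume_above (hopf_lax q h w) (t - ?l)"
        using t by (intro volume_above_hopf_lax[OF h _ d W' _ W]) auto
      then show ?thesis using False by simp
    qed (use t in auto)
  qed
  then have "rearrangement w W' \<le> emeasure lborel ({0..?l} \<union> ((+) (-?l)) -` ?T)"
    unfolding rearrangement_def using T
    by (intro emeasure_mono sets.Un) (auto intro: measurable_sets_borel)
  also have "\<dots> \<le> emeasure lborel {0..?l} + emeasure lborel (((+) (-?l)) -` ?T)"
    using T by (intro emeasure_subadditive) (auto intro: measurable_sets_borel)
  also have "emeasure lborel (((+) (-?l)) -` ?T) = emeasure (distr lborel borel ((+) (-?l))) ?T"
    using T by (simp add: emeasure_distr)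
  also have "\<dots> = emeasure lborel ?T"
    using lborel_distr_plus[of "-?l"] by simp
  also have "emeasure lborel {0..?l} = ennreal ?l" using cost_nonneg[OF h, of d] by simp
  finally show ?thesis by (simp add: rearrangement_def add.commute)
qed


lemma volume_above_w_ge_1: "1 \<le> t \<Longrightarrow> volume_above w t = 0"
proof -
  assume "1 \<le> t"
  then have "{x. w x > t} = {}" using w_bounds(2) by (auto simp: not_less intro: order_trans)
  then show ?thesis by (simp add: volume_above_def)
qed

lemma rearrangement_w_le_volume:
  assumes "0 < W" "W \<le> V'" "ennreal V' < emeasure lborel {x. w x = 1}"
  shows "rearrangement w W = 1"
proof -
  have "{t. t > 0 \<and> volume_above w t > ennreal W} = {0<..<1}"
  proof (intro set_eqI iffI)
    fix t assume t: "t \<in> {t. t > 0 \<and> volume_above w t > ennreal W}"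
    then have "t < 1" using volume_above_w_ge_1[of t] by (cases "t < 1") auto
    then show "t \<in> {0<..<1}" using t by simp
  next
    fix t :: real assume t: "t \<in> {0<..<1}"
    have "ennreal W \<le> ennreal V'" using assms by (intro ennreal_leI)
    also have "\<dots> < emeasure lborel {x. w x = 1}" by fact
    also have "\<dots> \<le> volume_above w t"
      unfolding volume_above_def using t by (intro emeasure_mono) auto
    finally show "t \<in> {t. t > 0 \<and> volume_above w t > ennreal W}" using t by simp
  qed
  then show ?thesis by (simp add: rearrangement_def)
qed

lemma rearrangement_w_ge_ball:
  assumes "W \<ge> \<Omega>"
  shows "rearrangement w W = 0"
proof -
  have "volume_above w t \<le> ennreal W" if "t > 0" for t
  proof -
    have "{x. w x > t} \<subseteq> ball 0 1"
      using w_supp that by (metis (mono_tags, lifting) mem_Collect_eq mem_ball_0 not_le order_less_trans less_irrefl subsetI)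
    then have "volume_above w t \<le> emeasure lborel (ball (0::'a) 1)"
      unfolding volume_above_def by (intro emeasure_mono) auto
    also have "\<dots> \<le> ennreal W" using assms by (simp add: emeasure_unit_ball ennreal_leI)
    finally show ?thesis .
  qed
  then have "\<not> ennreal W < volume_above w t" if "t > 0" for t using that by (simp add: not_less)
  then have "{t. t > 0 \<and> volume_above w t > ennreal W} = {}" by blast
  then show ?thesis unfolding rearrangement_def by (simp only: emeasure_empty)
qed

lemma rearrangement_w_le_1: "W > 0 \<Longrightarrow> rearrangement w W \<le> 1"
proof -
  assume "W > 0"
  have "{t. t > 0 \<and> volume_above w t > ennreal W} \<subseteq> {0..1}"
  proof
    fix t assume t: "t \<in> {t. t > 0 \<and> volume_above w t > ennreal W}"
    then have "t < 1" using volume_above_w_ge_1[of t] by (cases "t < 1") auto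
    then show "t \<in> {0..1}" using t by simp
  qed
  then have "rearrangement w W \<le> emeasure lborel {0..1::real}"
    unfolding rearrangement_def by (intro emeasure_mono) auto
  then show ?thesis by simp
qed

lemma rearrangement_w_le_hopf_lax:
  assumes "h > 0"
  shows "rearrangement w W \<le> rearrangement (hopf_lax q h w) W"
proof -
  have [measurable]: "hopf_lax q h w \<in> borel_measurable borel" by (rule hopf_lax_meas[OF assms])
  have "volume_above w t \<le> volume_above (hopf_lax q h w) t" for t
    unfolding volume_above_def using hopf_lax_ge_self[OF assms]
    by (intro emeasure_mono) (auto intro: less_le_trans)
  then show ?thesis
    unfolding rearrangement_def by (intro emeasure_mono) (auto intro: less_le_trans)
qed

lemma less_\<Omega>I:
  assumes "v \<ge> 0" "ennreal v < emeasure lborel {x. w x = 1}"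
  shows "v < \<Omega>"
proof -
  have "{x. w x = 1} \<subseteq> ball 0 1"
  proof
    fix x assume "x \<in> {x. w x = 1}"
    then show "x \<in> ball 0 1" using w_supp[of x] by (cases "norm x \<ge> 1") auto
  qed
  then have "emeasure lborel {x. w x = 1} \<le> ennreal \<Omega>"
    unfolding emeasure_unit_ball[symmetric] by (intro emeasure_mono) auto
  then have "ennreal v < ennreal \<Omega>" using assms by order
  then show ?thesis using assms by (simp add: ennreal_less_iff)
qed

text \<open>Volume is lost at the constant rate \<open>n * \<Omega> * \<kappa>\<close> when the radius moves with speed
  \<open>\<kappa> * r powr (1 - n)\<close>, the gradient flow of the extremal potential.\<close>

lemma displacement_cost:
  assumes h: "h > 0" and \<kappa>: "\<kappa> > 0" and W: "W > 0"
  defines "\<delta> \<equiv> real DIM('a) * \<Omega> * \<kappa> * h"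
  shows "rearrangement w W \<le> rearrangement (hopf_lax q h w) (W + \<delta>)
    + ennreal (h * (\<kappa> powr q / q * (W / \<Omega>) powr (- (q * (real DIM('a) - 1) / real DIM('a)))))"
proof -
  have Npos: "real DIM('a) > 0" by simp
  have \<delta>: "\<delta> > 0" using h \<kappa> \<Omega>_pos by (simp add: \<delta>_def)
  define r' r where "r' = (W / \<Omega>) powr (1 / real DIM('a))" and "r = ((W + \<delta>) / \<Omega>) powr (1 / real DIM('a))"
  have r': "r' > 0" using W \<Omega>_pos by (simp add: r'_def)
  have rr: "r' \<le> r" unfolding r'_def r_def using W \<delta> \<Omega>_pos by (intro powr_mono2 divide_right_mono) auto
  have pw: "r' ^ DIM('a) = W / \<Omega>" "r ^ DIM('a) = (W + \<delta>) / \<Omega>"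
    unfolding r'_def r_def using W \<delta> \<Omega>_pos by (simp_all add: powr_power)
  define d where "d = r - r'"
  \<comment> \<open>Since W grows by \<delta>, the n-th powers of the radii differ by n * \<kappa> *
    h. Hence d / h is at most the speed \<kappa> * r' powr (1 - n).\<close>
  have "real DIM('a) * r' ^ (DIM('a) - 1) * d \<le> r ^ DIM('a) - r' ^ DIM('a)"
    unfolding d_def using r' rr by (intro Bernoulli_power_diff) auto
  also have "\<dots> = real DIM('a) * (\<kappa> * h)"
    unfolding pw using \<Omega>_pos by (simp add: \<delta>_def field_simps)
  finally have "r' ^ (DIM('a) - 1) * d \<le> \<kappa> * h" using Npos by (simp add: mult.assoc)
  moreover have "r' ^ (DIM('a) - 1) = r' powr (real DIM('a) - 1)"
    using r' by (simp add: powr_realpow[symmetric] of_nat_diff Suc_le_eq)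
  ultimately have d_le: "d / h \<le> \<kappa> * r' powr (- (real DIM('a) - 1))"
    using h r' by (simp add: powr_minus_divide field_simps del: minus_diff_eq)
  have "cost h d \<le> h * (\<kappa> * r' powr (- (real DIM('a) - 1))) powr q / q"
    using h q_gt_1 rr d_le by (intro divide_right_mono mult_left_mono powr_mono2) (auto simp: d_def)
  also have "\<dots> = h * (\<kappa> powr q / q * (W / \<Omega>) powr (- (q * (real DIM('a) - 1) / real DIM('a))))"
  proof -
    have "1 / real DIM('a) * (- (real DIM('a) - 1)) * q = - (q * (real DIM('a) - 1) / real DIM('a))"
      by (simp add: field_simps)
    then have "(r' powr (- (real DIM('a) - 1))) powr q = (W / \<Omega>) powr (- (q * (real DIM('a) - 1) / real DIM('a)))"
      unfolding r'_def powr_powr by (rule arg_cong)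
    then show ?thesis using \<kappa> by (simp add: powr_mult)
  qed
  finally have "ennreal (cost h d) \<le> ennreal (h * (\<kappa> powr q / q * (W / \<Omega>) powr (- (q * (real DIM('a) - 1) / real DIM('a)))))"
    by (rule ennreal_leI)
  moreover have "rearrangement w W \<le> rearrangement (hopf_lax q h w) (W + \<delta>) + ennreal (cost h d)"
  proof (rule rearrangement_hopf_lax[OF h])
    have "\<Omega> powr (1 / real DIM('a)) * r' = W powr (1 / real DIM('a))" "\<Omega> powr (1 / real DIM('a)) * r = (W + \<delta>) powr (1 / real DIM('a))"
      unfolding r'_def r_def using W \<delta> \<Omega>_pos by (simp_all add: powr_mult[symmetric])
    then show "(W + \<delta>) powr (1 / real DIM('a)) \<le> W powr (1 / real DIM('a)) + \<Omega> powr (1 / real DIM('a)) * d"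
      by (simp add: d_def algebra_simps)
  qed (use rr W \<delta> in \<open>auto simp: d_def\<close>)
  ultimately show ?thesis by (meson add_left_mono order_trans)
qed

text \<open>The integral of the regularisation is bounded above through the energy, and below by
  displacing every volume W in [V, \<Omega>) to W + \<delta>, where the plateau gains exactly
  \<delta>. All remaining terms carry the factor h, which is divided out; \<kappa> stays free as a
  dual parameter.\<close>

theorem capacity_duality:
  assumes \<kappa>: "\<kappa> > 0"
  shows "ennreal (real DIM('a) * \<Omega> * \<kappa>) \<le> ennreal (1 / p) * (\<integral>\<^sup>+x. ennreal (\<sigma> x powr p) \<partial>lborel)
    + ennreal (\<kappa> powr q / q) * (\<integral>\<^sup>+W\<in>{V..<\<Omega>}. ennreal ((W / \<Omega>) powr (- (q * (real DIM('a) - 1) / real DIM('a)))) \<partial>lborel)"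
    (is "_ \<le> ennreal (1 / p) * ?S + ennreal (\<kappa> powr q / q) * ?K")
proof -
  obtain V' where V': "V < V'" "ennreal V' < emeasure lborel {x. w x = 1}"
  proof -
    obtain b where b: "ennreal V < b" "b < emeasure lborel {x. w x = 1}" using dense V(2) by blast
    then obtain v where v: "b = ennreal v" "v \<ge> 0" by (cases b) auto
    then show ?thesis using that b V by (auto simp: ennreal_less_iff)
  qed
  \<comment> \<open>The first bound on h yields \<open>cost h R \<ge> 1\<close>, so that only
    competitors within R count. The second yields V + \<delta> \<le> V', so that the plateau covers
    all volumes below V + \<delta>.\<close>
  define h where "h = min ((R powr q / q) powr (1 / (q - 1))) ((V' - V) / (real DIM('a) * \<Omega> * \<kappa>))"
  have h: "h > 0" using R q_gt_1 V' \<Omega>_pos \<kappa> by (simp add: h_def)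
  define \<delta> where "\<delta> = real DIM('a) * \<Omega> * \<kappa> * h"
  have \<delta>: "\<delta> > 0" using h \<Omega>_pos \<kappa> by (simp add: \<delta>_def)
  have "h \<le> (V' - V) / (real DIM('a) * \<Omega> * \<kappa>)" by (simp add: h_def)
  then have V\<delta>: "V + \<delta> \<le> V'" using \<Omega>_pos \<kappa> by (simp add: \<delta>_def field_simps)
  have "V' < \<Omega>" using less_\<Omega>I V V' by simp
  have small: "cost h R \<ge> 1"
  proof -
    have "h powr (q - 1) \<le> ((R powr q / q) powr (1 / (q - 1))) powr (q - 1)"
      using h q_gt_1 by (intro powr_mono2) (auto simp: h_def)
    also have "\<dots> = R powr q / q" using q_gt_1 R by (simp add: powr_powr)
    finally have "h powr (q - 1) \<le> R powr q / q" .
    moreover have "cost h R = R powr q / q / h powr (q - 1)"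
      using h R q_gt_1 by (simp add: powr_divide powr_diff ac_simps)
    moreover have "h powr (q - 1) > 0" using h by simp
    ultimately show ?thesis by (metis le_divide_eq_1_pos)
  qed
  let ?P = "rearrangement w" and ?H = "hopf_lax q h w"
  let ?PQ = "rearrangement ?H"
  let ?c = "\<lambda>W. h * (\<kappa> powr q / q * (W / \<Omega>) powr (- (q * (real DIM('a) - 1) / real DIM('a))))"
  have [measurable]: "?H \<in> borel_measurable borel" by (rule hopf_lax_meas[OF h])
  \<comment> \<open>The part of the integral beyond the plateau. It occurs on both sides of the
    final comparison and has to be finite to be cancelled.\<close>
  define B where "B = (\<integral>\<^sup>+W\<in>{V + \<delta>..<\<Omega>}. ?P W \<partial>lborel)"
  have B_fin: "B < top"
  proof -
    have "B \<le> (\<integral>\<^sup>+W. indicator {V + \<delta>..<\<Omega>} W \<partial>lborel)"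
      unfolding B_def using rearrangement_w_le_1 V \<delta>
      by (intro nn_integral_mono) (auto simp: indicator_def)
    also have "\<dots> < top" using V\<delta> \<open>V' < \<Omega>\<close> by simp
    finally show ?thesis .
  qed
  have split_w: "(\<integral>\<^sup>+W\<in>{a..<\<Omega>}. ?P W \<partial>lborel) = ennreal (V + \<delta> - a) + B" if a: "0 < a" "a \<le> V + \<delta>" for a
  proof -
    have "(\<integral>\<^sup>+W\<in>{a..<\<Omega>}. ?P W \<partial>lborel)
        = (\<integral>\<^sup>+W. indicator {a..<V + \<delta>} W + ?P W * indicator {V + \<delta>..<\<Omega>} W \<partial>lborel)"
      using a V\<delta> \<open>V' < \<Omega>\<close> rearrangement_w_le_volume[OF _ _ V'(2)]
      by (intro nn_integral_cong) (auto simp: indicator_def)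
    then show ?thesis using a by (simp add: nn_integral_add B_def)
  qed
  have int_w: "(\<integral>\<^sup>+x. ennreal (w x) \<partial>lborel) = ennreal (V + \<delta>) + B"
  proof -
    have "(\<integral>\<^sup>+x. ennreal (w x) \<partial>lborel) = (\<integral>\<^sup>+W\<in>{0<..}. ?P W \<partial>lborel)"
      by (simp add: nn_integral_rearrangement)
    also have "\<dots> = (\<integral>\<^sup>+W. indicator {0<..<V + \<delta>} W + ?P W * indicator {V + \<delta>..<\<Omega>} W \<partial>lborel)"
      using V V\<delta> \<delta> \<open>V' < \<Omega>\<close> rearrangement_w_le_volume[OF _ _ V'(2)] rearrangement_w_ge_ball
      by (intro nn_integral_cong) (auto simp: indicator_def)
    finally show ?thesis using V \<delta> by (simp add: nn_integral_add B_def)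
  qed
  have int_H: "(\<integral>\<^sup>+x. ennreal (?H x) \<partial>lborel)
      \<ge> ennreal (V + \<delta>) + (\<integral>\<^sup>+W\<in>{V + \<delta>..<\<Omega> + \<delta>}. ?PQ W \<partial>lborel)"
  proof -
    have "ennreal (V + \<delta>) + (\<integral>\<^sup>+W\<in>{V + \<delta>..<\<Omega> + \<delta>}. ?PQ W \<partial>lborel)
      = (\<integral>\<^sup>+W. indicator {0<..<V + \<delta>} W + ?PQ W * indicator {V + \<delta>..<\<Omega> + \<delta>} W \<partial>lborel)"
      using V \<delta> by (simp add: nn_integral_add)
    also have "\<dots> \<le> (\<integral>\<^sup>+W\<in>{0<..}. ?PQ W \<partial>lborel)"
    proof (rule nn_integral_mono)
      fix W
      have "1 \<le> ?PQ W" if "0 < W" "W < V + \<delta>"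
        using rearrangement_w_le_volume[OF _ _ V'(2), of W] rearrangement_w_le_hopf_lax[OF h, of W]
          that V\<delta> by simp
      then show "indicator {0<..<V + \<delta>} W + ?PQ W * indicator {V + \<delta>..<\<Omega> + \<delta>} W \<le> ?PQ W * indicator {0<..} W"
        using V \<delta> by (auto simp: indicator_def)
    qed
    finally show ?thesis by (simp add: nn_integral_rearrangement)
  qed
  \<comment> \<open>The rearrangement of w is one on [V, V + \<delta>), whence the term \<delta> on
    the left. On the right, translating the volume variable by \<delta> turns displaced values into
    an integral over [V + \<delta>, \<Omega> + \<delta>).\<close>
  have shift: "ennreal \<delta> + B \<le> (\<integral>\<^sup>+W\<in>{V + \<delta>..<\<Omega> + \<delta>}. ?PQ W \<partial>lborel) + ennreal (h * (\<kappa> powr q / q)) * ?K"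
  proof -
    have "ennreal \<delta> + B = (\<integral>\<^sup>+W\<in>{V..<\<Omega>}. ?P W \<partial>lborel)"
      using split_w[of V] V \<delta> by simp
    also have "\<dots> \<le> (\<integral>\<^sup>+W. ?PQ (W + \<delta>) * indicator {V..<\<Omega>} W + ennreal (?c W) * indicator {V..<\<Omega>} W \<partial>lborel)"
      using displacement_cost[OF h \<kappa>] V unfolding \<delta>_def
      by (intro nn_integral_mono) (auto simp: indicator_def)
    also have "\<dots> = (\<integral>\<^sup>+W. ?PQ (W + \<delta>) * indicator {V..<\<Omega>} W \<partial>lborel) + (\<integral>\<^sup>+W. ennreal (?c W) * indicator {V..<\<Omega>} W \<partial>lborel)"
      by (intro nn_integral_add) auto
    also have "(\<integral>\<^sup>+W. ?PQ (W + \<delta>) * indicator {V..<\<Omega>} W \<partial>lborel) = (\<integral>\<^sup>+W\<in>{V + \<delta>..<\<Omega> + \<delta>}. ?PQ W \<partial>lborel)"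
      by (subst nn_integral_real_affine[of "\<lambda>W. ?PQ W * indicator {V + \<delta>..<\<Omega> + \<delta>} W" 1 \<delta>])
         (auto intro!: nn_integral_cong simp: indicator_def add.commute)
    also have "(\<integral>\<^sup>+W. ennreal (?c W) * indicator {V..<\<Omega>} W \<partial>lborel) = ennreal (h * (\<kappa> powr q / q)) * ?K"
      using h q_gt_1 by (subst nn_integral_cmult[symmetric])
        (auto intro!: nn_integral_cong simp: indicator_def ennreal_mult'[symmetric])
    finally show ?thesis .
  qed
  have upper: "(\<integral>\<^sup>+x. ennreal (?H x) \<partial>lborel) \<le> (\<integral>\<^sup>+x. ennreal (w x) \<partial>lborel) + ennreal (h * (1 / p)) * ?S"
  proof -
    have "(\<integral>\<^sup>+x. ennreal (?H x) \<partial>lborel) \<le> (\<integral>\<^sup>+x. ennreal (w x) + ennreal (h * (1 / p)) * ennreal (\<sigma> x powr p) \<partial>lborel)"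
      using hopf_lax_le[OF h small] h p w_bounds(1)
      by (intro nn_integral_mono) (simp add: ennreal_mult'[symmetric] ennreal_plus[symmetric] ennreal_leI del: ennreal_plus)
    then show ?thesis by (simp add: nn_integral_add nn_integral_cmult)
  qed
  let ?A = "ennreal (V + \<delta>) + B"
  have "?A + ennreal \<delta> \<le> ?A + (ennreal (h * (1 / p)) * ?S + ennreal (h * (\<kappa> powr q / q)) * ?K)"
  proof -
    have "?A + ennreal \<delta> = ennreal (V + \<delta>) + (ennreal \<delta> + B)" by (simp add: ac_simps)
    also have "\<dots> \<le> ennreal (V + \<delta>) + ((\<integral>\<^sup>+W\<in>{V + \<delta>..<\<Omega> + \<delta>}. ?PQ W \<partial>lborel) + ennreal (h * (\<kappa> powr q / q)) * ?K)"
      using shift by (rule add_left_mono)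
    also have "\<dots> \<le> (\<integral>\<^sup>+x. ennreal (?H x) \<partial>lborel) + ennreal (h * (\<kappa> powr q / q)) * ?K"
      using int_H by (simp add: add.assoc[symmetric] add_right_mono)
    also have "\<dots> \<le> (?A + ennreal (h * (1 / p)) * ?S) + ennreal (h * (\<kappa> powr q / q)) * ?K"
      using upper unfolding int_w by (rule add_right_mono)
    finally show ?thesis by (simp add: add.assoc)
  qed
  moreover have "?A \<noteq> top" using B_fin by simp
  ultimately have "ennreal \<delta> \<le> ennreal (h * (1 / p)) * ?S + ennreal (h * (\<kappa> powr q / q)) * ?K"
    by (simp add: ennreal_add_left_cancel_le)
  also have "\<dots> = ennreal h * (ennreal (1 / p) * ?S + ennreal (\<kappa> powr q / q) * ?K)"
    using h p q_gt_1 by (simp only: ennreal_mult'[OF less_imp_le] distrib_left mult.assoc)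
  finally have "ennreal h * ennreal (real DIM('a) * \<Omega> * \<kappa>) \<le> ennreal h * (ennreal (1 / p) * ?S + ennreal (\<kappa> powr q / q) * ?K)"
    using h \<Omega>_pos \<kappa> by (simp add: \<delta>_def ennreal_mult'[symmetric] ac_simps)
  then show ?thesis
    using h by (simp add: ennreal_mult_le_mult_iff)
qed


corollary capacity_lower_bound:
  assumes k: "k > 0"
    and K: "(\<integral>\<^sup>+W\<in>{V..<\<Omega>}. ennreal ((W / \<Omega>) powr (- (q * (real DIM('a) - 1) / real DIM('a)))) \<partial>lborel)
      \<le> ennreal (\<Omega> * k)"
  shows "ennreal (real DIM('a) * \<Omega> * (real DIM('a) / k) powr (p - 1)) \<le> (\<integral>\<^sup>+x. ennreal (\<sigma> x powr p) \<partial>lborel)"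
    (is "_ \<le> ?S")
proof (cases ?S)
  case (real s)
  \<comment> \<open>This value maximises n * \<kappa> - \<kappa> powr q * k / q, because q - 1 = 1 /
    (p - 1). At the maximum the subtracted term is the fraction 1 / q of the first, which leaves 1 /
    p of it.\<close>
  define \<kappa> where "\<kappa> = (real DIM('a) / k) powr (p - 1)"
  have \<kappa>: "\<kappa> > 0" using k by (simp add: \<kappa>_def)
  have eq: "\<kappa> powr q * k = \<kappa> * real DIM('a)"
  proof -
    have "\<kappa> powr q = (real DIM('a) / k) powr p" using p by (simp add: \<kappa>_def q_def powr_powr)
    also have "p = (p - 1) + 1" by simp
    finally show ?thesis using k unfolding powr_add by (simp add: \<kappa>_def)
  qed
  have "ennreal (real DIM('a) * \<Omega> * \<kappa>) \<le> ennreal (1 / p) * ennreal s + ennreal (\<kappa> powr q / q) * ennreal (\<Omega> * k)"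
    using capacity_duality[OF \<kappa>] mult_left_mono[OF K, of "ennreal (\<kappa> powr q / q)"]
    unfolding real by (meson add_left_mono order_trans zero_le)
  also have "\<dots> = ennreal (s / p + \<kappa> powr q * k * \<Omega> / q)"
    using real p q_gt_1 k \<Omega>_pos by (simp add: ennreal_mult'[symmetric] ennreal_plus[symmetric] ac_simps del: ennreal_plus)
  finally have "real DIM('a) * \<Omega> * \<kappa> \<le> s / p + \<kappa> * real DIM('a) * \<Omega> / q"
    using real p q_gt_1 \<kappa> \<Omega>_pos unfolding eq by (subst (asm) ennreal_le_iff) auto
  moreover have "1 / q = 1 - 1 / p" using p by (simp add: q_def field_simps)
  then have "\<kappa> * real DIM('a) * \<Omega> / q = \<kappa> * real DIM('a) * \<Omega> * (1 - 1 / p)" by (metis times_divide_eq_right mult.right_neutral)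
  ultimately have "\<kappa> * real DIM('a) * \<Omega> / p \<le> s / p" by (simp add: algebra_simps)
  then have "real DIM('a) * \<Omega> * \<kappa> \<le> s" using p by (simp add: divide_le_cancel ac_simps)
  then show ?thesis unfolding real \<kappa>_def[symmetric] by (rule ennreal_leI)
qed simp

end

section \<open>The profile integral of a spherical ring\<close>

text \<open>With W = \<Omega> * t^N the integral becomes that of N * \<Omega> * t powr (-(N - 1) /
  (p - 1)) in the radius t, the familiar integral behind the capacity of a spherical ring. In terms
  of W the exponent is \<open>?e - 1\<close>, which suggests the antiderivative.\<close>

lemma nn_integral_ball_profile_le:
  fixes \<Omega> V N p :: real
  assumes V: "0 < V" "V \<le> \<Omega>" and p: "1 < p" "p < N"
  shows "(\<integral>\<^sup>+W\<in>{V..<\<Omega>}. ennreal ((W / \<Omega>) powr (- (p / (p - 1) * (N - 1) / N))) \<partial>lborel)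
    \<le> ennreal (\<Omega> * (N * (p - 1) / (N - p) * ((V / \<Omega>) powr (- ((N - p) / (N * (p - 1)))) - 1)))"
proof -
  let ?e = "- ((N - p) / (N * (p - 1)))"
  have e: "- (p / (p - 1) * (N - 1) / N) = ?e - 1" using p by (simp add: field_simps)
  have e0: "?e < 0" using p by simp
  let ?F = "\<lambda>W. \<Omega> * ((W / \<Omega>) powr ?e / ?e)"
  have "(\<integral>\<^sup>+W\<in>{V..<\<Omega>}. ennreal ((W / \<Omega>) powr (?e - 1)) \<partial>lborel)
      \<le> (\<integral>\<^sup>+W\<in>{V..\<Omega>}. ennreal ((W / \<Omega>) powr (?e - 1)) \<partial>lborel)"
    by (intro nn_integral_mono) (auto simp: indicator_def)
  also have "\<dots> = ennreal (?F \<Omega> - ?F V)"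
  proof (rule nn_integral_FTC_Icc[where F = ?F])
    fix W assume "W \<in> {V..\<Omega>}"
    then have W: "V \<le> W" "W \<le> \<Omega>" by auto
    have "DERIV (\<lambda>W. \<Omega> * ((W / \<Omega>) powr e / e)) W :> (W / \<Omega>) powr (e - 1)" if "e < 0" for e
    proof -
      have "((\<lambda>W. (W / \<Omega>) powr e) has_real_derivative (e * (W / \<Omega>) powr (e - 1) * (1 / \<Omega>))) (at W)"
        using W V by (auto intro!: derivative_eq_intros)
      from DERIV_cmult[OF DERIV_cdivide[OF this, of e], of \<Omega>] show ?thesis
        using that V by simp
    qed
    from this[OF e0] show "DERIV ?F W :> (W / \<Omega>) powr (?e - 1)" .
  qed (use V in auto)
  also have "?F \<Omega> - ?F V = \<Omega> * ((1 - (V / \<Omega>) powr ?e) / ?e)" using V by (simp add: diff_divide_distrib right_diff_distrib)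
  also have "(1 - (V / \<Omega>) powr ?e) / ?e = N * (p - 1) / (N - p) * ((V / \<Omega>) powr ?e - 1)"
    using p by (simp add: field_simps)
  finally show ?thesis unfolding e .
qed

text \<open>For p = N the exponent is -1 and the antiderivative logarithmic.\<close>

lemma nn_integral_ball_profile_log:
  fixes \<Omega> V N :: real
  assumes V: "0 < V" "V \<le> \<Omega>" and N: "1 < N"
  shows "(\<integral>\<^sup>+W\<in>{V..<\<Omega>}. ennreal ((W / \<Omega>) powr (- (N / (N - 1) * (N - 1) / N))) \<partial>lborel)
    \<le> ennreal (\<Omega> * ln (\<Omega> / V))"
proof -
  have e: "- (N / (N - 1) * (N - 1) / N) = -1" using N by simp
  have "(\<integral>\<^sup>+W\<in>{V..<\<Omega>}. ennreal ((W / \<Omega>) powr (-1)) \<partial>lborel)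
      \<le> (\<integral>\<^sup>+W\<in>{V..\<Omega>}. ennreal (\<Omega> * (1 / W)) \<partial>lborel)"
    using V by (intro nn_integral_mono) (auto simp: indicator_def powr_minus_divide)
  also have "\<dots> = ennreal (\<Omega> * ln \<Omega> - \<Omega> * ln V)"
    using V by (intro nn_integral_FTC_Icc) (auto intro!: derivative_eq_intros)
  also have "\<Omega> * ln \<Omega> - \<Omega> * ln V = \<Omega> * ln (\<Omega> / V)" using V by (simp add: ln_div right_diff_distrib)
  finally show ?thesis unfolding e .
qed


section \<open>Lifting paths through open discrete maps\<close>

lemma compact_subseqE:
  fixes S :: "'a::metric_space set"
  assumes "compact S" "\<And>k. X k \<in> S"
  obtains z \<phi> where "z \<in> S" "strict_mono (\<phi> :: nat \<Rightarrow> nat)" "(\<lambda>k. X (\<phi> k)) \<longlonglongrightarrow> z"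
  using assms unfolding compact_def o_def by metis

lemma subseq_inverse_Suc_tendsto:
  assumes "strict_mono (\<phi> :: nat \<Rightarrow> nat)"
  shows "(\<lambda>k. 1 / real (Suc (\<phi> k))) \<longlonglongrightarrow> 0"
  using LIMSEQ_subseq_LIMSEQ[OF LIMSEQ_inverse_real_of_nat assms]
  by (simp add: o_def inverse_eq_divide)

text \<open>A chain with small steps whose image stays close to a point cannot cross the shell around
  an isolated point of the fibre.\<close>

lemma chains_small:
  fixes f :: "'a::metric_space \<Rightarrow> 'b::heine_borel"
  assumes K: "compact K" and f: "continuous_on K f"
    and fib: "\<And>y. discrete {x \<in> K. f x = y}" and e: "e > 0"
  obtains d where "d > 0"
    "\<And>x m. \<lbrakk>\<And>j. j \<le> m \<Longrightarrow> x j \<in> K; \<And>j. j \<le> m \<Longrightarrow> dist (f (x j)) (f (x 0)) < d;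
       \<And>j. j < m \<Longrightarrow> dist (x (Suc j)) (x j) < d\<rbrakk> \<Longrightarrow> dist (x m) (x (0::nat)) < e"
proof -
  define good where "good d \<longleftrightarrow> (\<forall>x m. (\<forall>j\<le>m. x j \<in> K \<and> dist (f (x j)) (f (x 0)) < d) \<and>
      (\<forall>j<m. dist (x (Suc j)) (x j) < d) \<longrightarrow> dist (x m) (x (0::nat)) < e)" for d
  have "\<exists>d>0. good d"
  proof (rule ccontr)
    assume "\<not> ?thesis"
    then have "\<not> good (1 / real (Suc k))" for k by simp
    then have "\<exists>x m. (\<forall>j\<le>m. x j \<in> K \<and> dist (f (x j)) (f (x 0)) < 1 / real (Suc k)) \<and>
      (\<forall>j<m. dist (x (Suc j)) (x j) < 1 / real (Suc k)) \<and> \<not> dist (x m) (x (0::nat)) < e" for k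
      unfolding good_def by blast
    then obtain X M where XM: "\<And>k j. j \<le> M k \<Longrightarrow> X k j \<in> K"
      "\<And>k j. j \<le> M k \<Longrightarrow> dist (f (X k j)) (f (X k 0)) < 1 / real (Suc k)"
      "\<And>k j. j < M k \<Longrightarrow> dist (X k (Suc j)) (X k j) < 1 / real (Suc k)"
      "\<And>k. \<not> dist (X k (M k)) (X k 0) < e"
      by metis
    obtain z \<phi> where z: "z \<in> K" and \<phi>: "strict_mono \<phi>" and lim: "(\<lambda>k. X (\<phi> k) 0) \<longlonglongrightarrow> z"
      using compact_subseqE[OF K, of "\<lambda>k. X k 0"] XM(1) by (metis le0)
    have "z isolated_in {x \<in> K. f x = f z}"
      using fib[of "f z"] z by (intro discreteD) auto
    then obtain d where d: "d > 0" "\<And>y. y \<in> K \<Longrightarrow> f y = f z \<Longrightarrow> dist z y < d \<Longrightarrow> y = z"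
      by (elim isolated_inE_dist) auto
    \<comment> \<open>The shell between s and 2 * s around z stays inside the radius that isolates z
      in its fibre, so f z has a positive distance \<mu> from the image of the shell, and steps
      shorter than s cannot jump over it. The bound e / 4 makes the final displacement 2 * s smaller
      than e.\<close>
    define s where "s = min (e / 4) (d / 3)"
    have s: "s > 0" "s \<le> e / 4" "2 * s < d" using e d(1) by (auto simp: s_def)
    let ?H = "{y \<in> K. s \<le> dist z y \<and> dist z y \<le> 2 * s}"
    have "?H = K \<inter> {y. s \<le> dist z y} \<inter> {y. dist z y \<le> 2 * s}" by auto
    moreover have "closed {y. s \<le> dist z y}" "closed {y. dist z y \<le> 2 * s}"
      by (intro closed_Collect_le continuous_intros)+
    ultimately have "compact ?H" using K by (simp add: compact_Int_closed)
    moreover have "continuous_on ?H f" using f by (rule continuous_on_subset) auto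
    ultimately have "closed (f ` ?H)" by (intro compact_imp_closed compact_continuous_image)
    moreover have "f z \<notin> f ` ?H" using d(2) s by (force simp: image_iff)
    ultimately obtain \<mu> where \<mu>: "\<mu> > 0" "\<And>y. y \<in> ?H \<Longrightarrow> \<mu> \<le> dist (f z) (f y)"
      using separate_point_closed[of "f ` ?H" "f z"] by blast
    have limf: "(\<lambda>k. f (X (\<phi> k) 0)) \<longlonglongrightarrow> f z"
      by (rule continuous_on_tendsto_compose[OF f lim z]) (use XM(1) in auto)
    have ms: "min s (\<mu> / 2) > 0" using s \<mu> by simp
    have "\<forall>\<^sub>F k in sequentially. dist (X (\<phi> k) 0) z < s \<and> dist (f (X (\<phi> k) 0)) (f z) < \<mu> / 2
        \<and> 1 / real (Suc (\<phi> k)) < min s (\<mu> / 2)"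
      using tendstoD[OF lim s(1)] tendstoD[OF limf, of "\<mu> / 2"] \<mu>(1)
        order_tendstoD(2)[OF subseq_inverse_Suc_tendsto[OF \<phi>] ms]
      by (simp add: eventually_conj)
    then obtain k where k: "dist (X (\<phi> k) 0) z < s" "dist (f (X (\<phi> k) 0)) (f z) < \<mu> / 2"
        "1 / real (Suc (\<phi> k)) < s" "1 / real (Suc (\<phi> k)) < \<mu> / 2"
      by (metis (no_types, lifting) eventually_happens min_less_iff_conj trivial_limit_sequentially)
    let ?x = "X (\<phi> k)"
    have "j \<le> M (\<phi> k) \<Longrightarrow> dist z (?x j) < s" for j
    proof (induction j)
      case 0 then show ?case using k(1) by (simp add: dist_commute)
    next
      case (Suc j)
      then have "dist z (?x j) < s" by simp
      moreover have "dist (?x (Suc j)) (?x j) < s" using XM(3)[of j "\<phi> k"] Suc.prems k(3) by simp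
      ultimately have "dist z (?x (Suc j)) < 2 * s"
        using dist_triangle[of z "?x (Suc j)" "?x j"] by (simp add: dist_commute)
      moreover have "dist (f z) (f (?x (Suc j))) < \<mu>"
        using dist_triangle[of "f z" "f (?x (Suc j))" "f (?x 0)"] XM(2)[OF Suc.prems] k
        by (simp add: dist_commute)
      ultimately show ?case
        using \<mu>(2)[of "?x (Suc j)"] XM(1)[OF Suc.prems] by fastforce
    qed
    then have "dist z (?x (M (\<phi> k))) < s" by simp
    then have "dist (?x (M (\<phi> k))) (?x 0) < 2 * s"
      using dist_triangle[of "?x (M (\<phi> k))" "?x 0" z] k(1) by (simp add: dist_commute)
    then show False using XM(4)[of "\<phi> k"] s e by simp
  qed
  then show ?thesis using that unfolding good_def by metis
qed

text \<open>At a limit z of counterexamples, the image of the ball of radius e / 2 about z contains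
  a ball about f z; this one ball serves all points near z.\<close>

lemma uniformly_open:
  fixes f :: "'a::metric_space \<Rightarrow> 'b::metric_space"
  assumes K: "compact K" "K \<subseteq> U" and U: "open U" and f: "continuous_on U f"
    and op: "\<And>V. open V \<Longrightarrow> V \<subseteq> U \<Longrightarrow> open (f ` V)" and e: "e > 0"
  obtains d where "d > 0" "\<And>x y. x \<in> K \<Longrightarrow> dist y (f x) < d \<Longrightarrow> \<exists>x'\<in>U. dist x' x < e \<and> f x' = y"
proof -
  define good where "good d \<longleftrightarrow> (\<forall>x y. x \<in> K \<and> dist y (f x) < d \<longrightarrow> (\<exists>x'\<in>U. dist x' x < e \<and> f x' = y))" for d
  have "\<exists>d>0. good d"
  proof (rule ccontr)
    assume "\<not> ?thesis"
    then have "\<not> good (1 / real (Suc k))" for k by simp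
    then have "\<exists>x y. x \<in> K \<and> dist y (f x) < 1 / real (Suc k) \<and> \<not> (\<exists>x'\<in>U. dist x' x < e \<and> f x' = y)" for k
      unfolding good_def by blast
    then obtain X Y where XY: "\<And>k. X k \<in> K" "\<And>k. dist (Y k) (f (X k)) < 1 / real (Suc k)"
      "\<And>k. \<not> (\<exists>x'\<in>U. dist x' (X k) < e \<and> f x' = Y k)"
      by metis
    obtain z \<phi> where z: "z \<in> K" and \<phi>: "strict_mono \<phi>" and lim: "(\<lambda>k. X (\<phi> k)) \<longlonglongrightarrow> z"
      using compact_subseqE[OF K(1), of X] XY(1) by metis
    have "open (f ` (U \<inter> ball z (e / 2)))" using U by (intro op) auto
    moreover have "f z \<in> f ` (U \<inter> ball z (e / 2))" using z K e by auto
    ultimately obtain d where d: "d > 0" "ball (f z) d \<subseteq> f ` (U \<inter> ball z (e / 2))"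
      unfolding open_contains_ball by blast
    have limf: "(\<lambda>k. f (X (\<phi> k))) \<longlonglongrightarrow> f z"
      by (rule continuous_on_tendsto_compose[OF f lim]) (use z K XY(1) in \<open>auto intro!: always_eventually\<close>)
    have "\<forall>\<^sub>F k in sequentially. dist (X (\<phi> k)) z < e / 2 \<and> dist (f (X (\<phi> k))) (f z) < d / 2
        \<and> 1 / real (Suc (\<phi> k)) < d / 2"
      using tendstoD[OF lim, of "e / 2"] tendstoD[OF limf, of "d / 2"] d(1) e
        order_tendstoD(2)[OF subseq_inverse_Suc_tendsto[OF \<phi>], of "d / 2"]
      by (simp add: eventually_conj)
    then obtain k where k: "dist (X (\<phi> k)) z < e / 2" "dist (f (X (\<phi> k))) (f z) < d / 2"
        "1 / real (Suc (\<phi> k)) < d / 2"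
      by (metis (no_types, lifting) eventually_happens trivial_limit_sequentially)
    have "dist (f z) (Y (\<phi> k)) < d"
      using dist_triangle[of "f z" "Y (\<phi> k)" "f (X (\<phi> k))"] XY(2)[of "\<phi> k"] k by (simp add: dist_commute)
    then have "Y (\<phi> k) \<in> f ` (U \<inter> ball z (e / 2))" using d(2) by auto
    then obtain x' where x': "x' \<in> U" "dist z x' < e / 2" "f x' = Y (\<phi> k)" by auto
    have "dist x' (X (\<phi> k)) < e"
      using dist_triangle[of x' "X (\<phi> k)" z] k x' by (simp add: dist_commute)
    then show False using XY(3) x' by blast
  qed
  then show ?thesis using that unfolding good_def by metis
qed

section \<open>From finite chains of preimages to lifted paths\<close>

locale open_discrete_map =
  fixes f :: "'a::euclidean_space \<Rightarrow> 'b::euclidean_space" and U :: "'a set"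
  assumes U: "open U" and cont: "continuous_on U f"
    and op: "\<And>V. open V \<Longrightarrow> V \<subseteq> U \<Longrightarrow> open (f ` V)"
    and fibres: "\<And>y. discrete {x \<in> U. f x = y}"
begin

text \<open>\<open>open_at\<close> lifts the next value within \<eta> of the last point. Applied to
  the chain built so far, \<open>stay\<close> keeps that point within r / 2 of x, so a further step
  of at most r / 2 remains in the ball contained in K'.\<close>

lemma approximate_lift:
  assumes K': "compact K'" "K' \<subseteq> U" and x: "cball x r \<subseteq> K'"
    and stay: "\<And>c m. \<lbrakk>\<And>j. j \<le> m \<Longrightarrow> c j \<in> K'; \<And>j. j \<le> m \<Longrightarrow> dist (f (c j)) (f (c 0)) < d;
       \<And>j. j < m \<Longrightarrow> dist (c (Suc j)) (c j) < d\<rbrakk> \<Longrightarrow> dist (c m) (c (0::nat)) < r / 2"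
    and \<eta>: "0 < \<eta>" "\<eta> \<le> d" "\<eta> \<le> r / 2"
    and open_at: "\<And>x y. x \<in> K' \<Longrightarrow> dist y (f x) < \<delta> \<Longrightarrow> \<exists>x'\<in>U. dist x' x < \<eta> \<and> f x' = y"
    and y: "y 0 = f x" "\<And>j. j < n \<Longrightarrow> dist (y (Suc j)) (y j) < \<delta>" "\<And>j. j \<le> n \<Longrightarrow> dist (y j) (y 0) < d"
  shows "\<exists>c. c 0 = x \<and> (\<forall>j\<le>n. c j \<in> K' \<and> f (c j) = y j) \<and> (\<forall>j<n. dist (c (Suc j)) (c j) < \<eta>)"
  using y
proof (induction n)
  case 0
  have "x \<in> K'" using x \<eta> by (auto simp: subset_iff)
  then show ?case using 0 by (intro exI[of _ "\<lambda>_. x"]) auto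
next
  case (Suc n)
  then obtain c where c: "c 0 = x" "\<And>j. j \<le> n \<Longrightarrow> c j \<in> K'" "\<And>j. j \<le> n \<Longrightarrow> f (c j) = y j"
    "\<And>j. j < n \<Longrightarrow> dist (c (Suc j)) (c j) < \<eta>" by (metis le_SucI less_SucI)
  have "dist (c n) (c 0) < r / 2"
  proof (rule stay)
    show "dist (f (c j)) (f (c 0)) < d" if "j \<le> n" for j
      using c(3)[OF that] c(3)[of 0] Suc.prems(3)[of j] that by simp
    show "dist (c (Suc j)) (c j) < d" if "j < n" for j
      using c(4)[OF that] \<eta> by simp
  qed (use c in auto)
  moreover obtain x' where x': "x' \<in> U" "dist x' (c n) < \<eta>" "f x' = y (Suc n)"
    using open_at[of "c n" "y (Suc n)"] c(2,3)[of n] Suc.prems(2)[of n] by auto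
  ultimately have "dist x x' < r"
    using dist_triangle[of x x' "c n"] \<eta> c(1) by (simp add: dist_commute)
  then have "x' \<in> K'" using x by auto
  define c' where "c' = c(Suc n := x')"
  have "c' 0 = x" "\<And>j. j \<le> Suc n \<Longrightarrow> c' j \<in> K' \<and> f (c' j) = y j"
    using c x' \<open>x' \<in> K'\<close> by (auto simp: c'_def le_Suc_eq)
  moreover have "\<And>j. j < Suc n \<Longrightarrow> dist (c' (Suc j)) (c' j) < \<eta>"
    using c x' by (auto simp: c'_def less_Suc_eq)
  ultimately show ?case by blast
qed

text \<open>The path is lifted over ever finer grids and a limit is extracted in the manner of
  Arzela-Ascoli, with equicontinuity supplied by \<open>chains_small\<close>. The duration \<tau>
  depends on neither the starting time nor the starting point in K, so that such lifts can be
  concatenated.\<close>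

lemma short_lift:
  assumes K': "compact K'" "K' \<subseteq> U" and r: "r > 0" "\<And>x. x \<in> K \<Longrightarrow> cball x r \<subseteq> K'"
    and \<beta>: "continuous_on {0..L::real} \<beta>"
  obtains \<tau> where "\<tau> > 0" "\<And>t x. \<lbrakk>0 \<le> t; t \<le> L; x \<in> K; f x = \<beta> t\<rbrakk> \<Longrightarrow>
     \<exists>\<gamma>. continuous_on {t..min (t + \<tau>) L} \<gamma> \<and> \<gamma> t = x \<and> (\<forall>s\<in>{t..min (t + \<tau>) L}. \<gamma> s \<in> K' \<and> f (\<gamma> s) = \<beta> s)"
proof -
  have fK': "continuous_on K' f" using cont K'(2) by (rule continuous_on_subset)
  have fibK': "discrete {x \<in> K'. f x = y}" for y
    by (rule discrete_subset[OF fibres[of y]]) (use K' in auto)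
  have unif: "\<exists>\<tau>>0. \<forall>s\<in>{0..L}. \<forall>s'\<in>{0..L}. \<bar>s' - s\<bar> < \<tau> \<longrightarrow> dist (\<beta> s') (\<beta> s) < e" if "e > 0" for e
    using compact_uniformly_continuous[OF \<beta>] that
    unfolding uniformly_continuous_on_def by (simp add: dist_real_def)
  obtain d where d: "d > 0"
    "\<And>x m. \<lbrakk>\<And>j. j \<le> m \<Longrightarrow> x j \<in> K'; \<And>j. j \<le> m \<Longrightarrow> dist (f (x j)) (f (x 0)) < d;
       \<And>j. j < m \<Longrightarrow> dist (x (Suc j)) (x j) < d\<rbrakk> \<Longrightarrow> dist (x m) (x (0::nat)) < r / 2"
    using chains_small[OF K'(1) fK' fibK', of "r / 2"] r(1) by (metis half_gt_zero)
  obtain \<tau> where \<tau>: "\<tau> > 0" "\<And>s s'. s \<in> {0..L} \<Longrightarrow> s' \<in> {0..L} \<Longrightarrow> \<bar>s' - s\<bar> < \<tau> \<Longrightarrow> dist (\<beta> s') (\<beta> s) < d"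
    using unif[OF d(1)] by blast
  show ?thesis
  proof (rule that[of "\<tau> / 2"])
    fix t x assume t: "0 \<le> t" "t \<le> L" and x: "x \<in> K" "f x = \<beta> t"
    define T where "T = min (t + \<tau> / 2) L"
    have T: "t \<le> T" "T \<le> L" "T < t + \<tau>" using \<tau> t by (auto simp: T_def)
    have xK': "x \<in> K'" using r x by (auto simp: subset_iff)
    have "\<exists>\<gamma>. continuous_on {t..T} \<gamma> \<and> \<gamma> t = x \<and> (\<forall>s\<in>{t..T}. \<gamma> s \<in> K' \<and> f (\<gamma> s) = \<beta> s)"
    proof (cases "t = T")
      case True
      then show ?thesis using xK' x by (intro exI[of _ "\<lambda>_. x"]) auto
    next
      case False
      define len where "len = T - t"
      have len: "len > 0" using False T by (simp add: len_def)
      \<comment> \<open>The lifting steps tend to zero along the sequence, so that the jumps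
        disappear in the limit.\<close>
      define \<eta> where "\<eta> m = min (min d (r / 2)) (1 / real (Suc m))" for m
      have \<eta>: "0 < \<eta> m" "\<eta> m \<le> d" "\<eta> m \<le> r / 2" "\<eta> m \<le> 1 / real (Suc m)" for m
        using d r by (auto simp: \<eta>_def)
      have "\<exists>\<delta>>0. \<forall>x y. x \<in> K' \<and> dist y (f x) < \<delta> \<longrightarrow> (\<exists>x'\<in>U. dist x' x < \<eta> m \<and> f x' = y)" for m
        using uniformly_open[OF K' U cont op \<eta>(1)[of m]] by metis
      then obtain \<delta> where \<delta>: "\<And>m. \<delta> m > 0"
        "\<And>m x y. x \<in> K' \<Longrightarrow> dist y (f x) < \<delta> m \<Longrightarrow> \<exists>x'\<in>U. dist x' x < \<eta> m \<and> f x' = y"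
        by metis
      define finegrid where "finegrid m N \<longleftrightarrow> N > 0 \<and> len / N < 1 / real (Suc m) \<and>
        (\<forall>s\<in>{0..L}. \<forall>s'\<in>{0..L}. \<bar>s' - s\<bar> \<le> len / N \<longrightarrow>
          dist (\<beta> s') (\<beta> s) < min (\<delta> m) (1 / real (Suc m)))" for m and N :: nat
      have "\<exists>N. finegrid m N" for m
      proof -
        have "min (\<delta> m) (1 / real (Suc m)) > 0" using \<delta>(1) by simp
        then obtain \<epsilon> where \<epsilon>: "\<epsilon> > 0" "\<forall>s\<in>{0..L}. \<forall>s'\<in>{0..L}. \<bar>s' - s\<bar> < \<epsilon> \<longrightarrow>
            dist (\<beta> s') (\<beta> s) < min (\<delta> m) (1 / real (Suc m))"
          using unif by blast
        define \<epsilon>' where "\<epsilon>' = min \<epsilon> (1 / real (Suc m))"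
        have "\<epsilon>' > 0" using \<epsilon> by (simp add: \<epsilon>'_def)
        obtain N :: nat where N: "N > len / \<epsilon>'" using reals_Archimedean2 by blast
        moreover have "0 < len / \<epsilon>'" using len \<open>\<epsilon>' > 0\<close> by simp
        ultimately have "real N > 0" by linarith
        then have "len / N < \<epsilon>'" using N \<open>\<epsilon>' > 0\<close> by (simp add: field_simps)
        then show ?thesis using \<epsilon> \<open>real N > 0\<close> by (intro exI[of _ N]) (auto simp: finegrid_def \<epsilon>'_def)
      qed
      then obtain N where "\<And>m. finegrid m (N m)" by metis
      then have N: "\<And>m. N m > 0" "\<And>m. len / N m < 1 / real (Suc m)"
        "\<And>m s s'. s \<in> {0..L} \<Longrightarrow> s' \<in> {0..L} \<Longrightarrow> \<bar>s' - s\<bar> \<le> len / N m \<Longrightarrow> dist (\<beta> s') (\<beta> s) < \<delta> m"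
        "\<And>m s s'. s \<in> {0..L} \<Longrightarrow> s' \<in> {0..L} \<Longrightarrow> \<bar>s' - s\<bar> \<le> len / N m \<Longrightarrow> dist (\<beta> s') (\<beta> s) < 1 / real (Suc m)"
        unfolding finegrid_def by (metis min_less_iff_conj)+
      define tm where "tm m j = t + real j * (len / N m)" for m and j :: nat
      have tm_le: "tm m j \<le> T" if "j \<le> N m" for m j
      proof -
        have "real j * (len / N m) \<le> N m * (len / N m)" using that len by (intro mult_right_mono) auto
        then show ?thesis using N(1)[of m] by (simp add: tm_def len_def)
      qed
      have tm_ge: "t \<le> tm m j" for m j using len by (simp add: tm_def)
      have tm_in: "tm m j \<in> {0..L}" if "j \<le> N m" for m j
        using tm_le[OF that] tm_ge[of m j] t T by auto
      have "\<exists>c. c 0 = x \<and> (\<forall>j\<le>N m. c j \<in> K' \<and> f (c j) = \<beta> (tm m j)) \<and> (\<forall>j<N m. dist (c (Suc j)) (c j) < \<eta> m)" for m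
      proof (rule approximate_lift[OF K' r(2)[OF x(1)] d(2) \<eta>(1,2,3) \<delta>(2)])
        show "\<beta> (tm m 0) = f x" using x by (simp add: tm_def)
        show "dist (\<beta> (tm m (Suc j))) (\<beta> (tm m j)) < \<delta> m" if "j < N m" for j
        proof -
          have "tm m (Suc j) - tm m j = len / N m" by (simp add: tm_def add_divide_distrib distrib_right)
          then have "\<bar>tm m (Suc j) - tm m j\<bar> = len / N m" using len by simp
          then show ?thesis using that tm_in[of j m] tm_in[of "Suc j" m] by (intro N(3)) auto
        qed
        show "dist (\<beta> (tm m j)) (\<beta> (tm m 0)) < d" if "j \<le> N m" for j
        proof (rule \<tau>(2))
          show "\<bar>tm m j - tm m 0\<bar> < \<tau>" using tm_le[OF that] tm_ge[of m j] T by (simp add: tm_def)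
        qed (use tm_in that in auto)
      qed
      then obtain c where c: "\<And>m. c m 0 = x" "\<And>m j. j \<le> N m \<Longrightarrow> c m j \<in> K'"
          "\<And>m j. j \<le> N m \<Longrightarrow> f (c m j) = \<beta> (tm m j)" "\<And>m j. j < N m \<Longrightarrow> dist (c m (Suc j)) (c m j) < \<eta> m"
        by metis
      \<comment> \<open>The index of the last grid time not after s. It turns the chain into a step
        function \<open>g m\<close>, defined at all times.\<close>
      define idx where "idx m s = nat \<lfloor>(s - t) / (len / N m)\<rfloor>" for m s
      have step_pos: "len / N m > 0" for m using len N(1)[of m] by simp
      have idx: "tm m (idx m s) \<le> s" "s < tm m (idx m s) + len / N m" if "t \<le> s" for m s
      proof -
        have "(s - t) / (len / N m) \<ge> 0" using that step_pos[of m] by (intro divide_nonneg_pos) auto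
        then have "real (idx m s) \<le> (s - t) / (len / N m)" "(s - t) / (len / N m) < real (idx m s) + 1"
          unfolding idx_def by linarith+
        then have "real (idx m s) * (len / N m) \<le> s - t" "s - t < (real (idx m s) + 1) * (len / N m)"
          using step_pos[of m] by (simp_all only: pos_le_divide_eq pos_divide_less_eq)
        then show "tm m (idx m s) \<le> s" "s < tm m (idx m s) + len / N m"
          by (auto simp: tm_def distrib_right add_divide_distrib)
      qed
      have idx_mono: "idx m s \<le> idx m s'" if "s \<le> s'" for m s s'
        unfolding idx_def using that step_pos[of m] by (intro nat_mono floor_mono divide_right_mono) auto
      have idx_le: "idx m s \<le> N m" if "s \<le> T" for m s
      proof -
        have "idx m s \<le> idx m T" using that by (rule idx_mono)
        also have "idx m T = N m" using len N(1)[of m] unfolding idx_def len_def[symmetric] by simp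
        finally show ?thesis .
      qed
      define g where "g m s = c m (idx m s)" for m s
      have gK': "g m s \<in> K'" if "s \<in> {t..T}" for m s
        unfolding g_def using that idx_le by (intro c(2)) auto
      have fg: "dist (f (g m s)) (\<beta> s) < 1 / real (Suc m)" if "s \<in> {t..T}" for m s
      proof -
        have "dist (\<beta> (tm m (idx m s))) (\<beta> s) < 1 / real (Suc m)"
          using that idx[of s m] idx_le[of s m] tm_in[of "idx m s" m] t T by (intro N(4)) auto
        then show ?thesis unfolding g_def using c(3) idx_le that by simp
      qed
      \<comment> \<open>Step functions jump, so equicontinuity can hold only for all large m at each
        \<epsilon>. Values of \<open>g m\<close> at close times are joined by a chain lying over a
        short piece of \<beta>, to which \<open>chains_small\<close> applies.\<close>
      have equi: "\<exists>\<delta>>0. \<exists>M. \<forall>m\<ge>M. \<forall>s\<in>{t..T}. \<forall>s'\<in>{t..T}. \<bar>s - s'\<bar> < \<delta> \<longrightarrow> dist (g m s) (g m s') < \<epsilon>"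
        if \<epsilon>: "\<epsilon> > 0" for \<epsilon>
      proof -
        obtain d' where d': "d' > 0"
          "\<And>x m. \<lbrakk>\<And>j. j \<le> m \<Longrightarrow> x j \<in> K'; \<And>j. j \<le> m \<Longrightarrow> dist (f (x j)) (f (x 0)) < d';
             \<And>j. j < m \<Longrightarrow> dist (x (Suc j)) (x j) < d'\<rbrakk> \<Longrightarrow> dist (x m) (x (0::nat)) < \<epsilon>"
          using chains_small[OF K'(1) fK' fibK' \<epsilon>] by metis
        obtain \<tau>' where \<tau>': "\<tau>' > 0"
            "\<And>s s'. s \<in> {0..L} \<Longrightarrow> s' \<in> {0..L} \<Longrightarrow> \<bar>s' - s\<bar> < \<tau>' \<Longrightarrow> dist (\<beta> s') (\<beta> s) < d'"
          using unif[OF d'(1)] by blast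
        obtain M :: nat where M: "real M > 1 / min d' (\<tau>' / 2)" using reals_Archimedean2 by blast
        have M': "1 / real (Suc m) < d'" "1 / real (Suc m) < \<tau>' / 2" if "m \<ge> M" for m
        proof -
          define \<nu> where "\<nu> = min d' (\<tau>' / 2)"
          have "\<nu> > 0" using d' \<tau>' by (simp add: \<nu>_def)
          moreover have "1 / \<nu> < real (Suc m)" using M that unfolding \<nu>_def by linarith
          ultimately have "1 / real (Suc m) < \<nu>" by (simp add: field_simps)
          then have "1 / real (Suc m) < min d' (\<tau>' / 2)" by (simp add: \<nu>_def)
          then show "1 / real (Suc m) < d'" "1 / real (Suc m) < \<tau>' / 2" by auto
        qed
        have main: "dist (g m s) (g m s') < \<epsilon>"
          if m: "m \<ge> M" and s: "s \<in> {t..T}" "s' \<in> {t..T}" "s \<le> s'" "s' - s < \<tau>' / 2" for m s s'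
        proof -
          let ?i = "idx m s" and ?i' = "idx m s'"
          have ii: "?i \<le> ?i'" "?i' \<le> N m" using s idx_mono idx_le by auto
          have "dist (c m (?i + (?i' - ?i))) (c m (?i + 0)) < \<epsilon>"
          proof (rule d'(2))
            fix j assume j: "j \<le> ?i' - ?i"
            show "c m (?i + j) \<in> K'" using j ii by (intro c(2)) auto
            have "tm m (?i + j) \<le> tm m ?i'"
              unfolding tm_def using j ii step_pos[of m] by (intro add_left_mono mult_right_mono) auto
            moreover have "tm m ?i \<le> tm m (?i + j)"
              unfolding tm_def using step_pos[of m] by (intro add_left_mono mult_right_mono) auto
            moreover have "tm m ?i' - tm m ?i < \<tau>'"
              using idx[of s m] idx[of s' m] s N(2)[of m] M'(2)[OF m] by auto
            ultimately have "\<bar>tm m (?i + j) - tm m ?i\<bar> < \<tau>'" by simp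
            then have "dist (\<beta> (tm m (?i + j))) (\<beta> (tm m ?i)) < d'"
              using j ii by (intro \<tau>'(2) tm_in) auto
            then show "dist (f (c m (?i + j))) (f (c m (?i + 0))) < d'"
              using j ii by (simp add: c(3))
          next
            fix j assume j: "j < ?i' - ?i"
            then have "dist (c m (Suc (?i + j))) (c m (?i + j)) < \<eta> m" using ii by (intro c(4)) auto
            also have "\<dots> < d'" using \<eta>(4)[of m] M'(1)[OF m] by simp
            finally show "dist (c m (?i + Suc j)) (c m (?i + j)) < d'" by simp
          qed
          then show ?thesis using ii by (simp add: g_def dist_commute)
        qed
        show ?thesis
        proof (intro exI[of _ "\<tau>' / 2"] conjI exI[of _ M] allI impI ballI)
          fix m s s' assume *: "m \<ge> M" "s \<in> {t..T}" "s' \<in> {t..T}" "\<bar>s - s'\<bar> < \<tau>' / 2"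
          show "dist (g m s) (g m s') < \<epsilon>"
          proof (cases "s \<le> s'")
            case True
            then show ?thesis using main[of m s s'] * by auto
          next
            case False
            then show ?thesis using main[of m s' s] * by (auto simp: dist_commute)
          qed
        qed (use \<tau>' in auto)
      qed
      \<comment> \<open>A subsequence converges at all rational times. Equicontinuity carries
        convergence to the other times, each of which has rational times of the interval nearby
        because t < T.\<close>
      let ?S = "\<rat> \<inter> {t..T}"
      obtain Bd where Bd: "\<And>x. x \<in> K' \<Longrightarrow> norm x \<le> Bd"
        using compact_imp_bounded[OF K'(1)] unfolding bounded_iff by blast
      have cS: "countable ?S" using countable_rat by (rule countable_subset[rotated]) simp
      have bS: "norm (g n s) \<le> Bd" if "s \<in> ?S" for n s using that gK' Bd by simp
      obtain k where k: "strict_mono (k::nat \<Rightarrow> nat)" "\<And>s. s \<in> ?S \<Longrightarrow> \<exists>l. (\<lambda>n. g (k n) s) \<longlonglongrightarrow> l"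
        using function_convergent_subsequence[of ?S g Bd, OF cS bS] by blast
      have conv: "\<exists>l. (\<lambda>n. g (k n) s) \<longlonglongrightarrow> l" if s: "s \<in> {t..T}" for s
      proof -
        have "Cauchy (\<lambda>n. g (k n) s)"
        proof (rule metric_CauchyI)
          fix \<epsilon> :: real assume "\<epsilon> > 0"
          then have "\<epsilon> / 3 > 0" by simp
          from equi[OF this] obtain \<delta>' M where \<delta>': "\<delta>' > 0"
              and eq': "\<forall>m\<ge>M. \<forall>s\<in>{t..T}. \<forall>s'\<in>{t..T}. \<bar>s - s'\<bar> < \<delta>' \<longrightarrow> dist (g m s) (g m s') < \<epsilon> / 3"
            by (elim exE conjE)
          note eq = eq'[rule_format]
          have "max t (s - \<delta>') < min T (s + \<delta>')" using s \<delta>' len by (auto simp: len_def)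
          then obtain q where q: "q \<in> \<rat>" "max t (s - \<delta>') < q" "q < min T (s + \<delta>')"
            using Rats_dense_in_real by blast
          then have qS: "q \<in> {t..T}" "\<bar>s - q\<bar> < \<delta>'" by auto
          have "Cauchy (\<lambda>n. g (k n) q)" using k(2)[of q] q qS by (auto simp: convergent_Cauchy convergent_def)
          from metric_CauchyD[OF this \<open>\<epsilon> / 3 > 0\<close>] obtain M' where M': "\<And>m n. m \<ge> M' \<Longrightarrow> n \<ge> M' \<Longrightarrow> dist (g (k m) q) (g (k n) q) < \<epsilon> / 3"
            by blast
          show "\<exists>M. \<forall>m\<ge>M. \<forall>n\<ge>M. dist (g (k m) s) (g (k n) s) < \<epsilon>"
          proof (intro exI[of _ "max M M'"] allI impI)
            fix m n assume mn: "m \<ge> max M M'" "n \<ge> max M M'"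
            then have "k m \<ge> M" "k n \<ge> M" using seq_suble[OF k(1)] by (meson le_trans max.boundedE)+
            then have "dist (g (k m) s) (g (k m) q) < \<epsilon> / 3" "dist (g (k n) s) (g (k n) q) < \<epsilon> / 3"
              using eq s qS by auto
            moreover have "dist (g (k m) q) (g (k n) q) < \<epsilon> / 3" using M' mn by auto
            ultimately show "dist (g (k m) s) (g (k n) s) < \<epsilon>"
              using dist_triangle[of "g (k m) s" "g (k n) s" "g (k m) q"]
                dist_triangle[of "g (k m) q" "g (k n) s" "g (k n) q"] by (simp add: dist_commute)
          qed
        qed
        then show ?thesis by (simp add: Cauchy_convergent_iff convergent_def)
      qed
      then obtain G where G: "\<And>s. s \<in> {t..T} \<Longrightarrow> (\<lambda>n. g (k n) s) \<longlonglongrightarrow> G s" by metis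
      have GK': "G s \<in> K'" if "s \<in> {t..T}" for s
        by (rule closed_sequentially[OF compact_imp_closed[OF K'(1)] gK'[OF that] G[OF that]])
      have fG: "f (G s) = \<beta> s" if s: "s \<in> {t..T}" for s
      proof -
        have 1: "(\<lambda>n. f (g (k n) s)) \<longlonglongrightarrow> f (G s)"
          using gK'[OF s] by (intro continuous_on_tendsto_compose[OF fK' G[OF s] GK'[OF s]] always_eventually allI)
        have "(\<lambda>n. dist (f (g (k n) s)) (\<beta> s)) \<longlonglongrightarrow> 0"
        proof (rule tendsto_sandwich[OF _ _ tendsto_const subseq_inverse_Suc_tendsto[OF k(1)]])
          show "\<forall>\<^sub>F n in sequentially. dist (f (g (k n) s)) (\<beta> s) \<le> 1 / real (Suc (k n))"
            using fg[OF s] by (intro always_eventually allI less_imp_le)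
        qed simp
        then have "(\<lambda>n. f (g (k n) s)) \<longlonglongrightarrow> \<beta> s" by (subst tendsto_dist_iff)
        then show ?thesis using 1 LIMSEQ_unique by blast
      qed
      have "continuous_on {t..T} G"
        unfolding continuous_on_iff
      proof (intro ballI allI impI)
        fix s and \<epsilon> :: real assume s: "s \<in> {t..T}" and "\<epsilon> > 0"
        then have "\<epsilon> / 2 > 0" by simp
        from equi[OF this] obtain \<delta>' M where \<delta>': "\<delta>' > 0"
            and eq': "\<forall>m\<ge>M. \<forall>s\<in>{t..T}. \<forall>s'\<in>{t..T}. \<bar>s - s'\<bar> < \<delta>' \<longrightarrow> dist (g m s) (g m s') < \<epsilon> / 2"
          by (elim exE conjE)
        note eq = eq'[rule_format]
        show "\<exists>\<delta>>0. \<forall>s'\<in>{t..T}. dist s' s < \<delta> \<longrightarrow> dist (G s') (G s) < \<epsilon>"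
        proof (intro exI[of _ \<delta>'] conjI ballI impI \<delta>')
          fix s' assume s': "s' \<in> {t..T}" "dist s' s < \<delta>'"
          have "dist (G s') (G s) \<le> \<epsilon> / 2"
          proof (rule tendsto_upperbound[OF tendsto_dist[OF G[OF s'(1)] G[OF s]]])
            have "\<forall>\<^sub>F n in sequentially. k n \<ge> M"
              using eventually_ge_at_top[of M] by eventually_elim (meson k(1) le_trans seq_suble)
            then show "\<forall>\<^sub>F n in sequentially. dist (g (k n) s') (g (k n) s) \<le> \<epsilon> / 2"
              by eventually_elim (use eq s s' in \<open>auto simp: dist_real_def intro!: less_imp_le\<close>)
          qed simp
          then show "dist (G s') (G s) < \<epsilon>" using \<open>\<epsilon> > 0\<close> by simp
        qed
      qed
      moreover have "G t = x"
      proof -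
        have "g m t = x" for m by (simp add: g_def idx_def c(1))
        then show ?thesis using G[of t] T by (auto intro: LIMSEQ_unique[OF _ tendsto_const])
      qed
      ultimately show ?thesis using GK' fG by blast
    qed
    then show "\<exists>\<gamma>. continuous_on {t..min (t + \<tau> / 2) L} \<gamma> \<and> \<gamma> t = x \<and> (\<forall>s\<in>{t..min (t + \<tau> / 2) L}. \<gamma> s \<in> K' \<and> f (\<gamma> s) = \<beta> s)"
      unfolding T_def .
  qed (use \<tau> in auto)
qed

text \<open>As \<tau> does not shrink, finitely many short lifts either reach norm R or lift the
  whole path. The second outcome is excluded, since a lift staying in the ball would give \<beta> L
  a preimage there. The margin up to R' is where a short lift may run past norm R.\<close>

lemma lift_until_exit:
  assumes R: "0 < R" "R < R'" "cball 0 R' \<subseteq> U" and \<beta>: "continuous_on {0..L::real} \<beta>" and L: "L \<ge> 0"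
    and x: "x \<in> ball 0 R" "f x = \<beta> 0" and exit: "\<beta> L \<notin> f ` ball 0 R"
  obtains T \<gamma> where "0 \<le> T" "T \<le> L" "continuous_on {0..T} \<gamma>" "\<gamma> 0 = x" "norm (\<gamma> T) \<ge> R"
    "\<And>s. s \<in> {0..T} \<Longrightarrow> f (\<gamma> s) = \<beta> s"
proof -
  have R_pos: "R' - R > 0" using R by simp
  have sub: "cball y (R' - R) \<subseteq> cball 0 R'" if "y \<in> cball 0 R" for y :: 'a
  proof
    fix z assume "z \<in> cball y (R' - R)"
    then show "z \<in> cball 0 R'" using that dist_triangle[of 0 z y] by simp
  qed
  obtain \<tau> where \<tau>: "\<tau> > 0" "\<And>t x. \<lbrakk>0 \<le> t; t \<le> L; x \<in> cball 0 R; f x = \<beta> t\<rbrakk> \<Longrightarrow>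
     \<exists>\<gamma>. continuous_on {t..min (t + \<tau>) L} \<gamma> \<and> \<gamma> t = x \<and>
       (\<forall>s\<in>{t..min (t + \<tau>) L}. \<gamma> s \<in> cball 0 R' \<and> f (\<gamma> s) = \<beta> s)"
  proof (rule short_lift[where K = "cball 0 R", OF compact_cball R(3) R_pos sub \<beta>], goal_cases)
    case (1 y)
    show ?case by (rule 1(2))
  next
    case (2 \<tau>)
    show ?case by (rule 2(1)[OF 2(2,3)])
  qed
  define lift where "lift T \<gamma> \<longleftrightarrow> 0 \<le> T \<and> T \<le> L \<and> continuous_on {0..T} \<gamma> \<and> \<gamma> 0 = x \<and> (\<forall>s\<in>{0..T}. f (\<gamma> s) = \<beta> s)"
    for T \<gamma>
  have ex: "(\<exists>T \<gamma>. lift T \<gamma> \<and> norm (\<gamma> T) \<ge> R) \<or> (\<exists>\<gamma>. lift (min (real k * \<tau>) L) \<gamma>)" for k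
  proof (induction k)
    case 0
    have "lift (min (real 0 * \<tau>) L) (\<lambda>_. x)" using x L by (auto simp: lift_def)
    then show ?case by blast
  next
    case (Suc k)
    show ?case
    proof (cases "\<exists>T \<gamma>. lift T \<gamma> \<and> norm (\<gamma> T) \<ge> R")
      case False
      then obtain \<gamma> where \<gamma>: "lift (min (real k * \<tau>) L) \<gamma>" using Suc by blast
      define T where "T = min (real k * \<tau>) L"
      have T: "0 \<le> T" "T \<le> L" using \<gamma> by (auto simp: T_def lift_def)
      have "norm (\<gamma> T) < R" using False \<gamma> unfolding T_def by fastforce
      then obtain \<gamma>' where \<gamma>': "continuous_on {T..min (T + \<tau>) L} \<gamma>'" "\<gamma>' T = \<gamma> T"
          "\<forall>s\<in>{T..min (T + \<tau>) L}. f (\<gamma>' s) = \<beta> s"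
        using \<tau>(2)[OF T, of "\<gamma> T"] \<gamma> T unfolding lift_def T_def[symmetric] by (metis atLeastAtMost_iff less_imp_le mem_cball_0 order_refl)
      have eq: "min (real (Suc k) * \<tau>) L = min (T + \<tau>) L"
        using \<tau>(1) by (auto simp: T_def algebra_simps min_def)
      let ?T' = "min (T + \<tau>) L"
      have TT': "T \<le> ?T'" using T \<tau>(1) by simp
      have "continuous_on {0..?T'} (\<lambda>s. if s \<le> T then \<gamma> s else \<gamma>' s)"
      proof (rule continuous_on_cases_le)
        have "{s \<in> {0..?T'}. s \<le> T} = {0..T}" "{s \<in> {0..?T'}. T \<le> s} = {T..?T'}" using TT' T by auto
        then show "continuous_on {s \<in> {0..?T'}. s \<le> T} \<gamma>" "continuous_on {s \<in> {0..?T'}. T \<le> s} \<gamma>'"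
          using \<gamma> \<gamma>' by (simp_all add: lift_def T_def[symmetric])
      qed (use \<gamma>' in \<open>auto intro: continuous_intros\<close>)
      then have "lift ?T' (\<lambda>s. if s \<le> T then \<gamma> s else \<gamma>' s)"
        using \<gamma> \<gamma>' T TT' unfolding lift_def T_def[symmetric] by auto
      then show ?thesis unfolding eq by blast
    qed blast
  qed
  have "\<exists>T \<gamma>. lift T \<gamma> \<and> norm (\<gamma> T) \<ge> R"
  proof (rule ccontr)
    assume no: "\<not> ?thesis"
    obtain k :: nat where "real k > L / \<tau>" using reals_Archimedean2 by blast
    then have "min (real k * \<tau>) L = L" using \<tau>(1) by (simp add: field_simps)
    then obtain \<gamma> where \<gamma>: "lift L \<gamma>" using ex[of k] no by auto
    then have "norm (\<gamma> L) < R" using no by fastforce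
    moreover have "f (\<gamma> L) = \<beta> L" using \<gamma> L by (simp add: lift_def)
    ultimately show False using exit by (metis image_eqI mem_ball_0)
  qed
  then show ?thesis using that unfolding lift_def by blast
qed

end

text \<open>Take b as the first time at level \<open>r\<^sub>2\<close> and a as the last time before
  b at level \<open>r\<^sub>1\<close>. By the intermediate value theorem, a value outside the open
  range in between would produce an earlier or a later crossing.\<close>

lemma last_first_crossing:
  fixes g :: "real \<Rightarrow> real"
  assumes g: "continuous_on {0..T} g" and T: "0 \<le> T" and r: "g 0 \<le> r\<^sub>1" "r\<^sub>1 < r\<^sub>2" "r\<^sub>2 \<le> g T"
  obtains a b where "0 \<le> a" "a \<le> b" "b \<le> T" "g a = r\<^sub>1" "g b = r\<^sub>2" "\<And>t. a < t \<Longrightarrow> t < b \<Longrightarrow> r\<^sub>1 < g t \<and> g t < r\<^sub>2"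
proof -
  have comp: "compact {t \<in> {0..s}. g t = r}" if "s \<le> T" for r s
  proof -
    have "{t \<in> {0..s}. g t = r} = {0..s} \<inter> g -` {r}" by auto
    moreover have "closed ({0..s} \<inter> g -` {r})"
      using that by (intro continuous_closed_preimage continuous_on_subset[OF g]) auto
    ultimately show ?thesis by (simp add: compact_eq_bounded_closed bounded_Int)
  qed
  have IVT: "\<exists>t\<in>{u..v}. g t = r" if "0 \<le> u" "u \<le> v" "v \<le> T" "g u \<le> r" "r \<le> g v" for u v r
    using IVT'[of g u r v] that continuous_on_subset[OF g, of "{u..v}"] by force
  have "{t \<in> {0..T}. g t = r\<^sub>2} \<noteq> {}" using IVT[of 0 T r\<^sub>2] r T by auto
  then obtain b where b: "b \<in> {0..T}" "g b = r\<^sub>2" "\<And>t. t \<in> {0..T} \<Longrightarrow> g t = r\<^sub>2 \<Longrightarrow> b \<le> t"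
    using compact_attains_inf[OF comp[of T r\<^sub>2]] by auto
  have "{t \<in> {0..b}. g t = r\<^sub>1} \<noteq> {}" using IVT[of 0 b r\<^sub>1] r b by auto
  then obtain a where a: "a \<in> {0..b}" "g a = r\<^sub>1" "\<And>t. t \<in> {0..b} \<Longrightarrow> g t = r\<^sub>1 \<Longrightarrow> t \<le> a"
    using compact_attains_sup[OF comp[of b r\<^sub>1]] b by auto
  show ?thesis
  proof (rule that[of a b])
    fix t assume t: "a < t" "t < b"
    have "r\<^sub>1 < g t"
    proof (rule ccontr)
      assume "\<not> r\<^sub>1 < g t"
      then obtain s where "s \<in> {t..b}" "g s = r\<^sub>1" using IVT[of t b r\<^sub>1] t a b r by auto
      then show False using a(1) a(3)[of s] t by auto
    qed
    moreover have "g t < r\<^sub>2"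
    proof (rule ccontr)
      assume "\<not> g t < r\<^sub>2"
      then obtain s where "s \<in> {0..t}" "g s = r\<^sub>2" using IVT[of 0 t r\<^sub>2] t a b r by auto
      then show False using b(3)[of s] b(1) t by auto
    qed
    ultimately show "r\<^sub>1 < g t \<and> g t < r\<^sub>2" by blast
  qed (use a b in auto)
qed


section \<open>Curves parametrised by arc length\<close>

abbreviation polygon_length :: "(real \<Rightarrow> 'a::metric_space) \<Rightarrow> real list \<Rightarrow> real" where
  "polygon_length \<gamma> ts \<equiv> (\<Sum>i < length ts - 1. dist (\<gamma> (ts ! i)) (\<gamma> (ts ! Suc i)))"

lemma polygon_length_snoc:
  "ts \<noteq> [] \<Longrightarrow> polygon_length \<gamma> (ts @ [t]) = polygon_length \<gamma> ts + dist (\<gamma> (last ts)) (\<gamma> t)"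
proof -
  assume "ts \<noteq> []"
  then obtain m where m: "length ts = Suc m" by (cases ts) auto
  then show ?thesis
    using \<open>ts \<noteq> []\<close> by (simp add: nth_append last_conv_nth)
qed

lemma polygon_length_snoc_ge: "polygon_length \<gamma> ts \<le> polygon_length \<gamma> (ts @ [t])"
proof (cases "ts = []")
  case False
  show ?thesis unfolding polygon_length_snoc[OF False] by simp
qed simp

lemma polygon_length_le:
  assumes "\<And>u v. a \<le> u \<Longrightarrow> u \<le> v \<Longrightarrow> v \<le> b \<Longrightarrow> dist (\<gamma> u) (\<gamma> v) \<le> v - u"
    and "sorted ts" "set ts \<subseteq> {a..b}" "ts \<noteq> []"
  shows "polygon_length \<gamma> ts \<le> last ts - hd ts"
  using assms(2-4)
proof (induction ts rule: rev_induct)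
  case (snoc t ts)
  show ?case
  proof (cases "ts = []")
    case False
    have "last ts \<le> t" "last ts \<in> {a..b}" "t \<le> b"
      using snoc.prems subsetD[OF _ last_in_set[OF False], of "{a..b}"] last_in_set[OF False]
      by (auto simp: sorted_append)
    then have "dist (\<gamma> (last ts)) (\<gamma> t) \<le> t - last ts" using assms(1)[of "last ts" t] by auto
    moreover have "polygon_length \<gamma> ts \<le> last ts - hd ts"
      using snoc False by (auto simp: sorted_append)
    ultimately show ?thesis unfolding polygon_length_snoc[OF False] using False by simp
  qed simp
qed simp

lemma curve_length_le:
  assumes "a \<le> b" "\<And>u v. a \<le> u \<Longrightarrow> u \<le> v \<Longrightarrow> v \<le> b \<Longrightarrow> dist (\<gamma> u) (\<gamma> v) \<le> v - u"
  shows "curve_length \<gamma> a b \<le> ennreal (b - a)"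
  unfolding curve_length_def
proof (rule SUP_least)
  fix ts assume ts: "ts \<in> {ts. sorted ts \<and> set ts \<subseteq> {a..b}}"
  show "ennreal (polygon_length \<gamma> ts) \<le> ennreal (b - a)"
  proof (cases "ts = []")
    case False
    have "polygon_length \<gamma> ts \<le> last ts - hd ts"
      using ts False assms(2) by (intro polygon_length_le[of a b]) auto
    also have "\<dots> \<le> b - a"
      using ts subsetD[OF _ last_in_set[OF False], of "{a..b}"] subsetD[OF _ hd_in_set[OF False], of "{a..b}"]
      by auto
    finally show ?thesis by (rule ennreal_leI)
  qed simp
qed

lemma dist_le_curve_length: "a \<le> b \<Longrightarrow> ennreal (dist (\<gamma> a) (\<gamma> b)) \<le> curve_length \<gamma> a b"
  unfolding curve_length_def by (rule SUP_upper2[of "[a, b]"]) auto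

lemma curve_length_add_le:
  assumes "a \<le> c" "c \<le> b"
  shows "curve_length \<gamma> a c + ennreal (dist (\<gamma> c) (\<gamma> b)) \<le> curve_length \<gamma> a b"
proof -
  have "curve_length \<gamma> a c + ennreal (dist (\<gamma> c) (\<gamma> b))
      = (SUP ts \<in> {ts. sorted ts \<and> set ts \<subseteq> {a..c}}. ennreal (polygon_length \<gamma> ts) + ennreal (dist (\<gamma> c) (\<gamma> b)))"
    unfolding curve_length_def
    by (rule ennreal_SUP_add_left[symmetric]) (auto intro: exI[of _ "[]"])
  also have "\<dots> \<le> curve_length \<gamma> a b"
  proof (rule SUP_least)
    fix ts assume ts: "ts \<in> {ts. sorted ts \<and> set ts \<subseteq> {a..c}}"
    have "ennreal (polygon_length \<gamma> ts) + ennreal (dist (\<gamma> c) (\<gamma> b))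
        = ennreal (polygon_length \<gamma> ts + dist (\<gamma> c) (\<gamma> b))"
      by (simp add: sum_nonneg)
    also have "\<dots> \<le> ennreal (polygon_length \<gamma> ((ts @ [c]) @ [b]))"
      using polygon_length_snoc_ge[of \<gamma> ts c] polygon_length_snoc[of "ts @ [c]" \<gamma> b]
      by (intro ennreal_leI) (simp del: length_append append_assoc)
    also have "\<dots> \<le> curve_length \<gamma> a b"
      unfolding curve_length_def using ts assms
      by (intro SUP_upper) (auto simp: sorted_append)
    finally show "ennreal (polygon_length \<gamma> ts) + ennreal (dist (\<gamma> c) (\<gamma> b)) \<le> curve_length \<gamma> a b" .
  qed
  finally show ?thesis .
qed

lemma curve_length_cong:
  assumes "\<And>t. a \<le> t \<Longrightarrow> t \<le> b \<Longrightarrow> \<gamma> t = \<gamma>' t"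
  shows "curve_length \<gamma> a b = curve_length \<gamma>' a b"
  unfolding curve_length_def
proof (intro SUP_cong refl arg_cong[of _ _ ennreal] sum.cong)
  fix ts i assume "ts \<in> {ts. sorted ts \<and> set ts \<subseteq> {a..b}}" "i \<in> {..<length ts - 1}"
  then have "ts ! i \<in> set ts" "ts ! Suc i \<in> set ts" "set ts \<subseteq> {a..b}" by auto
  then have "ts ! i \<in> {a..b}" "ts ! Suc i \<in> {a..b}" by blast+
  then show "dist (\<gamma> (ts ! i)) (\<gamma> (ts ! Suc i)) = dist (\<gamma>' (ts ! i)) (\<gamma>' (ts ! Suc i))"
    using assms by simp
qed

text \<open>For such a curve \<open>arc_length_param\<close> is a translation and the line integral
  an ordinary integral in t. Continuity on the whole line gives Borel measurability of \<beta>; only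
  its values on [0, L] carry meaning.\<close>

definition arclength_curve :: "(real \<Rightarrow> 'a::euclidean_space) \<Rightarrow> real \<Rightarrow> bool" where
  "arclength_curve \<beta> L \<longleftrightarrow> 0 \<le> L \<and> continuous_on UNIV \<beta> \<and>
     (\<forall>s t. 0 \<le> s \<and> s \<le> t \<and> t \<le> L \<longrightarrow> curve_length \<beta> s t = ennreal (t - s))"

lemma arclength_curve_dist:
  assumes "arclength_curve \<beta> L" "0 \<le> s" "s \<le> t" "t \<le> L"
  shows "dist (\<beta> s) (\<beta> t) \<le> t - s"
  using assms dist_le_curve_length[of s t \<beta>] unfolding arclength_curve_def by simp

lemma arclength_curve_const: "arclength_curve (\<lambda>_. x) 0"
proof -
  have "curve_length (\<lambda>_. x) 0 0 \<le> ennreal (0 - 0)" by (rule curve_length_le) auto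
  then have "curve_length (\<lambda>_. x) s t = ennreal (t - s)" if "0 \<le> s" "s \<le> t" "t \<le> 0" for s t
  proof -
    have "s = 0" "t = 0" using that by auto
    then show ?thesis using \<open>curve_length (\<lambda>_. x) 0 0 \<le> ennreal (0 - 0)\<close> by simp
  qed
  then show ?thesis by (simp add: arclength_curve_def)
qed

lemma arclength_curve_translate:
  assumes "arclength_curve \<beta> L" shows "arclength_curve (\<lambda>t. \<beta> t + z) L"
proof -
  have "curve_length (\<lambda>t. \<beta> t + z) s t = curve_length \<beta> s t" for s t
    unfolding curve_length_def by simp
  then show ?thesis using assms by (auto simp: arclength_curve_def intro!: continuous_intros)
qed

text \<open>A straight segment in direction e is appended; \<open>min\<close> and \<open>max\<close>
  keep the map continuous on the whole line. It is 1-Lipschitz on [0, L + l], which bounds lengths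
  from above; from below, the chord of the segment is added to the length up to L.\<close>

lemma arclength_curve_extend:
  assumes \<beta>: "arclength_curve \<beta> L" and l: "0 \<le> l" and e: "norm e = 1"
  shows "arclength_curve (\<lambda>t. \<beta> (min t L) + max 0 (t - L) *\<^sub>R e) (L + l)" (is "arclength_curve ?\<gamma> _")
proof -
  have cont: "continuous_on UNIV \<beta>" and L: "0 \<le> L" using \<beta> by (auto simp: arclength_curve_def)
  have "continuous_on UNIV (\<lambda>t. \<beta> (min t L))"
    by (rule continuous_on_compose2[OF cont]) (auto intro!: continuous_intros)
  then have "continuous_on UNIV ?\<gamma>" by (intro continuous_intros)
  moreover have "curve_length ?\<gamma> s t = ennreal (t - s)" if st: "0 \<le> s" "s \<le> t" "t \<le> L + l" for s t
  proof (rule antisym)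
    show "curve_length ?\<gamma> s t \<le> ennreal (t - s)"
    proof (rule curve_length_le[OF st(2)])
      fix u v assume uv: "s \<le> u" "u \<le> v" "v \<le> t"
      have "dist (?\<gamma> u) (?\<gamma> v) \<le> dist (\<beta> (min u L)) (\<beta> (min v L)) + dist (max 0 (u - L) *\<^sub>R e) (max 0 (v - L) *\<^sub>R e)"
        by (rule dist_triangle_add)
      also have "dist (max 0 (u - L) *\<^sub>R e) (max 0 (v - L) *\<^sub>R e) = max 0 (v - L) - max 0 (u - L)"
        using uv e by (simp add: dist_norm flip: scaleR_diff_left)
      also have "dist (\<beta> (min u L)) (\<beta> (min v L)) \<le> min v L - min u L"
        using uv st L by (intro arclength_curve_dist[OF \<beta>]) auto
      finally show "dist (?\<gamma> u) (?\<gamma> v) \<le> v - u" using uv by (simp add: min_def max_def split: if_splits)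
    qed
    show "ennreal (t - s) \<le> curve_length ?\<gamma> s t"
    proof (cases "L \<le> s")
      case True
      have "dist (?\<gamma> s) (?\<gamma> t) = t - s"
        using True st e by (simp add: dist_norm flip: scaleR_diff_left)
      then show ?thesis using dist_le_curve_length[OF st(2), of ?\<gamma>] by simp
    next
      case False
      show ?thesis
      proof (cases "t \<le> L")
        case True
        have "curve_length ?\<gamma> s t = curve_length \<beta> s t"
          using True by (intro curve_length_cong) auto
        then show ?thesis using \<beta> True st by (simp add: arclength_curve_def)
      next
        case tL: False
        have "curve_length ?\<gamma> s L = curve_length \<beta> s L"
          by (intro curve_length_cong) auto
        then have "curve_length ?\<gamma> s L = ennreal (L - s)"
          using \<beta> False st by (simp add: arclength_curve_def)
        moreover have "dist (?\<gamma> L) (?\<gamma> t) = t - L"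
          using tL e by (simp add: dist_norm)
        ultimately have "ennreal (L - s) + ennreal (t - L) \<le> curve_length ?\<gamma> s t"
          using curve_length_add_le[of s L t ?\<gamma>] False tL by simp
        then show ?thesis using False tL by (simp add: ennreal_plus[symmetric] del: ennreal_plus)
      qed
    qed
  qed
  ultimately show ?thesis using L l by (simp add: arclength_curve_def)
qed

text \<open>The length of g from a to t is t - a, so the choice in \<open>arc_length_param\<close>
  has the single candidate a + s. Agreement with \<beta> is asked on [a, b] only, because g will be
  the image of a piece of a lift.\<close>

lemma line_integral_arclength_le:
  assumes \<beta>: "arclength_curve \<beta> L" and ab: "0 \<le> a" "a \<le> b" "b \<le> L"
    and g: "\<And>t. a \<le> t \<Longrightarrow> t \<le> b \<Longrightarrow> g t = \<beta> t" and \<rho> [measurable]: "\<rho> \<in> borel_measurable borel"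
  shows "line_integral \<rho> g a b \<le> (\<integral>\<^sup>+t\<in>{0..L}. \<rho> (\<beta> t) \<partial>lborel)"
proof -
  have [measurable]: "\<beta> \<in> borel_measurable borel"
    using \<beta> by (intro borel_measurable_continuous_onI) (simp add: arclength_curve_def)
  have len: "curve_length g a t = ennreal (t - a)" if "a \<le> t" "t \<le> b" for t
  proof -
    have "curve_length g a t = curve_length \<beta> a t"
      using that g by (intro curve_length_cong) auto
    then show ?thesis using \<beta> ab that by (simp add: arclength_curve_def)
  qed
  have param: "arc_length_param g a b s = \<beta> (a + s)" if s: "0 \<le> s" "s \<le> b - a" for s
  proof -
    have "(SOME t. t \<in> {a..b} \<and> curve_length g a t = ennreal s) = a + s"
    proof (rule some_equality)
      show "a + s \<in> {a..b} \<and> curve_length g a (a + s) = ennreal s" using s len[of "a + s"] by auto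
      fix t assume t: "t \<in> {a..b} \<and> curve_length g a t = ennreal s"
      then have "ennreal (t - a) = ennreal s" using len[of t] by auto
      then show "t = a + s" using t s by auto
    qed
    then show ?thesis using g[of "a + s"] s by (simp add: arc_length_param_def)
  qed
  have "line_integral \<rho> g a b = (\<integral>\<^sup>+s\<in>{0..b - a}. \<rho> (arc_length_param g a b s) \<partial>lebesgue)"
    using ab len[of b] by (simp add: line_integral_def)
  also have "\<dots> = (\<integral>\<^sup>+s. \<rho> (\<beta> (a + s)) * indicator {0..b - a} s \<partial>lebesgue)"
    using param by (intro nn_integral_cong) (auto simp: indicator_def)
  also have "\<dots> = (\<integral>\<^sup>+s. \<rho> (\<beta> (a + s)) * indicator {0..b - a} s \<partial>lborel)"
    by (intro nn_integral_completion) measurable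
  also have "\<dots> = (\<integral>\<^sup>+t. \<rho> (\<beta> t) * indicator {a..b} t \<partial>lborel)"
    by (subst nn_integral_real_affine[of "\<lambda>t. \<rho> (\<beta> t) * indicator {a..b} t" 1 a])
       (auto intro!: nn_integral_cong simp: indicator_def)
  also have "\<dots> \<le> (\<integral>\<^sup>+t\<in>{0..L}. \<rho> (\<beta> t) \<partial>lborel)"
    using ab by (intro nn_integral_mono) (auto simp: indicator_def)
  finally show ?thesis .
qed

lemma curve_integral_arclength_le:
  assumes \<beta>: "arclength_curve \<beta> L" and ab: "0 \<le> a" "a \<le> b" "b \<le> L"
    and g: "\<And>t. a \<le> t \<Longrightarrow> t \<le> b \<Longrightarrow> g t = \<beta> t" and \<rho>: "\<rho> \<in> borel_measurable borel"
  shows "curve_integral \<rho> ({a..b}, g) \<le> (\<integral>\<^sup>+t\<in>{0..L}. \<rho> (\<beta> t) \<partial>lborel)"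
    and "locally_rectifiable ({a..b}, g)"
proof -
  show "curve_integral \<rho> ({a..b}, g) \<le> (\<integral>\<^sup>+t\<in>{0..L}. \<rho> (\<beta> t) \<partial>lborel)"
    unfolding curve_integral_def using ab g
    by (auto intro!: SUP_least line_integral_arclength_le[OF \<beta> _ _ _ _ \<rho>])
  show "locally_rectifiable ({a..b}, g)"
    unfolding locally_rectifiable_def
  proof clarsimp
    fix s t assume st: "s \<le> t" "a \<le> s" "t \<le> b"
    have "curve_length g s t = curve_length \<beta> s t" using st g by (intro curve_length_cong) auto
    also have "\<dots> < top" using \<beta> st ab by (simp add: arclength_curve_def)
    finally show "curve_length g s t < top" .
  qed
qed

text \<open>A lift of \<beta> starts with norm below \<open>r\<^sub>1\<close> and reaches norm at
  least \<open>r\<^sub>2\<close>. Its piece between suitable crossings joins the two spheres in the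
  ring, and the image of that piece is an arc of \<beta>; so already this arc has \<rho>-length at
  least one.\<close>

lemma (in open_discrete_map) admissible_arclength:
  assumes r: "0 < r\<^sub>1" "r\<^sub>1 < r\<^sub>2" "r\<^sub>2 < r\<^sub>3" "cball 0 r\<^sub>3 \<subseteq> U"
    and \<rho>: "\<rho> \<in> admissible (image_curves f (joining_curves (sphere 0 r\<^sub>1) (sphere 0 r\<^sub>2) (annulus r\<^sub>1 r\<^sub>2 0)))"
    and \<beta>: "arclength_curve \<beta> L" "\<beta> 0 \<in> f ` ball 0 r\<^sub>1" "\<beta> L \<notin> f ` ball 0 r\<^sub>2"
  shows "1 \<le> (\<integral>\<^sup>+t\<in>{0..L}. \<rho> (\<beta> t) \<partial>lborel)"
proof -
  have L: "0 \<le> L" and cont\<beta>: "continuous_on {0..L} \<beta>"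
    using \<beta>(1) continuous_on_subset by (auto simp: arclength_curve_def)
  obtain x where x: "x \<in> ball 0 r\<^sub>1" "f x = \<beta> 0" using \<beta>(2) by auto
  then have "x \<in> ball 0 r\<^sub>2" using r by auto
  then obtain T \<gamma> where T: "0 \<le> T" "T \<le> L" and \<gamma>: "continuous_on {0..T} \<gamma>" "\<gamma> 0 = x" "norm (\<gamma> T) \<ge> r\<^sub>2"
    "\<And>s. s \<in> {0..T} \<Longrightarrow> f (\<gamma> s) = \<beta> s"
    using lift_until_exit[OF _ r(3,4) cont\<beta> L _ x(2) \<beta>(3)] r by (metis less_trans)
  have "continuous_on {0..T} (\<lambda>t. norm (\<gamma> t))" using \<gamma>(1) by (rule continuous_on_norm)
  then obtain a b where ab: "0 \<le> a" "a \<le> b" "b \<le> T" "norm (\<gamma> a) = r\<^sub>1" "norm (\<gamma> b) = r\<^sub>2"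
      "\<And>t. a < t \<Longrightarrow> t < b \<Longrightarrow> r\<^sub>1 < norm (\<gamma> t) \<and> norm (\<gamma> t) < r\<^sub>2"
    using last_first_crossing[OF _ T(1), of "\<lambda>t. norm (\<gamma> t)" r\<^sub>1 r\<^sub>2] \<gamma> x r by auto
  have "continuous_on {a..b} \<gamma>" using \<gamma>(1) by (rule continuous_on_subset) (use ab in auto)
  then have "({a..b}, \<gamma>) \<in> joining_curves (sphere 0 r\<^sub>1) (sphere 0 r\<^sub>2) (annulus r\<^sub>1 r\<^sub>2 0)"
    unfolding joining_curves_def annulus_def using ab by auto
  then have mem: "({a..b}, f \<circ> \<gamma>) \<in> image_curves f (joining_curves (sphere 0 r\<^sub>1) (sphere 0 r\<^sub>2) (annulus r\<^sub>1 r\<^sub>2 0))"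
    unfolding image_curves_def by force
  have eq: "(f \<circ> \<gamma>) t = \<beta> t" if "a \<le> t" "t \<le> b" for t using \<gamma>(4) ab that by simp
  have meas: "\<rho> \<in> borel_measurable borel" using \<rho> by (simp add: admissible_def)
  have bL: "b \<le> L" using ab T by simp
  note ci = curve_integral_arclength_le[OF \<beta>(1) ab(1,2) bL eq meas]
  have "1 \<le> curve_integral \<rho> ({a..b}, f \<circ> \<gamma>)"
    using \<rho> mem ci(2) unfolding admissible_def by blast
  also note ci(1)
  finally show ?thesis .
qed


section \<open>The modulus of the image of a ring\<close>

lemma arclength_curve_measurable: "arclength_curve \<beta> L \<Longrightarrow> \<beta> \<in> borel_measurable borel"
  by (intro borel_measurable_continuous_onI) (simp add: arclength_curve_def)

lemma epowr_measurable [measurable]: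
  assumes [measurable]: "g \<in> borel_measurable M"
  shows "(\<lambda>x. g x epowr p) \<in> borel_measurable M"
  unfolding epowr_def by measurable

lemma epowr_ennreal: "x \<ge> 0 \<Longrightarrow> ennreal x epowr p = ennreal (x powr p)"
  by (simp add: epowr_def)

text \<open>The tangent to the power function at \<open>a\<close> lies below its graph. Integrated
  with \<open>a\<close> an average, this becomes Jensen's inequality.\<close>

lemma Young_epowr:
  assumes p: "p > 1" and a: "a \<ge> 0"
  shows "ennreal (p * a powr (p - 1)) * x \<le> x epowr p + ennreal ((p - 1) * a powr p)"
proof (cases x)
  case (real v)
  have "v * a powr (p - 1) \<le> v powr p / p + (a powr (p - 1)) powr (p / (p - 1)) / (p / (p - 1))"
    using p a real by (intro Young_scaled) auto
  also have "(a powr (p - 1)) powr (p / (p - 1)) = a powr p" using p by (simp add: powr_powr)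
  finally have "p * (v * a powr (p - 1)) \<le> p * (v powr p / p + a powr p / (p / (p - 1)))"
    using p by (intro mult_left_mono) auto
  also have "\<dots> = v powr p + (p - 1) * a powr p" using p by (simp add: field_simps)
  finally show ?thesis
    using real p a by (simp add: epowr_ennreal ennreal_mult'[symmetric] ennreal_plus[symmetric] ennreal_leI ac_simps del: ennreal_plus)
next
  case top
  then show ?thesis by (simp add: epowr_def)
qed

lemma le_one_plus_epowr: "p > 1 \<Longrightarrow> x \<le> 1 + x epowr p"
proof (cases x)
  case (real v)
  assume p: "p > 1"
  have "v \<le> 1 + v powr p"
  proof (cases "v \<le> 1")
    case True then show ?thesis by (simp add: add_increasing2)
  next
    case False
    then have "v powr 1 \<le> v powr p" using p by (intro powr_mono) auto
    then show ?thesis using False by simp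
  qed
  then have "ennreal v \<le> ennreal (1 + v powr p)" by (rule ennreal_leI)
  then show ?thesis using real by (simp add: epowr_ennreal)
qed (simp add: epowr_def)

lemma nn_integral_lborel_translate:
  assumes "g \<in> borel_measurable (borel :: 'a::euclidean_space measure)"
  shows "(\<integral>\<^sup>+y. g (y + z) \<partial>lborel) = (\<integral>\<^sup>+y. g y \<partial>lborel)"
proof -
  have "(\<integral>\<^sup>+y. g y \<partial>lborel) = (\<integral>\<^sup>+y. g y \<partial>distr lborel borel ((+) z))" by (simp add: lborel_distr_plus)
  also have "\<dots> = (\<integral>\<^sup>+y. g (z + y) \<partial>lborel)" using assms by (simp add: nn_integral_distr)
  finally show ?thesis by (simp add: add.commute)
qed

section \<open>Averages over balls\<close>

definition ball_average :: "real \<Rightarrow> ('a::euclidean_space \<Rightarrow> ennreal) \<Rightarrow> 'a \<Rightarrow> ennreal" where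
  "ball_average r \<rho> y = (\<integral>\<^sup>+z\<in>ball 0 r. \<rho> (y + z) \<partial>lborel) / emeasure lborel (ball (0::'a) r)"

lemma ball_borel [measurable]: "ball (y::'a::euclidean_space) r \<in> sets borel"
  by simp

lemma emeasure_ball_bounds:
  assumes "r > 0"
  shows "emeasure lborel (ball (0::'a::euclidean_space) r) \<noteq> 0" "emeasure lborel (ball (0::'a) r) \<noteq> top"
  using assms unit_ball_vol_pos[of "real DIM('a)"] by (simp_all add: emeasure_ball ennreal_eq_0_iff not_le)

lemma ball_average_mult:
  fixes \<rho> :: "'a::euclidean_space \<Rightarrow> ennreal"
  assumes "r > 0"
  shows "ball_average r \<rho> y * emeasure lborel (ball (0::'a) r) = (\<integral>\<^sup>+z\<in>ball 0 r. \<rho> (y + z) \<partial>lborel)"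
  unfolding ball_average_def using emeasure_ball_bounds[OF assms, where 'a = 'a]
  by (subst ennreal_divide_times, subst ennreal_times_divide, subst ennreal_mult_divide_eq) auto

lemma ball_average_measurable [measurable]:
  assumes [measurable]: "\<rho> \<in> borel_measurable (borel :: 'a::euclidean_space measure)"
  shows "ball_average r \<rho> \<in> borel_measurable borel"
proof -
  have "(\<lambda>y. (\<integral>\<^sup>+z\<in>ball 0 r. \<rho> (y + z) \<partial>lborel) / c) \<in> borel_measurable borel" for c
    by measurable
  then show ?thesis unfolding ball_average_def[abs_def] .
qed

lemma nn_integral_ball_average:
  assumes [measurable]: "\<rho> \<in> borel_measurable (borel :: 'a::euclidean_space measure)" and r: "r > 0"
  shows "(\<integral>\<^sup>+y. ball_average r \<rho> y \<partial>lborel) = (\<integral>\<^sup>+y. \<rho> y \<partial>lborel)"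
proof -
  let ?b = "emeasure lborel (ball (0::'a) r)"
  have "(\<integral>\<^sup>+y. ball_average r \<rho> y \<partial>lborel) = (\<integral>\<^sup>+y. \<integral>\<^sup>+z. \<rho> (y + z) * indicator (ball 0 r) z \<partial>lborel \<partial>lborel) / ?b"
    unfolding ball_average_def by (rule nn_integral_divide) measurable
  also have "(\<integral>\<^sup>+y. \<integral>\<^sup>+z. \<rho> (y + z) * indicator (ball 0 r) z \<partial>lborel \<partial>lborel)
      = (\<integral>\<^sup>+z. \<integral>\<^sup>+y. \<rho> (y + z) * indicator (ball 0 r) z \<partial>lborel \<partial>lborel)"
    by (rule lborel_pair.Fubini') measurable
  also have "\<dots> = (\<integral>\<^sup>+z. (\<integral>\<^sup>+y. \<rho> y \<partial>lborel) * indicator (ball (0::'a) r) z \<partial>lborel)"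
    by (intro nn_integral_cong) (simp add: nn_integral_multc nn_integral_lborel_translate)
  also have "\<dots> = (\<integral>\<^sup>+y. \<rho> y \<partial>lborel) * ?b" by (simp add: nn_integral_cmult)
  finally show ?thesis
    using emeasure_ball_bounds[OF r, where 'a = 'a] by (simp add: ennreal_mult_divide_eq)
qed

text \<open>Jensen's inequality: \<open>Young_epowr\<close> is integrated over the ball with
  \<open>a\<close> the average, and the finite term with the factor p - 1 is cancelled.\<close>

lemma ball_average_powr_le:
  assumes [measurable]: "\<rho> \<in> borel_measurable (borel :: 'a::euclidean_space measure)" and r: "r > 0" and p: "p > 1"
  shows "ennreal (enn2real (ball_average r \<rho> y) powr p) \<le> ball_average r (\<lambda>x. \<rho> x epowr p) y"
proof (cases "ball_average r \<rho> y")
  \<comment> \<open>Here \<open>enn2real\<close> returns 0 and the left side vanishes. By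
    \<open>ball_average_le\<close>, metrics of finite energy do not reach this case.\<close>
  case top
  then show ?thesis using p by simp
next
  case (real a)
  let ?b = "emeasure lborel (ball (0::'a) r)"
  have "ennreal (p * a powr (p - 1)) * (ennreal a * ?b) = (\<integral>\<^sup>+z. ennreal (p * a powr (p - 1)) * \<rho> (y + z) * indicator (ball 0 r) z \<partial>lborel)"
    using ball_average_mult[OF r, of \<rho> y] unfolding real by (simp add: nn_integral_cmult mult.assoc)
  also have "\<dots> \<le> (\<integral>\<^sup>+z. \<rho> (y + z) epowr p * indicator (ball 0 r) z + ennreal ((p - 1) * a powr p) * indicator (ball 0 r) z \<partial>lborel)"
    using Young_epowr[OF p real(1)] by (intro nn_integral_mono) (auto simp: indicator_def)
  also have "\<dots> = (\<integral>\<^sup>+z\<in>ball 0 r. \<rho> (y + z) epowr p \<partial>lborel) + ennreal ((p - 1) * a powr p) * ?b"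
    by (simp add: nn_integral_add nn_integral_cmult)
  also have "ennreal (p * a powr (p - 1)) * (ennreal a * ?b) = ennreal (a powr p) * ?b + ennreal ((p - 1) * a powr p) * ?b"
  proof -
    have "p * a powr (p - 1) * a = a powr p + (p - 1) * a powr p"
    proof (cases "a = 0")
      case False
      then have "a powr (p - 1) * a = a powr p" using real powr_add[of a "p - 1" 1] by simp
      then show ?thesis by (simp add: algebra_simps)
    qed (use p in simp)
    then have "ennreal (p * a powr (p - 1)) * ennreal a = ennreal (a powr p) + ennreal ((p - 1) * a powr p)"
      using p real by (simp add: ennreal_mult'[symmetric] ennreal_plus[symmetric] del: ennreal_plus)
    then show ?thesis by (metis mult.assoc distrib_right)
  qed
  finally have "ennreal (a powr p) * ?b \<le> (\<integral>\<^sup>+z\<in>ball 0 r. \<rho> (y + z) epowr p \<partial>lborel)"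
    using emeasure_ball_bounds[OF r, where 'a = 'a] by (simp add: ennreal_add_left_cancel_le add.commute ennreal_mult_eq_top_iff)
  then have "ennreal (a powr p) * ?b / ?b \<le> ball_average r (\<lambda>x. \<rho> x epowr p) y"
    unfolding ball_average_def by (rule divide_right_mono_ennreal)
  then show ?thesis
    using emeasure_ball_bounds[OF r, where 'a = 'a] real by (simp add: ennreal_mult_divide_eq)
qed

text \<open>A metric of finite energy may be infinite at points, but by x \<le> 1 + x powr p its
  averages of a fixed radius are bounded uniformly in y.\<close>

lemma ball_average_le:
  assumes [measurable]: "\<rho> \<in> borel_measurable (borel :: 'a::euclidean_space measure)" and r: "r > 0" and p: "p > 1"
  shows "ball_average r \<rho> y \<le> 1 + (\<integral>\<^sup>+x. \<rho> x epowr p \<partial>lborel) / emeasure lborel (ball (0::'a) r)"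
proof -
  let ?b = "emeasure lborel (ball (0::'a) r)"
  have "(\<integral>\<^sup>+z\<in>ball 0 r. \<rho> (y + z) \<partial>lborel) \<le> (\<integral>\<^sup>+z. indicator (ball 0 r) z + \<rho> (y + z) epowr p \<partial>lborel)"
    using le_one_plus_epowr[OF p] by (intro nn_integral_mono) (auto simp: indicator_def)
  also have "\<dots> = ?b + (\<integral>\<^sup>+x. \<rho> x epowr p \<partial>lborel)"
    using nn_integral_lborel_translate[of "\<lambda>x. \<rho> x epowr p" y] by (simp add: nn_integral_add add.commute[of y])
  finally have "ball_average r \<rho> y \<le> (?b + (\<integral>\<^sup>+x. \<rho> x epowr p \<partial>lborel)) / ?b"
    unfolding ball_average_def by (rule divide_right_mono_ennreal)
  also have "\<dots> = 1 + (\<integral>\<^sup>+x. \<rho> x epowr p \<partial>lborel) / ?b"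
    using emeasure_ball_bounds[OF r, where 'a = 'a] using ennreal_mult_divide_eq[of ?b 1] by (simp add: add_divide_distrib_ennreal)
  finally show ?thesis .
qed

text \<open>The ball about y lies in the larger ball about x. The factor is the ratio of their
  volumes and tends to one as R \<rightarrow> 0.\<close>

lemma ball_average_near:
  assumes [measurable]: "\<rho> \<in> borel_measurable (borel :: 'a::euclidean_space measure)"
    and r: "r > 0" "R > 0" and xy: "dist x y < R"
  shows "ball_average r \<rho> y \<le> ennreal (((r + R) / r) ^ DIM('a)) * ball_average (r + R) \<rho> x"
proof -
  let ?b = "\<lambda>r. emeasure lborel (ball (0::'a) r)"
  have shift: "(\<integral>\<^sup>+z\<in>ball 0 r. \<rho> (y + z) \<partial>lborel) = (\<integral>\<^sup>+z\<in>ball y r. \<rho> z \<partial>lborel)" for y r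
  proof -
    have "(\<integral>\<^sup>+z\<in>ball y r. \<rho> z \<partial>lborel) = (\<integral>\<^sup>+z. \<rho> (z + y) * indicator (ball y r) (z + y) \<partial>lborel)"
      by (rule nn_integral_lborel_translate[symmetric]) measurable
    also have "\<dots> = (\<integral>\<^sup>+z\<in>ball 0 r. \<rho> (y + z) \<partial>lborel)"
      by (intro nn_integral_cong) (auto simp: indicator_def dist_norm add.commute norm_minus_commute)
    finally show ?thesis ..
  qed
  have "ball y r \<subseteq> ball x (r + R)"
  proof
    fix z assume "z \<in> ball y r"
    then show "z \<in> ball x (r + R)" using xy dist_triangle[of x z y] by simp
  qed
  then have "(\<integral>\<^sup>+z\<in>ball 0 r. \<rho> (y + z) \<partial>lborel) \<le> (\<integral>\<^sup>+z\<in>ball 0 (r + R). \<rho> (x + z) \<partial>lborel)"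
    unfolding shift by (intro nn_integral_mono) (auto simp: indicator_def)
  then have "ball_average r \<rho> y \<le> ball_average (r + R) \<rho> x * ?b (r + R) / ?b r"
    unfolding ball_average_mult[OF add_pos_pos[OF r]] unfolding ball_average_def[of r]
    by (rule divide_right_mono_ennreal)
  also have "\<dots> = ball_average (r + R) \<rho> x * (?b (r + R) / ?b r)" by (simp add: ennreal_times_divide)
  also have "?b (r + R) / ?b r = ennreal (((r + R) / r) ^ DIM('a))"
    using r unit_ball_vol_pos[of "real DIM('a)"]
    by (simp add: emeasure_ball divide_ennreal power_divide less_imp_neq[symmetric])
  finally show ?thesis by (simp add: mult.commute)
qed

text \<open>By Fubini, the length of \<beta> in the averaged metric is the mean of the
  \<rho>-lengths of its translates by z, each of which is at least one.\<close>

lemma ball_average_arclength: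
  assumes [measurable]: "\<rho> \<in> borel_measurable (borel :: 'a::euclidean_space measure)"
    and r: "r > 0" and \<beta>: "arclength_curve \<beta> L"
    and ge: "\<And>z. z \<in> ball 0 r \<Longrightarrow> 1 \<le> (\<integral>\<^sup>+t\<in>{0..L}. \<rho> (\<beta> t + z) \<partial>lborel)"
  shows "1 \<le> (\<integral>\<^sup>+t\<in>{0..L}. ball_average r \<rho> (\<beta> t) \<partial>lborel)"
proof -
  let ?b = "emeasure lborel (ball (0::'a) r)"
  have [measurable]: "\<beta> \<in> borel_measurable borel" by (rule arclength_curve_measurable[OF \<beta>])
  have "?b = (\<integral>\<^sup>+z. indicator (ball (0::'a) r) z \<partial>lborel)" by simp
  also have "\<dots> \<le> (\<integral>\<^sup>+z. \<integral>\<^sup>+t. \<rho> (\<beta> t + z) * indicator {0..L} t * indicator (ball 0 r) z \<partial>lborel \<partial>lborel)"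
    using ge by (intro nn_integral_mono) (auto simp: indicator_def)
  also have "\<dots> = (\<integral>\<^sup>+t. \<integral>\<^sup>+z. \<rho> (\<beta> t + z) * indicator {0..L} t * indicator (ball 0 r) z \<partial>lborel \<partial>lborel)"
    by (rule lborel_pair.Fubini') measurable
  also have "\<dots> = (\<integral>\<^sup>+t. ball_average r \<rho> (\<beta> t) * indicator {0..L} t * ?b \<partial>lborel)"
  proof (rule nn_integral_cong)
    fix t
    have "(\<integral>\<^sup>+z. \<rho> (\<beta> t + z) * indicator {0..L} t * indicator (ball 0 r) z \<partial>lborel)
       = (\<integral>\<^sup>+z. \<rho> (\<beta> t + z) * indicator (ball 0 r) z \<partial>lborel) * indicator {0..L} t"
      by (subst nn_integral_multc[symmetric]) (auto simp: ac_simps)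
    then show "(\<integral>\<^sup>+z. \<rho> (\<beta> t + z) * indicator {0..L} t * indicator (ball 0 r) z \<partial>lborel)
       = ball_average r \<rho> (\<beta> t) * indicator {0..L} t * ?b"
      unfolding ball_average_mult[OF r, symmetric] by (simp add: ac_simps)
  qed
  also have "\<dots> = (\<integral>\<^sup>+t\<in>{0..L}. ball_average r \<rho> (\<beta> t) \<partial>lborel) * ?b"
    by (rule nn_integral_multc) measurable
  finally have "?b * 1 \<le> ?b * (\<integral>\<^sup>+t\<in>{0..L}. ball_average r \<rho> (\<beta> t) \<partial>lborel)" by (simp add: mult.commute)
  then show ?thesis
    using emeasure_ball_bounds[OF r, where 'a = 'a] by (subst (asm) ennreal_mult_le_mult_iff) auto
qed

section \<open>Distance from a set in a conformal metric\<close>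

definition path_potential :: "('a::euclidean_space \<Rightarrow> ennreal) \<Rightarrow> 'a set \<Rightarrow> 'a \<Rightarrow> ennreal" where
  "path_potential A C y = (INF (\<beta>, L) \<in> {(\<beta>, L). arclength_curve \<beta> L \<and> \<beta> 0 \<in> C \<and> \<beta> L = y}.
     \<integral>\<^sup>+t\<in>{0..L}. A (\<beta> t) \<partial>lborel)"

lemma path_potential_zero: "y \<in> C \<Longrightarrow> path_potential A C y = 0"
proof -
  assume y: "y \<in> C"
  have "(\<integral>\<^sup>+t\<in>{0..0::real}. A y \<partial>lborel) = 0" by (simp add: nn_integral_cmult)
  then have "path_potential A C y \<le> 0"
    unfolding path_potential_def
    using y arclength_curve_const[of y] by (intro INF_lower2[of "(\<lambda>_. y, 0)"]) auto
  then show ?thesis by simp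
qed

text \<open>A path ending at y is continued by the straight segment to x. All points of the segment
  are within \<open>dist x y\<close> of x, where A is at most s.\<close>

lemma path_potential_step:
  fixes x y :: "'a::euclidean_space"
  assumes [measurable]: "A \<in> borel_measurable borel"
    and A: "\<And>z. dist x z \<le> dist x y \<Longrightarrow> A z \<le> ennreal s" and s: "s \<ge> 0"
  shows "path_potential A C x \<le> path_potential A C y + ennreal (s * dist x y)"
proof (cases "x = y")
  case False
  define l where "l = dist x y"
  define e where "e = (x - y) /\<^sub>R l"
  have l: "l > 0" using False by (simp add: l_def)
  have e: "norm e = 1" "l *\<^sub>R e = x - y" using l by (simp_all add: e_def l_def dist_norm)
  have "path_potential A C x \<le> (\<integral>\<^sup>+t\<in>{0..L}. A (\<beta> t) \<partial>lborel) + ennreal (s * l)"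
    if \<beta>: "arclength_curve \<beta> L" "\<beta> 0 \<in> C" "\<beta> L = y" for \<beta> L
  proof -
    let ?\<gamma> = "\<lambda>t. \<beta> (min t L) + max 0 (t - L) *\<^sub>R e"
    have L: "L \<ge> 0" using \<beta> by (simp add: arclength_curve_def)
    have \<gamma>: "arclength_curve ?\<gamma> (L + l)" using \<beta>(1) l e by (intro arclength_curve_extend) auto
    have [measurable]: "\<beta> \<in> borel_measurable borel" by (rule arclength_curve_measurable[OF \<beta>(1)])
    have "?\<gamma> (L + l) = x" "?\<gamma> 0 \<in> C" using \<beta> l L e by auto
    then have "path_potential A C x \<le> (\<integral>\<^sup>+t\<in>{0..L + l}. A (?\<gamma> t) \<partial>lborel)"
      unfolding path_potential_def using \<gamma> by (intro INF_lower2[of "(?\<gamma>, L + l)"]) auto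
    also have "\<dots> \<le> (\<integral>\<^sup>+t. A (\<beta> t) * indicator {0..L} t + ennreal s * indicator {L..L + l} t \<partial>lborel)"
    proof (rule nn_integral_mono)
      fix t
      have "A (?\<gamma> t) \<le> ennreal s" if "L \<le> t" "t \<le> L + l"
      proof (rule A)
        have "x = y + l *\<^sub>R e" using e by simp
        then have "x - ?\<gamma> t = (l - (t - L)) *\<^sub>R e" using that \<beta>(3) by (simp add: algebra_simps)
        then have "dist x (?\<gamma> t) = \<bar>l - (t - L)\<bar>" using e by (simp add: dist_norm)
        then show "dist x (?\<gamma> t) \<le> dist x y" using that by (simp add: l_def)
      qed
      then show "A (?\<gamma> t) * indicator {0..L + l} t \<le> A (\<beta> t) * indicator {0..L} t + ennreal s * indicator {L..L + l} t"
        by (auto simp: indicator_def add_increasing2)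
    qed
    also have "\<dots> = (\<integral>\<^sup>+t\<in>{0..L}. A (\<beta> t) \<partial>lborel) + ennreal (s * l)"
      using l s by (simp add: nn_integral_add nn_integral_cmult ennreal_mult')
    finally show ?thesis .
  qed
  then have "path_potential A C x - ennreal (s * l) \<le> path_potential A C y"
    unfolding path_potential_def[of A C y]
    by (intro INF_greatest) (auto simp: ennreal_minus_le_iff add.commute)
  then show ?thesis unfolding l_def by (simp add: ennreal_minus_le_iff add.commute)
qed simp


text \<open>Averages over balls of radius \<open>\<epsilon>\<close> are again admissible, because translating a path by less than
  \<open>\<epsilon>\<close> keeps its length at least one. On \<open>ball x R\<close> they are bounded by a multiple of the average
  over \<open>ball x (\<epsilon> + R)\<close>, which therefore bounds the difference quotients of the potential.\<close>

lemma energy_of_averaged_metric: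
  fixes C :: "'a::euclidean_space set"
  assumes \<rho> [measurable]: "\<rho> \<in> borel_measurable borel" and p: "p > 1" and \<epsilon>: "\<epsilon> > 0" and R: "R > 0"
    and fin: "(\<integral>\<^sup>+x. \<rho> x epowr p \<partial>lborel) < top"
    and paths: "\<And>\<beta> L z. \<lbrakk>arclength_curve \<beta> L; \<beta> 0 \<in> C; norm (\<beta> L) \<ge> 1; norm z < \<epsilon>\<rbrakk> \<Longrightarrow>
      1 \<le> (\<integral>\<^sup>+t\<in>{0..L}. \<rho> (\<beta> t + z) \<partial>lborel)"
    and C: "C \<in> sets borel"
    and V: "V > 0" "ennreal V < emeasure lborel C" and k: "k > 0"
    and K: "(\<integral>\<^sup>+W\<in>{V..<unit_ball_vol DIM('a)}. ennreal ((W / unit_ball_vol DIM('a)) powr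
        (- (p / (p - 1) * (real DIM('a) - 1) / real DIM('a)))) \<partial>lborel) \<le> ennreal (unit_ball_vol DIM('a) * k)"
  shows "ennreal (real DIM('a) * unit_ball_vol DIM('a) * (real DIM('a) / k) powr (p - 1))
    \<le> ennreal ((((\<epsilon> + R) / \<epsilon>) ^ DIM('a)) powr p) * (\<integral>\<^sup>+x. \<rho> x epowr p \<partial>lborel)"
proof -
  define A where "A = ball_average \<epsilon> \<rho>"
  define u where "u = path_potential A C"
  \<comment> \<open>Subtraction in \<open>ennreal\<close> truncates, so w is the maximum of 0 and 1
    - u, and is 0 where u is infinite.\<close>
  define w where "w x = enn2real (1 - u x)" for x
  define c where "c = ((\<epsilon> + R) / \<epsilon>) ^ DIM('a)"
  define \<sigma> where "\<sigma> x = c * enn2real (ball_average (\<epsilon> + R) \<rho> x)" for x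
  have c: "c > 0" using \<epsilon> R by (simp add: c_def)
  have \<epsilon>R: "\<epsilon> + R > 0" using \<epsilon> R by simp
  have [measurable]: "A \<in> borel_measurable borel" by (simp add: A_def)
  \<comment> \<open>A uniform bound for the averages makes \<sigma> bounded and thereby w
    continuous.\<close>
  define M where "M = 1 + (\<integral>\<^sup>+x. \<rho> x epowr p \<partial>lborel) / emeasure lborel (ball (0::'a) (\<epsilon> + R))"
  have M: "M < top"
    using fin emeasure_ball_bounds[OF \<epsilon>R, where 'a = 'a]
    unfolding M_def less_top[symmetric] by (simp add: ennreal_divide_eq_top_iff)
  have av_le: "ball_average (\<epsilon> + R) \<rho> x \<le> M" for x
    unfolding M_def by (rule ball_average_le[OF \<rho> \<epsilon>R p])
  have \<sigma>_eq: "ennreal (\<sigma> x) = ennreal c * ball_average (\<epsilon> + R) \<rho> x" for x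
    using le_less_trans[OF av_le M, of x] c by (simp add: \<sigma>_def ennreal_mult'')
  have \<sigma>_nonneg: "\<sigma> x \<ge> 0" for x using c by (simp add: \<sigma>_def)
  have \<sigma>_le: "\<sigma> x \<le> c * enn2real M" for x
    unfolding \<sigma>_def using c av_le M by (intro mult_left_mono enn2real_mono) auto
  have u_step: "u x \<le> u y + ennreal (\<sigma> x * dist x y)" if "dist x y < R" for x y
    unfolding u_def
  proof (rule path_potential_step)
    fix z assume "dist x z \<le> dist x y"
    then show "A z \<le> ennreal (\<sigma> x)"
      using ball_average_near[OF \<rho> \<epsilon> R, of x z] that by (simp add: A_def \<sigma>_eq c_def)
  qed (simp_all add: \<sigma>_nonneg)
  have w_step: "w y - w x \<le> \<sigma> x * dist x y" if "dist x y < R" for x y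
  proof -
    have "1 - u y \<le> (1 - u x) + ennreal (\<sigma> x * dist x y)"
    proof (cases "u x")
      case (real a)
      have "1 - u y \<le> ennreal (1 - a) + ennreal (\<sigma> x * dist x y)"
      proof (cases "u y")
        case (real b)
        then have "a \<le> b + \<sigma> x * dist x y"
          using u_step[OF that] \<open>u x = ennreal a\<close> \<open>0 \<le> a\<close> \<sigma>_nonneg[of x]
          by (simp add: ennreal_plus[symmetric] del: ennreal_plus)
        then have "ennreal (1 - b) \<le> ennreal (max 0 (1 - a) + \<sigma> x * dist x y)"
          using \<sigma>_nonneg[of x] by (intro ennreal_leI) auto
        then show ?thesis using real \<sigma>_nonneg[of x]
          by (simp add: ennreal_minus ennreal_1[symmetric] ennreal_max_0 del: ennreal_1)
      next
        case top
        then have "1 - u y = 0" by (simp add: diff_eq_0_ennreal)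
        then show ?thesis by simp
      qed
      then show ?thesis using real by (simp add: ennreal_minus ennreal_1[symmetric] del: ennreal_1)
    next
      case top
      then have "u y = top" using u_step[OF that] by (simp add: top_unique)
      then show ?thesis using top by simp
    qed
    moreover have "1 - u x < top" "1 - u y < top" by (metis diff_le_self_ennreal ennreal_one_less_top order_le_less_trans)+
    ultimately have "enn2real (1 - u y) \<le> enn2real ((1 - u x) + ennreal (\<sigma> x * dist x y))"
      by (intro enn2real_mono) auto
    also have "\<dots> = w x + \<sigma> x * dist x y"
      using \<open>1 - u x < top\<close> \<sigma>_nonneg[of x] by (simp add: enn2real_plus w_def)
    finally show ?thesis by (simp add: w_def)
  qed
  have w_cont: "continuous_on UNIV w"
    unfolding continuous_on_iff
  proof (intro ballI allI impI)
    fix x and e :: real assume e: "e > 0"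
    let ?B = "c * enn2real M"
    have B: "?B \<ge> 0" using c by simp
    show "\<exists>d>0. \<forall>x'\<in>UNIV. dist x' x < d \<longrightarrow> dist (w x') (w x) < e"
    proof (intro exI[of _ "min R (e / (?B + 1))"] conjI ballI impI)
      show "0 < min R (e / (?B + 1))" using R e B by simp
      fix x' assume d: "dist x' x < min R (e / (?B + 1))"
      have "w x' - w x \<le> ?B * dist x' x" "w x - w x' \<le> ?B * dist x' x"
        using w_step[of x x'] w_step[of x' x] d mult_right_mono[OF \<sigma>_le, of "dist x' x"]
        by (force simp: dist_commute intro: order_trans)+
      then have "dist (w x') (w x) \<le> ?B * dist x' x" by (simp add: dist_real_def abs_le_iff)
      also have "\<dots> \<le> (?B + 1) * dist x' x" by (simp add: distrib_right)
      also have "\<dots> < e" using d B by (simp add: pos_less_divide_eq mult.commute)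
      finally show "dist (w x') (w x) < e" .
    qed
  qed
  have w_le: "w x \<le> 1" for x
    unfolding w_def using enn2real_mono[of "1 - u x" 1] by simp
  \<comment> \<open>Every competitor for \<open>u x\<close> ends outside the open unit ball, so its
    translates by less than \<epsilon> have \<rho>-length at least one, and hence its length in the
    averaged metric is at least one.\<close>
  have w_supp: "w x = 0" if "norm x \<ge> 1" for x
  proof -
    have "1 \<le> u x"
      unfolding u_def path_potential_def A_def
      using that by (auto intro!: INF_greatest ball_average_arclength[OF \<rho> \<epsilon>] paths)
    then show ?thesis by (simp add: w_def diff_eq_0_ennreal)
  qed
  have "C \<subseteq> {x. w x = 1}" by (auto simp: w_def u_def path_potential_zero)
  moreover have "closed {x. w x = 1}" using w_cont by (intro closed_Collect_eq continuous_intros)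
  ultimately have "emeasure lborel C \<le> emeasure lborel {x. w x = 1}"
    by (intro emeasure_mono) auto
  then have VC: "ennreal V < emeasure lborel {x. w x = 1}" using V by order
  interpret condenser_potential w \<sigma> p "p / (p - 1)" R V
    by unfold_locales (use p w_cont w_le w_supp R w_step V VC \<sigma>_nonneg in \<open>auto simp: w_def \<sigma>_def[abs_def]\<close>)
  have "ennreal (real DIM('a) * unit_ball_vol DIM('a) * (real DIM('a) / k) powr (p - 1)) \<le> (\<integral>\<^sup>+x. ennreal (\<sigma> x powr p) \<partial>lborel)"
    using capacity_lower_bound[OF k] K unfolding \<Omega>_def .
  also have "\<dots> \<le> (\<integral>\<^sup>+x. ennreal (c powr p) * ball_average (\<epsilon> + R) (\<lambda>x. \<rho> x epowr p) x \<partial>lborel)"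
  proof (rule nn_integral_mono)
    fix x
    have "ennreal (\<sigma> x powr p) = ennreal (c powr p) * ennreal (enn2real (ball_average (\<epsilon> + R) \<rho> x) powr p)"
      using c by (simp add: \<sigma>_def powr_mult ennreal_mult'')
    also have "\<dots> \<le> ennreal (c powr p) * ball_average (\<epsilon> + R) (\<lambda>x. \<rho> x epowr p) x"
      by (intro mult_left_mono ball_average_powr_le[OF \<rho> \<epsilon>R p]) auto
    finally show "ennreal (\<sigma> x powr p) \<le> ennreal (c powr p) * ball_average (\<epsilon> + R) (\<lambda>x. \<rho> x epowr p) x" .
  qed
  also have "\<dots> = ennreal (c powr p) * (\<integral>\<^sup>+x. \<rho> x epowr p \<partial>lborel)"
    by (simp add: nn_integral_cmult nn_integral_ball_average \<epsilon>R)
  finally show ?thesis unfolding c_def .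
qed

lemma modulus_image_ring_ge:
  fixes f :: "'a::euclidean_space \<Rightarrow> 'a"
  assumes f: "open_discrete_map f (ball 0 1)" and into: "f ` ball 0 1 \<subseteq> ball 0 1"
    and r: "0 < r\<^sub>0" "r\<^sub>0 < r\<^sub>1" "r\<^sub>1 < r\<^sub>2" "r\<^sub>2 < 1" and p: "p > 1"
    and V: "V > 0" "ennreal V < emeasure lborel (f ` cball 0 r\<^sub>0)" and k: "k > 0"
    and K: "(\<integral>\<^sup>+W\<in>{V..<unit_ball_vol DIM('a)}. ennreal ((W / unit_ball_vol DIM('a)) powr
        (- (p / (p - 1) * (real DIM('a) - 1) / real DIM('a)))) \<partial>lborel) \<le> ennreal (unit_ball_vol DIM('a) * k)"
  shows "ennreal (real DIM('a) * unit_ball_vol DIM('a) * (real DIM('a) / k) powr (p - 1))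
    \<le> modulus p (image_curves f (joining_curves (sphere 0 r\<^sub>1) (sphere 0 r\<^sub>2) (annulus r\<^sub>1 r\<^sub>2 0)))"
    (is "?X \<le> modulus p ?\<Gamma>")
  unfolding modulus_def
proof (rule INF_greatest)
  fix \<rho> assume \<rho>: "\<rho> \<in> admissible ?\<Gamma>"
  interpret open_discrete_map f "ball 0 1" by (rule f)
  have [measurable]: "\<rho> \<in> borel_measurable borel" using \<rho> by (simp add: admissible_def)
  have leb: "(\<integral>\<^sup>+x. \<rho> x epowr p \<partial>lebesgue) = (\<integral>\<^sup>+x. \<rho> x epowr p \<partial>lborel)"
    by (rule nn_integral_completion) measurable
  show "?X \<le> (\<integral>\<^sup>+x. \<rho> x epowr p \<partial>lebesgue)"
  proof (cases "(\<integral>\<^sup>+x. \<rho> x epowr p \<partial>lborel)")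
    case (real I)
    have comp: "compact (f ` cball 0 s)" if "s < 1" for s
      using that by (intro compact_continuous_image continuous_on_subset[OF cont]) auto
    have "f ` cball 0 r\<^sub>0 \<subseteq> f ` ball 0 r\<^sub>1" using r by (intro image_mono) auto
    moreover have "open (f ` ball 0 r\<^sub>1)" using r by (intro op) auto
    ultimately obtain \<epsilon>\<^sub>1 where \<epsilon>\<^sub>1: "\<epsilon>\<^sub>1 > 0" "(\<Union>x\<in>f ` cball 0 r\<^sub>0. ball x \<epsilon>\<^sub>1) \<subseteq> f ` ball 0 r\<^sub>1"
      using compact_subset_open_imp_ball_epsilon_subset[OF comp, of r\<^sub>0] r by (metis less_trans)
    have "f ` cball 0 r\<^sub>2 \<subseteq> f ` ball 0 1" using r by (intro image_mono) auto
    then have "f ` cball 0 r\<^sub>2 \<subseteq> ball 0 1" using into by blast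
    then obtain \<epsilon>\<^sub>2 where \<epsilon>\<^sub>2: "\<epsilon>\<^sub>2 > 0" "(\<Union>x\<in>f ` cball 0 r\<^sub>2. ball x \<epsilon>\<^sub>2) \<subseteq> ball 0 1"
      using compact_subset_open_imp_ball_epsilon_subset[OF comp[OF r(4)] open_ball] by metis
    define \<epsilon> where "\<epsilon> = min \<epsilon>\<^sub>1 \<epsilon>\<^sub>2"
    have \<epsilon>: "\<epsilon> > 0" using \<epsilon>\<^sub>1 \<epsilon>\<^sub>2 by (simp add: \<epsilon>_def)
    have paths: "1 \<le> (\<integral>\<^sup>+t\<in>{0..L}. \<rho> (\<beta> t + z) \<partial>lborel)"
      if \<beta>: "arclength_curve \<beta> L" "\<beta> 0 \<in> f ` cball 0 r\<^sub>0" "norm (\<beta> L) \<ge> 1" "norm z < \<epsilon>" for \<beta> L z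
    proof (rule admissible_arclength[OF _ r(3) _ _ \<rho> arclength_curve_translate[OF \<beta>(1)]])
      have "\<beta> 0 + z \<in> ball (\<beta> 0) \<epsilon>\<^sub>1" using \<beta>(4) by (simp add: dist_norm \<epsilon>_def)
      then show "\<beta> 0 + z \<in> f ` ball 0 r\<^sub>1" using \<epsilon>\<^sub>1(2) \<beta>(2) by blast
      show "\<beta> L + z \<notin> f ` ball 0 r\<^sub>2"
      proof
        assume "\<beta> L + z \<in> f ` ball 0 r\<^sub>2"
        then have "\<beta> L + z \<in> f ` cball 0 r\<^sub>2" by auto
        moreover have "\<beta> L \<in> ball (\<beta> L + z) \<epsilon>\<^sub>2" using \<beta>(4) by (simp add: dist_norm \<epsilon>_def)
        ultimately have "\<beta> L \<in> ball 0 1" using \<epsilon>\<^sub>2(2) by blast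
        then show False using \<beta>(3) by simp
      qed
      show "r\<^sub>2 < (r\<^sub>2 + 1) / 2" "cball 0 ((r\<^sub>2 + 1) / 2) \<subseteq> ball (0::'a) 1" using r by auto
    qed (use r in auto)
    let ?x = "real DIM('a) * unit_ball_vol DIM('a) * (real DIM('a) / k) powr (p - 1)"
    have le: "?x \<le> (((\<epsilon> + R) / \<epsilon>) ^ DIM('a)) powr p * I" if R: "R > 0" for R
    proof -
      have "ennreal ?x \<le> ennreal ((((\<epsilon> + R) / \<epsilon>) ^ DIM('a)) powr p) * (\<integral>\<^sup>+x. \<rho> x epowr p \<partial>lborel)"
      proof (rule energy_of_averaged_metric[where C = "f ` cball 0 r\<^sub>0" and V = V and k = k])
        show "f ` cball 0 r\<^sub>0 \<in> sets borel" using comp[of r\<^sub>0] r by (intro borel_compact) auto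
        show "(\<integral>\<^sup>+x. \<rho> x epowr p \<partial>lborel) < top" using real by simp
      qed (use p \<epsilon> R paths V k K in auto)
      also have "\<dots> = ennreal ((((\<epsilon> + R) / \<epsilon>) ^ DIM('a)) powr p * I)"
        using real by (simp add: ennreal_mult'[symmetric])
      finally show ?thesis using real by (subst (asm) ennreal_le_iff) auto
    qed
    \<comment> \<open>As \<epsilon> does not depend on R, the volume ratio disappears in the limit R
      \<rightarrow> 0.\<close>
    have "((\<lambda>R. (((\<epsilon> + R) / \<epsilon>) ^ DIM('a)) powr p * I) \<longlongrightarrow> (((\<epsilon> + 0) / \<epsilon>) ^ DIM('a)) powr p * I) (at_right 0)"
      using \<epsilon> by (intro tendsto_intros) auto
    then have lim: "((\<lambda>R. (((\<epsilon> + R) / \<epsilon>) ^ DIM('a)) powr p * I) \<longlongrightarrow> I) (at_right 0)"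
      using \<epsilon> by simp
    have "?x \<le> I"
    proof (rule tendsto_lowerbound[OF lim])
      show "\<forall>\<^sub>F R in at_right 0. ?x \<le> (((\<epsilon> + R) / \<epsilon>) ^ DIM('a)) powr p * I"
        using le by (intro eventually_at_rightI[of 0 1]) auto
    qed simp
    then show ?thesis unfolding leb real by (rule ennreal_leI)
  qed (simp add: leb)
qed


section \<open>The area of the unit sphere\<close>

text \<open>The solid cone over a spherical cap, without the apex, where the direction is undefined.
  Cones over disjoint caps are disjoint parts of the unit ball, and the volume of each is about 1 /
  n times the area of its cap; this is how the volume of the ball controls the area of the
  sphere.\<close>

definition cap_cone :: "'a::euclidean_space \<Rightarrow> real \<Rightarrow> 'a set" where
  "cap_cone x r = {y. 0 < norm y \<and> norm y < 1 \<and> dist (y /\<^sub>R norm y) x \<le> r}"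

lemma cap_cone_borel [measurable]: "cap_cone x r \<in> sets borel"
proof -
  have "cap_cone x r = {y. y \<noteq> 0 \<and> norm y < 1 \<and> dist (y /\<^sub>R norm y) x \<le> r}"
    by (auto simp: cap_cone_def)
  also have "\<dots> \<in> sets borel" by measurable
  finally show ?thesis .
qed

text \<open>A chord is shorter than the tangent of the angle it subtends.\<close>

lemma round_cone_subset_cap_cone:
  fixes e :: "'a::euclidean_space"
  assumes e: "e \<in> Basis" and r: "r > 0"
  shows "{y. 0 < y \<bullet> e \<and> y \<bullet> e < 1 / sqrt (1 + r\<^sup>2) \<and> (\<Sum>i\<in>Basis - {e}. (y \<bullet> i)\<^sup>2) \<le> (r * (y \<bullet> e))\<^sup>2} \<subseteq> cap_cone e r"
proof
  fix y assume "y \<in> {y. 0 < y \<bullet> e \<and> y \<bullet> e < 1 / sqrt (1 + r\<^sup>2) \<and> (\<Sum>i\<in>Basis - {e}. (y \<bullet> i)\<^sup>2) \<le> (r * (y \<bullet> e))\<^sup>2}"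
  then have h: "0 < y \<bullet> e" "y \<bullet> e < 1 / sqrt (1 + r\<^sup>2)" and z: "(\<Sum>i\<in>Basis - {e}. (y \<bullet> i)\<^sup>2) \<le> (r * (y \<bullet> e))\<^sup>2"
    by auto
  let ?h = "y \<bullet> e" and ?n = "norm y"
  have "?n\<^sup>2 = ?h\<^sup>2 + (\<Sum>i\<in>Basis - {e}. (y \<bullet> i)\<^sup>2)"
    unfolding power2_norm_eq_inner euclidean_inner[of y y] using e
    by (subst sum.remove[of _ e]) (auto simp: power2_eq_square)
  then have n2: "?n\<^sup>2 \<le> (1 + r\<^sup>2) * ?h\<^sup>2" using z by (simp add: power_mult_distrib algebra_simps)
  have hn: "?h \<le> ?n" using Basis_le_norm[OF e, of y] by simp
  then have n0: "?n > 0" using h by linarith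
  have s: "sqrt (1 + r\<^sup>2) > 0" by (simp add: add_pos_nonneg)
  \<comment> \<open>The height of the round cone is the reciprocal of this factor, which keeps its
    slanted side inside the unit ball.\<close>
  have n_le: "?n \<le> sqrt (1 + r\<^sup>2) * ?h"
  proof (rule power2_le_imp_le)
    have "(sqrt (1 + r\<^sup>2))\<^sup>2 = 1 + r\<^sup>2" by (rule real_sqrt_pow2) simp
    then show "?n\<^sup>2 \<le> (sqrt (1 + r\<^sup>2) * ?h)\<^sup>2" unfolding power_mult_distrib using n2 by simp
    show "0 \<le> sqrt (1 + r\<^sup>2) * ?h" using s h by simp
  qed
  also have "\<dots> < 1" using h s by (simp add: field_simps)
  finally have n1: "?n < 1" .
  have "(dist (y /\<^sub>R ?n) e)\<^sup>2 = 2 - 2 * (?h / ?n)"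
  proof -
    have "(dist (y /\<^sub>R ?n) e)\<^sup>2 = (y /\<^sub>R ?n) \<bullet> (y /\<^sub>R ?n) - 2 * ((y /\<^sub>R ?n) \<bullet> e) + e \<bullet> e"
      by (simp add: dist_norm power2_norm_eq_inner inner_diff_left inner_diff_right inner_commute)
    moreover have "(y /\<^sub>R ?n) \<bullet> (y /\<^sub>R ?n) = 1"
      using n0 by (simp add: dot_square_norm power2_eq_square)
    ultimately show ?thesis using e by (simp add: inner_Basis divide_inverse mult.commute)
  qed
  \<comment> \<open>The cosine of the angle between y and e is at least
    \<open>1 / sqrt (1 + r\<^sup>2)\<close>. It remains to see that this is at least
    \<open>1 - r\<^sup>2 / 2\<close>, by bounding the square root by
    \<open>1 + r\<^sup>2 / 2\<close>.\<close>
  also have "\<dots> \<le> r\<^sup>2"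
  proof -
    have "1 - r\<^sup>2 / 2 \<le> 1 / sqrt (1 + r\<^sup>2)"
    proof -
      have "sqrt (1 + r\<^sup>2) \<le> 1 + r\<^sup>2 / 2"
      proof (rule real_le_lsqrt)
        have "(1 + r\<^sup>2 / 2)\<^sup>2 = 1 + r\<^sup>2 + (r\<^sup>2 / 2)\<^sup>2"
          by (simp add: power2_eq_square algebra_simps)
        then show "1 + r\<^sup>2 \<le> (1 + r\<^sup>2 / 2)\<^sup>2" by simp
      qed simp
      then have "1 / (1 + r\<^sup>2 / 2) \<le> 1 / sqrt (1 + r\<^sup>2)" using s by (intro frac_le) simp_all
      moreover have "1 - r\<^sup>2 / 2 \<le> 1 / (1 + r\<^sup>2 / 2)"
      proof -
        have "(1 - r\<^sup>2 / 2) * (1 + r\<^sup>2 / 2) = 1 - (r\<^sup>2 / 2)\<^sup>2"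
          by (simp add: power2_eq_square algebra_simps)
        then have "(1 - r\<^sup>2 / 2) * (1 + r\<^sup>2 / 2) \<le> 1" by simp
        moreover have "1 + r\<^sup>2 / 2 > 0" by (simp add: add_pos_nonneg)
        ultimately show ?thesis by (simp add: pos_le_divide_eq)
      qed
      ultimately show ?thesis by linarith
    qed
    also have "1 / sqrt (1 + r\<^sup>2) \<le> ?h / ?n" using n_le n0 s by (simp add: field_simps)
    finally show ?thesis by simp
  qed
  finally have "dist (y /\<^sub>R ?n) e \<le> r" by (rule power2_le_imp_le) (rule less_imp_le[OF r])
  then show "y \<in> cap_cone e r" unfolding cap_cone_def using n0 n1 by blast
qed

section \<open>Volumes of cones\<close>

lemma nn_integral_monomial:
  fixes c H :: real
  assumes "c \<ge> 0" "H \<ge> 0"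
  shows "(\<integral>\<^sup>+h\<in>{0..H}. ennreal (c * h ^ k) \<partial>lborel) = ennreal (c * H ^ Suc k / Suc k)"
proof -
  have "(\<integral>\<^sup>+h\<in>{0..H}. ennreal (c * h ^ k) \<partial>lborel) = ennreal (c * H ^ Suc k / Suc k - c * 0 ^ Suc k / Suc k)"
  proof (rule nn_integral_FTC_Icc)
    fix x :: real
    have "DERIV (\<lambda>h. h ^ Suc k) x :> Suc k * x ^ k" using DERIV_pow[of "Suc k" x] by simp
    from DERIV_cdivide[OF DERIV_cmult[OF this, of c], of "Suc k"]
    show "DERIV (\<lambda>h. c * h ^ Suc k / Suc k) x :> c * x ^ k" by simp
  qed (use assms in auto)
  then show ?thesis by simp
qed

text \<open>The slice at height h is a ball of dimension n - 1 and radius r * h. The coordinate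
  along e is split off from the product measure and the slices are integrated over 0 < h <
  H.\<close>

lemma emeasure_round_cone:
  fixes e :: "'a::euclidean_space"
  assumes e: "e \<in> Basis" and r: "r > 0" and H: "H > 0"
  shows "emeasure lborel {y::'a. 0 < y \<bullet> e \<and> y \<bullet> e < H \<and> (\<Sum>i\<in>Basis - {e}. (y \<bullet> i)\<^sup>2) \<le> (r * (y \<bullet> e))\<^sup>2}
    = ennreal (unit_ball_vol (real (DIM('a) - 1)) * r ^ (DIM('a) - 1) * H ^ DIM('a) / DIM('a))"
proof -
  interpret product_sigma_finite "\<lambda>_. lborel :: real measure" by standard
  let ?B = "Basis - {e} :: 'a set" and ?k = "DIM('a) - 1"
  let ?S = "{y::'a. 0 < y \<bullet> e \<and> y \<bullet> e < H \<and> (\<Sum>i\<in>?B. (y \<bullet> i)\<^sup>2) \<le> (r * (y \<bullet> e))\<^sup>2}"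
  let ?P = "\<lambda>A. Pi\<^sub>M A (\<lambda>_. lborel :: real measure)"
  let ?T = "{g. 0 < g e \<and> g e < H \<and> (\<Sum>i\<in>?B. (g i)\<^sup>2) \<le> (r * g e)\<^sup>2} \<inter> space (?P Basis)"
  have comp: "(\<lambda>g. g i) \<in> borel_measurable (?P I)" if "i \<in> I" for i I
    using measurable_component_singleton[OF that, of "\<lambda>_. lborel"] unfolding measurable_lborel1 .
  have S: "?S \<in> sets borel"
  proof -
    have "?S = {y. 0 < y \<bullet> e} \<inter> {y. y \<bullet> e < H} \<inter> {y. (\<Sum>i\<in>?B. (y \<bullet> i)\<^sup>2) \<le> (r * (y \<bullet> e))\<^sup>2}" by blast
    moreover have "open {y. 0 < y \<bullet> e}" "open {y. y \<bullet> e < H}" "closed {y. (\<Sum>i\<in>?B. (y \<bullet> i)\<^sup>2) \<le> (r * (y \<bullet> e))\<^sup>2}"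
      by (intro open_Collect_less closed_Collect_le continuous_intros)+
    ultimately show ?thesis by (simp only: sets.Int borel_open borel_closed)
  qed
  have T: "?T \<in> sets (?P Basis)"
  proof -
    have sum: "(\<lambda>g. \<Sum>i\<in>?B. (g i)\<^sup>2) \<in> borel_measurable (?P Basis)"
      by (intro borel_measurable_sum borel_measurable_power comp) simp
    have rsq: "(\<lambda>g. (r * g e)\<^sup>2) \<in> borel_measurable (?P Basis)"
      by (intro borel_measurable_power borel_measurable_times borel_measurable_const comp e)
    have "?T = {g \<in> space (?P Basis). 0 < g e} \<inter> {g \<in> space (?P Basis). g e < H}
        \<inter> {g \<in> space (?P Basis). (\<Sum>i\<in>?B. (g i)\<^sup>2) \<le> (r * g e)\<^sup>2}" by auto
    also have "\<dots> \<in> sets (?P Basis)"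
      by (intro sets.Int borel_measurable_less borel_measurable_le comp e sum rsq borel_measurable_const)
    finally show ?thesis .
  qed
  have ins: "insert e ?B = Basis" using e by auto
  have "emeasure lborel ?S = emeasure (distr (?P Basis) borel (\<lambda>f. \<Sum>b\<in>Basis. f b *\<^sub>R b)) ?S"
    by (rule arg_cong[where f = "\<lambda>M. emeasure M ?S", OF lborel_eq])
  also have "\<dots> = emeasure (?P Basis) ((\<lambda>f. \<Sum>b\<in>Basis. f b *\<^sub>R b) -` ?S \<inter> space (?P Basis))"
  proof (rule emeasure_distr)
    show "(\<lambda>f. \<Sum>b\<in>Basis. f b *\<^sub>R b) \<in> borel_measurable (?P Basis)"
      by (intro borel_measurable_sum borel_measurable_scaleR borel_measurable_const comp)
  qed (rule S)
  also have "(\<lambda>f. \<Sum>b\<in>Basis. f b *\<^sub>R b) -` ?S \<inter> space (?P Basis) = ?T"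
    using e by auto
  also have "emeasure (?P Basis) ?T = (\<integral>\<^sup>+g. indicator ?T g \<partial>?P (insert e ?B))"
    unfolding ins by (rule nn_integral_indicator[OF T, symmetric])
  also have "\<dots> = (\<integral>\<^sup>+h. \<integral>\<^sup>+g. indicator ?T (g(e := h)) \<partial>?P ?B \<partial>lborel)"
  proof (rule product_nn_integral_insert_rev)
    show "indicator ?T \<in> borel_measurable (?P (insert e ?B))"
      unfolding ins by (rule borel_measurable_indicator[OF T])
  qed auto
  also have "\<dots> = (\<integral>\<^sup>+h. ennreal (unit_ball_vol (real ?k) * r ^ ?k * h ^ ?k) * indicator {0..H} h \<partial>lborel)"
  proof (rule nn_integral_cong_AE)
    \<comment> \<open>The heights of the cone form an open interval, whereas
      \<open>nn_integral_monomial\<close> integrates over the closed one; the two end points are a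
      null set.\<close>
    have "AE h in lborel. h \<notin> {H, 0}"
      by (intro AE_not_in countable_imp_null_set_lborel) auto
    then show "AE h in lborel. (\<integral>\<^sup>+g. indicator ?T (g(e := h)) \<partial>?P ?B)
        = ennreal (unit_ball_vol (real ?k) * r ^ ?k * h ^ ?k) * indicator {0..H} h"
    proof eventually_elim
      case (elim h)
      show ?case
      proof (cases "0 < h \<and> h < H")
        case True
        have "(\<integral>\<^sup>+g. indicator ?T (g(e := h)) \<partial>?P ?B)
           = (\<integral>\<^sup>+g. indicator ({g. sqrt (\<Sum>i\<in>?B. (g i)\<^sup>2) \<le> r * h} \<inter> space (?P ?B)) g \<partial>?P ?B)"
        proof (rule nn_integral_cong)
          fix g assume g: "g \<in> space (?P ?B)"
          have "(\<Sum>i\<in>?B. ((g(e := h)) i)\<^sup>2) = (\<Sum>i\<in>?B. (g i)\<^sup>2)" by (intro sum.cong) auto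
          moreover have "g(e := h) \<in> space (?P Basis)" using g e by (auto simp: space_PiM PiE_def extensional_def)
          moreover have "sqrt (\<Sum>i\<in>?B. (g i)\<^sup>2) \<le> r * h \<longleftrightarrow> (\<Sum>i\<in>?B. (g i)\<^sup>2) \<le> (r * h)\<^sup>2"
            using r True by (intro real_sqrt_le_iff') (auto intro: sum_nonneg)
          ultimately show "indicator ?T (g(e := h))
              = (indicator ({g. sqrt (\<Sum>i\<in>?B. (g i)\<^sup>2) \<le> r * h} \<inter> space (?P ?B)) g :: ennreal)"
            using g True by (auto simp: indicator_def)
        qed
        also have "\<dots> = emeasure (?P ?B) ({g. sqrt (\<Sum>i\<in>?B. (g i)\<^sup>2) \<le> r * h} \<inter> space (?P ?B))"
        proof (rule nn_integral_indicator)
          have "{g. sqrt (\<Sum>i\<in>?B. (g i)\<^sup>2) \<le> r * h} \<inter> space (?P ?B)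
              = {g \<in> space (?P ?B). sqrt (\<Sum>i\<in>?B. (g i)\<^sup>2) \<le> r * h}" by blast
          also have "\<dots> \<in> sets (?P ?B)"
            by (intro borel_measurable_le measurable_compose[OF _ borel_measurable_sqrt] borel_measurable_sum borel_measurable_power
                comp borel_measurable_const)
          finally show "{g. sqrt (\<Sum>i\<in>?B. (g i)\<^sup>2) \<le> r * h} \<inter> space (?P ?B) \<in> sets (?P ?B)" .
        qed
        also have "\<dots> = ennreal (unit_ball_vol (real (card ?B)) * (r * h) ^ card ?B)"
          using r True by (intro emeasure_cball_aux) auto
        also have "card ?B = ?k" using e by simp
        finally have eq: "(\<integral>\<^sup>+g. indicator ?T (g(e := h)) \<partial>?P ?B)
            = ennreal (unit_ball_vol (real ?k) * (r * h) ^ ?k)" .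
        show ?thesis unfolding eq using True by (simp add: power_mult_distrib mult.assoc)
      next
        case False
        then have "(\<integral>\<^sup>+g. indicator ?T (g(e := h)) \<partial>?P ?B) = (\<integral>\<^sup>+g. 0 \<partial>?P ?B)"
          by (intro nn_integral_cong) (auto simp: indicator_def)
        then show ?thesis using False elim by (auto simp: indicator_def)
      qed
    qed
  qed
  also have "\<dots> = ennreal (unit_ball_vol (real ?k) * r ^ ?k * H ^ Suc ?k / Suc ?k)"
    using r H by (intro nn_integral_monomial) simp_all
  also have "Suc ?k = DIM('a)" by (simp add: Suc_leI)
  finally show ?thesis .
qed

text \<open>Uniqueness of Haar measure, in the special case needed: both sides times the volume of the unit
  ball are the integral of \<open>1\<^bsub>A\<^esub> (T x) * 1\<^bsub>B\<^esub> (y - T x)\<close>.\<close>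

lemma emeasure_orthogonal_vimage:
  fixes T :: "'a::euclidean_space \<Rightarrow> 'a"
  assumes T: "orthogonal_transformation T" and A [measurable]: "A \<in> sets borel"
  shows "emeasure lborel (T -` A) = emeasure lborel A"
proof -
  have lin: "linear T" and n: "\<And>y. norm (T y) = norm y"
    using T orthogonal_transformation_norm orthogonal_transformation_linear by blast+
  have [measurable]: "T \<in> borel_measurable borel"
    using linear_continuous_on[OF lin[unfolded linear_conv_bounded_linear]] by (rule borel_measurable_continuous_onI)
  obtain S where S: "\<And>y. T (S y) = y"
    using orthogonal_transformation_surj[OF T] by (metis surjD)
  let ?B = "ball (0::'a) 1"
  have [measurable]: "?B \<in> sets borel" by simp
  have "emeasure lborel (T -` A) * emeasure lborel ?B = (\<integral>\<^sup>+x. indicator A (T x) * emeasure lborel ?B \<partial>lborel)"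
  proof -
    have "T -` A \<in> sets borel" using measurable_sets[of T borel borel A] by simp
    then have "emeasure lborel (T -` A) = (\<integral>\<^sup>+x. indicator (T -` A) x \<partial>lborel)" by simp
    also have "\<dots> = (\<integral>\<^sup>+x. indicator A (T x) \<partial>lborel)"
      by (intro nn_integral_cong) (simp add: indicator_def)
    finally show ?thesis by (simp add: nn_integral_multc)
  qed
  also have "\<dots> = (\<integral>\<^sup>+x. \<integral>\<^sup>+y. indicator A (T x) * indicator ?B (y - T x) \<partial>lborel \<partial>lborel)"
  proof (rule nn_integral_cong)
    fix x
    have "(\<integral>\<^sup>+y. indicator A (T x) * indicator ?B (y - T x) \<partial>lborel) = indicator A (T x) * (\<integral>\<^sup>+y. indicator ?B (y - T x) \<partial>lborel)"
      by (rule nn_integral_cmult) measurable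
    also have "(\<integral>\<^sup>+y. indicator ?B (y - T x) \<partial>lborel) = emeasure lborel ?B"
      using nn_integral_lborel_translate[of "indicator ?B" "- T x"] by simp
    finally show "indicator A (T x) * emeasure lborel ?B = (\<integral>\<^sup>+y. indicator A (T x) * indicator ?B (y - T x) \<partial>lborel)" by simp
  qed
  also have "\<dots> = (\<integral>\<^sup>+y. \<integral>\<^sup>+x. indicator A (T x) * indicator ?B (y - T x) \<partial>lborel \<partial>lborel)"
    by (rule lborel_pair.Fubini'[symmetric]) measurable
  also have "\<dots> = (\<integral>\<^sup>+y. \<integral>\<^sup>+x. indicator A (T x + y) * indicator ?B (- T x) \<partial>lborel \<partial>lborel)"
  proof (rule nn_integral_cong)
    fix y
    have "(\<integral>\<^sup>+x. indicator A (T x) * indicator ?B (y - T x) \<partial>lborel)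
        = (\<integral>\<^sup>+x. indicator A (T (x + S y)) * indicator ?B (y - T (x + S y)) \<partial>lborel)"
      by (rule nn_integral_lborel_translate[symmetric]) measurable
    then show "(\<integral>\<^sup>+x. indicator A (T x) * indicator ?B (y - T x) \<partial>lborel)
        = (\<integral>\<^sup>+x. indicator A (T x + y) * indicator ?B (- T x) \<partial>lborel)"
      using lin S by (simp add: linear_add)
  qed
  also have "\<dots> = (\<integral>\<^sup>+x. \<integral>\<^sup>+y. indicator A (T x + y) * indicator ?B (- T x) \<partial>lborel \<partial>lborel)"
    by (rule lborel_pair.Fubini') measurable
  also have "\<dots> = (\<integral>\<^sup>+x. emeasure lborel A * indicator ?B x \<partial>lborel)"
  proof (rule nn_integral_cong)
    fix x
    have "(\<integral>\<^sup>+y. indicator A (T x + y) * indicator ?B (- T x) \<partial>lborel) = (\<integral>\<^sup>+y. indicator A (T x + y) \<partial>lborel) * indicator ?B (- T x)"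
      by (rule nn_integral_multc) measurable
    also have "(\<integral>\<^sup>+y. indicator A (T x + y) \<partial>lborel) = emeasure lborel A"
      using nn_integral_lborel_translate[of "indicator A" "T x"] by (simp add: add.commute)
    finally show "(\<integral>\<^sup>+y. indicator A (T x + y) * indicator ?B (- T x) \<partial>lborel) = emeasure lborel A * indicator ?B x"
      using n by (simp add: indicator_def)
  qed
  also have "\<dots> = emeasure lborel A * emeasure lborel ?B" by (simp add: nn_integral_cmult)
  finally have "emeasure lborel ?B * emeasure lborel (T -` A) = emeasure lborel ?B * emeasure lborel A" by (simp add: mult.commute)
  moreover have "emeasure lborel ?B \<noteq> 0" "emeasure lborel ?B \<noteq> top"
    using unit_ball_vol_pos[of "real DIM('a)"] by (simp_all add: emeasure_ball ennreal_eq_0_iff not_le)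
  ultimately show ?thesis by (simp add: ennreal_mult_cancel_left)
qed

lemma orthogonal_vimage_cap_cone:
  fixes T :: "'a::euclidean_space \<Rightarrow> 'a"
  assumes "orthogonal_transformation T"
  shows "T -` cap_cone (T x) r = cap_cone x r"
proof -
  have lin: "linear T" and n: "\<And>y. norm (T y) = norm y"
    using assms orthogonal_transformation_norm orthogonal_transformation_linear by blast+
  have d: "dist (T y /\<^sub>R norm (T y)) (T x) = dist (y /\<^sub>R norm y) x" for y
  proof -
    have "T y /\<^sub>R norm (T y) - T x = T (y /\<^sub>R norm y - x)"
      using lin n by (simp add: linear_diff linear_cmul)
    then show ?thesis using n by (simp add: dist_norm)
  qed
  show ?thesis
    unfolding cap_cone_def vimage_def mem_Collect_eq n d[unfolded n] ..
qed

text \<open>The round cone was measured along a basis vector. An orthogonal map taking this vector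
  to x preserves volume and carries cap cones to cap cones.\<close>

lemma emeasure_cap_cone_ge:
  fixes x :: "real ^ 'n"
  assumes x: "norm x = 1" and r: "r > 0"
  shows "emeasure lborel (cap_cone x r)
    \<ge> ennreal (unit_ball_vol (real (CARD('n) - 1)) * r ^ (CARD('n) - 1) * (1 / sqrt (1 + r\<^sup>2)) ^ CARD('n) / CARD('n))"
proof -
  obtain e :: "real ^ 'n" where e: "e \<in> Basis" using nonempty_Basis by blast
  then obtain T where T: "orthogonal_transformation T" "T e = x"
    using orthogonal_transformation_exists_1[of e x] x by auto
  have H: "1 / sqrt (1 + r\<^sup>2) > 0" by (simp add: add_pos_nonneg)
  have "emeasure lborel {y. 0 < y \<bullet> e \<and> y \<bullet> e < 1 / sqrt (1 + r\<^sup>2) \<and> (\<Sum>i\<in>Basis - {e}. (y \<bullet> i)\<^sup>2) \<le> (r * (y \<bullet> e))\<^sup>2}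
      \<le> emeasure lborel (cap_cone e r)"
    using round_cone_subset_cap_cone[OF e r] by (intro emeasure_mono) auto
  also have "emeasure lborel (cap_cone e r) = emeasure lborel (cap_cone x r)"
    using emeasure_orthogonal_vimage[OF T(1) cap_cone_borel, of x r]
      orthogonal_vimage_cap_cone[OF T(1), of e r] T(2) by simp
  finally show ?thesis unfolding emeasure_round_cone[OF e r H] by simp
qed

section \<open>Coverings of the sphere by small caps\<close>

lemma hausdorff_gauge_le:
  fixes U :: "'a::euclidean_space set"
  assumes "U \<subseteq> cball x r" "r \<ge> 0"
  shows "hausdorff_gauge k U \<le> ennreal (unit_ball_vol (real k) * r ^ k)" "bounded U" "diameter U \<le> 2 * r"
proof -
  show "bounded U" using assms(1) bounded_cball by (rule bounded_subset[rotated])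
  show d: "diameter U \<le> 2 * r"
    using diameter_subset[OF assms(1) bounded_cball] assms(2) by simp
  have "diameter U \<ge> 0" using \<open>bounded U\<close> by (rule diameter_ge_0)
  then show "hausdorff_gauge k U \<le> ennreal (unit_ball_vol (real k) * r ^ k)"
    unfolding hausdorff_gauge_def using d
    by (auto intro!: ennreal_leI mult_left_mono power_mono)
qed

text \<open>Disjoint balls of a Vitali family have disjoint cones in the unit ball, which bounds
  their total gauge by n times the volume of that ball, divided by q. Finitely many balls keep their
  size and the others are enlarged five times; the enlarged tail costs less than \<eta>. An enlarged
  ball has diameter at most \<open>10 * r\<^sub>0\<close>.\<close>

lemma hausdorff_pre_sphere_le:
  fixes \<delta> r\<^sub>0 \<eta> :: real
  assumes r\<^sub>0: "r\<^sub>0 > 0" "10 * r\<^sub>0 \<le> \<delta>" and \<eta>: "\<eta> > 0"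
  shows "hausdorff_pre (CARD('n) - 1) \<delta> (sphere (0 :: real ^ 'n) 1)
    \<le> ennreal (CARD('n) * unit_ball_vol CARD('n) * sqrt (1 + r\<^sub>0\<^sup>2) ^ CARD('n) + \<eta>)"
proof -
  let ?k = "CARD('n) - 1" and ?n = "real CARD('n)" and ?S = "sphere (0 :: real ^ 'n) 1"
  let ?\<kappa> = "unit_ball_vol (real ?k)" and ?\<Omega> = "unit_ball_vol ?n"
  \<comment> \<open>The smallest of the height factors in \<open>emeasure_cap_cone_ge\<close> for
    radii up to \<open>r\<^sub>0\<close>; it tends to one with
    \<open>r\<^sub>0 \<rightarrow> 0\<close>.\<close>
  define q where "q = (1 / sqrt (1 + r\<^sub>0\<^sup>2)) ^ CARD('n)"
  have q: "q > 0" unfolding q_def by (intro zero_less_power) (simp add: add_pos_nonneg)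
  define K where "K = {(x :: real ^ 'n, r). norm x = 1 \<and> 0 < r \<and> r \<le> r\<^sub>0}"
  obtain C where C: "countable C" "C \<subseteq> K"
     "pairwise (\<lambda>i j. disjnt (cball (fst i) (snd i)) (cball (fst j) (snd j))) C"
     and Vit: "\<And>i. i \<in> K \<Longrightarrow> \<exists>j. j \<in> C \<and> \<not> disjnt (cball (fst i) (snd i)) (cball (fst j) (snd j)) \<and>
                        cball (fst i) (snd i) \<subseteq> ball (fst j) (5 * snd j)"
  proof (rule Vitali_covering_lemma_cballs_balls[of K snd r\<^sub>0 fst], goal_cases)
    case (1 i)
    from 1(2) show ?case by (auto simp: K_def)
  next
    case (2 C)
    show ?case by (rule 2(1)[OF 2(2-5)])
  qed
  \<comment> \<open>The Vitali family may be finite or infinite. It is indexed by a set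
    \<open>I\<close> of naturals, and all other indices receive empty sets and weight 0.\<close>
  define I where "I = to_nat_on C ` C"
  define X where "X i = fst (from_nat_into C i)" for i
  define \<rho> where "\<rho> i = snd (from_nat_into C i)" for i
  have mem: "from_nat_into C i \<in> C" if "i \<in> I" for i
    using that C(1) by (auto simp: I_def)
  have inj: "from_nat_into C i \<noteq> from_nat_into C j" if "i \<in> I" "j \<in> I" "i \<noteq> j" for i j
    using that C(1) by (auto simp: I_def)
  have X: "norm (X i) = 1" "0 < \<rho> i" "\<rho> i \<le> r\<^sub>0" if "i \<in> I" for i
    using mem[OF that] C(2) unfolding X_def \<rho>_def K_def by auto
  define b where "b i = (if i \<in> I then ?\<kappa> * \<rho> i ^ ?k else 0)" for i
  have b0: "b i \<ge> 0" for i using X(2)[of i] by (auto simp: b_def intro!: mult_nonneg_nonneg)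
  define D where "D i = (if i \<in> I then cap_cone (X i) (\<rho> i) else {})" for i
  have "disjoint_family D"
    unfolding disjoint_family_on_def
  proof (intro ballI impI)
    fix i j :: nat assume "i \<noteq> j"
    show "D i \<inter> D j = {}"
    proof (rule ccontr)
      assume ne: "D i \<inter> D j \<noteq> {}"
      then have ij: "i \<in> I" "j \<in> I" by (auto simp: D_def split: if_splits)
      then obtain y where "y \<in> cap_cone (X i) (\<rho> i)" "y \<in> cap_cone (X j) (\<rho> j)" using ne by (auto simp: D_def)
      then have "y /\<^sub>R norm y \<in> cball (X i) (\<rho> i) \<inter> cball (X j) (\<rho> j)" by (simp add: cap_cone_def dist_commute)
      moreover have "disjnt (cball (X i) (\<rho> i)) (cball (X j) (\<rho> j))"
        using C(3) mem ij inj[OF ij \<open>i \<noteq> j\<close>] unfolding pairwise_def X_def \<rho>_def by blast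
      ultimately show False unfolding disjnt_def by blast
    qed
  qed
  moreover have Dm: "range D \<subseteq> sets lborel" by (auto simp: D_def)
  ultimately have "(\<Sum>i. emeasure lborel (D i)) = emeasure lborel (\<Union>i. D i)"
    by (intro suminf_emeasure) auto
  also have "\<dots> \<le> emeasure lborel (ball (0 :: real ^ 'n) 1)"
    by (intro emeasure_mono) (auto simp: D_def cap_cone_def split: if_splits)
  also have "\<dots> = ennreal ?\<Omega>" by (simp add: emeasure_ball)
  finally have sumD: "(\<Sum>i. emeasure lborel (D i)) \<le> ennreal ?\<Omega>" .
  have D_ge: "ennreal (b i * (q / ?n)) \<le> emeasure lborel (D i)" for i
  proof (cases "i \<in> I")
    case True
    let ?s = "1 / sqrt (1 + (\<rho> i)\<^sup>2)"
    have sq: "sqrt (1 + t\<^sup>2) > 0" for t :: real by (simp add: add_pos_nonneg)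
    have "(\<rho> i)\<^sup>2 \<le> r\<^sub>0\<^sup>2" using X[OF True] by (intro power_mono) simp_all
    then have "sqrt (1 + (\<rho> i)\<^sup>2) \<le> sqrt (1 + r\<^sub>0\<^sup>2)" by simp
    then have "1 / sqrt (1 + r\<^sub>0\<^sup>2) \<le> ?s" by (intro frac_le sq) simp_all
    then have qs: "q \<le> ?s ^ CARD('n)" unfolding q_def by (rule power_mono) (use sq[of r\<^sub>0] in simp)
    have "b i * (q / ?n) = ?\<kappa> * \<rho> i ^ ?k * q / ?n" using True by (simp add: b_def)
    also have "\<dots> \<le> ?\<kappa> * \<rho> i ^ ?k * ?s ^ CARD('n) / ?n"
      using X(2)[OF True] by (intro divide_right_mono mult_left_mono qs mult_nonneg_nonneg) simp_all
    finally have "ennreal (b i * (q / ?n)) \<le> ennreal (?\<kappa> * \<rho> i ^ ?k * ?s ^ CARD('n) / ?n)"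
      by (rule ennreal_leI)
    also note emeasure_cap_cone_ge[OF X(1,2)[OF True]]
    finally show ?thesis using True by (simp add: D_def)
  qed (simp add: b_def)
  have partial: "(\<Sum>i<m. b i) \<le> ?n * ?\<Omega> / q" for m
  proof -
    have "ennreal ((\<Sum>i<m. b i) * (q / ?n)) = (\<Sum>i<m. ennreal (b i * (q / ?n)))"
      using b0 q by (simp add: sum_distrib_right sum_divide_distrib)
    also have "\<dots> \<le> (\<Sum>i<m. emeasure lborel (D i))" by (intro sum_mono D_ge)
    also have "\<dots> \<le> (\<Sum>i. emeasure lborel (D i))" by (intro sum_le_suminf) auto
    also note sumD
    finally have "(\<Sum>i<m. b i) * (q / ?n) \<le> ?\<Omega>" by (subst (asm) ennreal_le_iff) auto
    then show ?thesis using q by (simp add: field_simps)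
  qed
  have sb: "summable b" using b0 partial by (rule summableI_nonneg_bounded)
  have "\<eta> / 5 ^ ?k > 0" using \<eta> by simp
  \<comment> \<open>Enlargement multiplies a weight by \<open>5 ^ ?k\<close>, so the tail is made
    smaller than \<eta> by this factor beforehand.\<close>
  from suminf_exist_split[OF this sb] obtain m where m: "norm (\<Sum>i. b (i + m)) < \<eta> / 5 ^ ?k" by blast
  define c where "c i = (if i < m then b i else 5 ^ ?k * b i)" for i
  have c0: "c i \<ge> 0" for i using b0 by (simp add: c_def)
  have c_shift: "(\<lambda>i. c (i + m)) = (\<lambda>i. 5 ^ ?k * b (i + m))" by (auto simp: c_def)
  have sc: "summable c"
  proof -
    have "summable (\<lambda>i. b (i + m))" using sb by (subst summable_iff_shift)
    then have "summable (\<lambda>i. c (i + m))" unfolding c_shift by (rule summable_mult)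
    then show ?thesis by (subst (asm) summable_iff_shift)
  qed
  have "suminf c = (\<Sum>i. c (i + m)) + (\<Sum>i<m. c i)" by (rule suminf_split_initial_segment[OF sc])
  also have "(\<Sum>i. c (i + m)) = 5 ^ ?k * (\<Sum>i. b (i + m))"
    unfolding c_shift by (rule suminf_mult) (use sb in \<open>subst summable_iff_shift\<close>)
  also have "5 ^ ?k * (\<Sum>i. b (i + m)) \<le> \<eta>" using m by (simp add: field_simps abs_less_iff)
  also have "(\<Sum>i<m. c i) = (\<Sum>i<m. b i)" by (intro sum.cong) (auto simp: c_def)
  also have "\<dots> \<le> ?n * ?\<Omega> / q" by (rule partial)
  finally have sum_c: "suminf c \<le> ?n * ?\<Omega> / q + \<eta>" by simp
  define U where "U i = (if i \<in> I then ?S \<inter> cball (X i) (if i < m then \<rho> i else 5 * \<rho> i) else {})" for i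
  have U_gauge: "hausdorff_gauge ?k (U i) \<le> ennreal (c i)" and U_small: "bounded (U i) \<and> diameter (U i) \<le> \<delta>" for i
  proof -
    have "hausdorff_gauge ?k (U i) \<le> ennreal (c i) \<and> bounded (U i) \<and> diameter (U i) \<le> \<delta>"
    proof (cases "i \<in> I")
      case True
      define s where "s = (if i < m then \<rho> i else 5 * \<rho> i)"
      have "U i \<subseteq> cball (X i) s" "s \<ge> 0" "2 * s \<le> \<delta>"
        using True X[OF True] r\<^sub>0 by (auto simp: U_def s_def)
      moreover have "?\<kappa> * s ^ ?k = c i" using True by (simp add: c_def s_def b_def power_mult_distrib)
      ultimately show ?thesis using hausdorff_gauge_le(1)[of "U i" "X i" s ?k] hausdorff_gauge_le(2,3)[of "U i" "X i" s] by simp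
    next
      case False
      then show ?thesis using r\<^sub>0 by (simp add: U_def hausdorff_gauge_def diameter_def)
    qed
    then show "hausdorff_gauge ?k (U i) \<le> ennreal (c i)" "bounded (U i) \<and> diameter (U i) \<le> \<delta>" by auto
  qed
  have cover: "?S \<subseteq> (\<Union>i. U i)"
  proof
    fix x assume x: "x \<in> ?S"
    show "x \<in> (\<Union>i. U i)"
    proof (cases "\<exists>i<m. i \<in> I \<and> x \<in> cball (X i) (\<rho> i)")
      case True
      then obtain i where "i < m" "i \<in> I" "x \<in> cball (X i) (\<rho> i)" by blast
      then have "x \<in> U i" using x by (simp add: U_def)
      then show ?thesis by blast
    next
      case False
      \<comment> \<open>A small ball about x avoids the closed set F. The ball that the Vitali
        property assigns to it meets it, so its index is at least m, and its enlargement, which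
        contains x, belongs to the cover.\<close>
      define F where "F = (\<Union>i\<in>{i. i < m \<and> i \<in> I}. cball (X i) (\<rho> i))"
      have "open (- F)" unfolding F_def by (intro open_Compl closed_UN) auto
      moreover have "x \<in> - F" using False unfolding F_def by blast
      ultimately obtain d where d: "d > 0" "cball x d \<subseteq> - F"
        using open_contains_cball by metis
      have "(x, min d r\<^sub>0) \<in> K" using x d r\<^sub>0 by (simp add: K_def)
      from Vit[OF this] obtain j where j: "j \<in> C" "\<not> disjnt (cball x (min d r\<^sub>0)) (cball (fst j) (snd j))"
        "cball x (min d r\<^sub>0) \<subseteq> ball (fst j) (5 * snd j)" by auto
      define i where "i = to_nat_on C j"
      have i: "i \<in> I" "from_nat_into C i = j" using j C(1) by (auto simp: i_def I_def)
      then have Xi: "X i = fst j" "\<rho> i = snd j" by (auto simp: X_def \<rho>_def)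
      have "\<not> i < m"
      proof
        assume "i < m"
        then have "cball (X i) (\<rho> i) \<subseteq> F" unfolding F_def using i by blast
        moreover have "cball x (min d r\<^sub>0) \<subseteq> cball x d" by auto
        ultimately show False using d(2) j(2) unfolding disjnt_def Xi[symmetric] by blast
      qed
      moreover have "x \<in> cball (X i) (5 * \<rho> i)"
        using j(3) d r\<^sub>0 unfolding Xi by (auto simp: subset_iff intro!: less_imp_le)
      ultimately have "x \<in> U i" using x i by (simp add: U_def)
      then show ?thesis by blast
    qed
  qed
  have "hausdorff_pre ?k \<delta> ?S \<le> (\<Sum>i. hausdorff_gauge ?k (U i))"
    unfolding hausdorff_pre_def using cover U_small by (intro INF_lower) auto
  also have "\<dots> \<le> (\<Sum>i. ennreal (c i))" by (intro suminf_le U_gauge) auto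
  also have "\<dots> = ennreal (suminf c)" using c0 sc by (intro suminf_ennreal2) auto
  also have "\<dots> \<le> ennreal (?n * ?\<Omega> / q + \<eta>)" using sum_c by (rule ennreal_leI)
  also have "?n * ?\<Omega> / q = ?n * ?\<Omega> * sqrt (1 + r\<^sub>0\<^sup>2) ^ CARD('n)" by (simp add: q_def power_one_over)
  finally show ?thesis .
qed

text \<open>For fixed \<delta> the radius of the caps and the error tend to zero together. The
  resulting bound is independent of \<delta> and passes to the supremum.\<close>

theorem unit_sphere_area_le: "unit_sphere_area TYPE(real ^ 'n) \<le> CARD('n) * unit_ball_vol CARD('n)"
proof -
  let ?S = "sphere (0 :: real ^ 'n) 1" and ?k = "CARD('n) - 1" and ?X = "CARD('n) * unit_ball_vol CARD('n)"
  have X: "?X \<ge> 0" by simp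
  have "hausdorff_pre ?k \<delta> ?S \<le> ennreal ?X" if \<delta>: "\<delta> > 0" for \<delta>
  proof (rule tendsto_lowerbound)
    have "((\<lambda>r. ?X * sqrt (1 + r\<^sup>2) ^ CARD('n) + r) \<longlongrightarrow> ?X * sqrt (1 + 0\<^sup>2) ^ CARD('n) + 0) (at_right 0)"
      by (intro tendsto_intros)
    then show "((\<lambda>r. ennreal (?X * sqrt (1 + r\<^sup>2) ^ CARD('n) + r)) \<longlongrightarrow> ennreal ?X) (at_right 0)"
      by (intro tendsto_ennrealI) simp
    show "\<forall>\<^sub>F r in at_right 0. hausdorff_pre ?k \<delta> ?S \<le> ennreal (?X * sqrt (1 + r\<^sup>2) ^ CARD('n) + r)"
      using \<delta> hausdorff_pre_sphere_le[where 'n = 'n] by (intro eventually_at_rightI[of 0 "\<delta> / 10"]) auto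
  qed simp
  then have "hausdorff_outer ?k ?S \<le> ennreal ?X"
    unfolding hausdorff_outer_def by (intro SUP_least) auto
  \<comment> \<open>Were the sphere not in the sigma-algebra, \<open>emeasure\<close> would be 0 by
    default, so the inequality holds in either case.\<close>
  moreover have "emeasure (hausdorff_measure ?k) ?S \<le> hausdorff_outer ?k ?S"
  proof (cases "?S \<in> sets (hausdorff_measure ?k)")
    case False
    then show ?thesis by (simp add: emeasure_notin_sets)
  qed (simp add: emeasure_hausdorff_measure)
  ultimately have "emeasure (hausdorff_measure ?k) ?S \<le> ennreal ?X" by order
  then have "enn2real (emeasure (hausdorff_measure ?k) ?S) \<le> enn2real (ennreal ?X)"
    by (rule enn2real_mono) simp
  then show ?thesis using X by (simp add: unit_sphere_area_def measure_def)
qed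


section \<open>The growth estimate\<close>

lemma epowr_mult:
  assumes "a > 0"
  shows "(ennreal a * x) epowr p = ennreal (a powr p) * x epowr p"
proof (cases x)
  case (real v)
  then show ?thesis using assms
    by (simp add: epowr_def ennreal_mult'[symmetric] powr_mult)
next
  case top
  then show ?thesis using assms by (simp add: epowr_def ennreal_mult_top)
qed

text \<open>Approximation from below by simple functions avoids asking for a measurable
  \<open>g\<close>. In \<open>ring_modulus_le\<close> the integrand contains \<psi> at norm x with
  \<psi> only Lebesgue measurable, so its measurability is not a mere matter of composition.\<close>

lemma nn_integral_cmult_le:
  assumes a: "a > 0"
  shows "(\<integral>\<^sup>+x. ennreal a * g x \<partial>M) \<le> ennreal a * (\<integral>\<^sup>+x. g x \<partial>M)"
  unfolding nn_integral_def[of M "\<lambda>x. ennreal a * g x"]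
proof (rule SUP_least)
  fix s assume s: "s \<in> {s. simple_function M s \<and> s \<le> (\<lambda>x. ennreal a * g x)}"
  have meas: "s \<in> borel_measurable M" using s by (auto intro: borel_measurable_simple_function)
  have inv: "ennreal a * (ennreal (1 / a) * y) = y" "ennreal (1 / a) * (ennreal a * y) = y" for y
    using a by (simp_all add: mult.assoc[symmetric] ennreal_mult'[symmetric])
  have "ennreal (1 / a) * s x \<le> g x" for x
  proof -
    have "s x \<le> ennreal a * g x" using s by (simp add: le_fun_def)
    then have "ennreal (1 / a) * s x \<le> ennreal (1 / a) * (ennreal a * g x)" by (rule mult_left_mono) simp
    then show ?thesis by (simp only: inv)
  qed
  then have "(\<integral>\<^sup>+x. ennreal (1 / a) * s x \<partial>M) \<le> (\<integral>\<^sup>+x. g x \<partial>M)" by (rule nn_integral_mono)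
  then have "ennreal a * (\<integral>\<^sup>+x. ennreal (1 / a) * s x \<partial>M) \<le> ennreal a * (\<integral>\<^sup>+x. g x \<partial>M)" by (rule mult_left_mono) simp
  moreover have "ennreal a * (\<integral>\<^sup>+x. ennreal (1 / a) * s x \<partial>M) = (\<integral>\<^sup>+x. s x \<partial>M)"
    using meas by (simp add: nn_integral_cmult inv)
  moreover have "(\<integral>\<^sup>+x. s x \<partial>M) = integral\<^sup>S M s" using s by (intro nn_integral_eq_simple_integral) simp
  ultimately show "integral\<^sup>S M s \<le> ennreal a * (\<integral>\<^sup>+x. g x \<partial>M)" by simp
qed

lemma frontier_dist_unit_ball: "infdist (0::'a::euclidean_space) (frontier (ball 0 1)) = 1"
proof -
  obtain e :: 'a where "norm e = 1" using vector_choose_size[of 1] by auto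
  then have "sphere (0::'a) 1 \<noteq> {}" by auto
  moreover have "dist (0::'a) a = 1" if "a \<in> sphere 0 1" for a using that by simp
  ultimately show ?thesis by (simp add: infdist_def frontier_ball cong: INF_cong_simp)
qed

text \<open>The test function is \<psi> divided by its own integral I over the ring, hence
  normalised exactly. The growth bound refers to the ring with outer radius 1, which contains the
  given one.\<close>

lemma ring_modulus_le:
  fixes f :: "'a::euclidean_space \<Rightarrow> 'a"
  assumes ring: "ring_mapping_at p Q (ball 0 1) f 0"
    and r: "0 < r\<^sub>1" "r\<^sub>1 < r\<^sub>2" "r\<^sub>2 < 1"
    and \<psi>: "\<psi> \<in> borel_measurable (lebesgue_on {0<..})"
    and I: "(\<integral>\<^sup>+t\<in>{r\<^sub>1<..<r\<^sub>2}. \<psi> t \<partial>lebesgue) = ennreal I" "I > 0"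
    and growth: "(\<integral>\<^sup>+x \<in> annulus r\<^sub>1 1 0. Q x * \<psi> (norm x) epowr p \<partial>lebesgue) \<le> ennreal b" and b: "b \<ge> 0"
  shows "modulus p (image_curves f (joining_curves (sphere 0 r\<^sub>1) (sphere 0 r\<^sub>2) (annulus r\<^sub>1 r\<^sub>2 0)))
    \<le> ennreal (I powr (- p) * b)"
proof -
  define \<eta> where "\<eta> t = ennreal (1 / I) * \<psi> t" for t
  have \<psi>': "\<psi> \<in> borel_measurable (lebesgue_on {r\<^sub>1<..<r\<^sub>2})"
    by (rule measurable_restrict_mono[OF \<psi>]) (use r in auto)
  then have \<eta>: "\<eta> \<in> borel_measurable (lebesgue_on {r\<^sub>1<..<r\<^sub>2})" unfolding \<eta>_def by measurable
  have meas: "(\<lambda>t. \<psi> t * indicator {r\<^sub>1<..<r\<^sub>2} t) \<in> borel_measurable lebesgue"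
    using \<psi>' by (subst borel_measurable_restrict_space_iff_ennreal[symmetric]) auto
  have "(\<integral>\<^sup>+t\<in>{r\<^sub>1<..<r\<^sub>2}. \<eta> t \<partial>lebesgue) = (\<integral>\<^sup>+t. ennreal (1 / I) * (\<psi> t * indicator {r\<^sub>1<..<r\<^sub>2} t) \<partial>lebesgue)"
    by (simp add: \<eta>_def mult.assoc)
  also have "\<dots> = ennreal (1 / I) * ennreal I" unfolding I(1)[symmetric] by (rule nn_integral_cmult[OF meas])
  also have "\<dots> = 1" using I(2) by (simp add: ennreal_mult'[symmetric])
  finally have one: "(\<integral>\<^sup>+t\<in>{r\<^sub>1<..<r\<^sub>2}. \<eta> t \<partial>lebesgue) \<ge> 1" by simp
  have "modulus p (image_curves f (joining_curves (sphere 0 r\<^sub>1) (sphere 0 r\<^sub>2) (annulus r\<^sub>1 r\<^sub>2 0)))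
      \<le> (\<integral>\<^sup>+x \<in> annulus r\<^sub>1 r\<^sub>2 0. Q x * \<eta> (dist x 0) epowr p \<partial>lebesgue)"
    using ring[unfolded ring_mapping_at_def frontier_dist_unit_ball] \<eta> one r by blast
  also have "\<dots> \<le> (\<integral>\<^sup>+x. ennreal ((1 / I) powr p) * (Q x * \<psi> (norm x) epowr p * indicator (annulus r\<^sub>1 1 0) x) \<partial>lebesgue)"
  proof (rule nn_integral_mono)
    fix x :: 'a
    have "annulus r\<^sub>1 r\<^sub>2 0 \<subseteq> annulus r\<^sub>1 1 (0::'a)" using r by (auto simp: annulus_def)
    then have "indicator (annulus r\<^sub>1 r\<^sub>2 0) x \<le> (indicator (annulus r\<^sub>1 1 0) x :: ennreal)"
      by (auto simp: indicator_def)
    then have "ennreal ((1 / I) powr p) * (Q x * \<psi> (norm x) epowr p * indicator (annulus r\<^sub>1 r\<^sub>2 0) x)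
        \<le> ennreal ((1 / I) powr p) * (Q x * \<psi> (norm x) epowr p * indicator (annulus r\<^sub>1 1 0) x)"
      by (intro mult_left_mono) simp_all
    moreover have "\<eta> (dist x 0) epowr p = ennreal ((1 / I) powr p) * \<psi> (norm x) epowr p"
      using I(2) by (simp add: \<eta>_def epowr_mult)
    ultimately show "Q x * \<eta> (dist x 0) epowr p * indicator (annulus r\<^sub>1 r\<^sub>2 0) x
        \<le> ennreal ((1 / I) powr p) * (Q x * \<psi> (norm x) epowr p * indicator (annulus r\<^sub>1 1 0) x)"
      by (simp add: ac_simps)
  qed
  also have "\<dots> \<le> ennreal ((1 / I) powr p) * (\<integral>\<^sup>+x \<in> annulus r\<^sub>1 1 0. Q x * \<psi> (norm x) epowr p \<partial>lebesgue)"
    using I(2) by (intro nn_integral_cmult_le) simp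
  also have "\<dots> \<le> ennreal ((1 / I) powr p) * ennreal b" by (rule mult_left_mono[OF growth]) simp
  also have "\<dots> = ennreal (I powr (- p) * b)"
    using I(2) b by (simp add: ennreal_mult'[symmetric] powr_minus_divide powr_divide)
  finally show ?thesis .
qed

text \<open>The ring inequality asks for an outer radius below 1, so radii \<open>s k\<close>
  increasing to 1 are used; the shift in k + 2 keeps even \<open>s 0\<close> above r. The limit is
  an integral over an open interval, and the end points are null.\<close>

lemma nn_integral_tail_LIMSEQ:
  fixes \<psi> :: "real \<Rightarrow> ennreal"
  assumes \<psi>: "\<psi> \<in> borel_measurable (lebesgue_on {0<..})" and r: "0 < r" "r < 1"
  defines "s \<equiv> \<lambda>k. 1 - (1 - r) / real (k + 2)"
  shows "(\<lambda>k. \<integral>\<^sup>+t\<in>{r<..<s k}. \<psi> t \<partial>lebesgue) \<longlonglongrightarrow> (\<integral>\<^sup>+t\<in>{r..1}. \<psi> t \<partial>lebesgue)"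
    and "\<And>k. r < s k" "\<And>k. s k < 1"
proof -
  show rs: "r < s k" for k
  proof -
    have "(1 - r) / real (k + 2) < (1 - r) / 1" using r by (intro divide_strict_left_mono) auto
    then show ?thesis by (simp add: s_def)
  qed
  show s1: "s k < 1" for k using r by (simp add: s_def)
  have meas: "(\<lambda>t. \<psi> t * indicator A t) \<in> borel_measurable lebesgue" if "A \<subseteq> {0<..}" "A \<in> sets lebesgue" for A
    using measurable_restrict_mono[OF \<psi> that(1)] that(2)
    by (subst borel_measurable_restrict_space_iff_ennreal[symmetric]) auto
  have lim_s: "s \<longlonglongrightarrow> 1"
  proof -
    have "(\<lambda>k. (1 - r) / real (k + 2)) \<longlonglongrightarrow> 0"
      by (rule LIMSEQ_ignore_initial_segment[OF lim_const_over_n])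
    then have "(\<lambda>k. 1 - (1 - r) / real (k + 2)) \<longlonglongrightarrow> 1 - 0" by (intro tendsto_intros)
    then show ?thesis by (simp add: s_def)
  qed
  have mono_s: "s j \<le> s k" if "j \<le> k" for j k
    unfolding s_def using r that by (intro diff_left_mono divide_left_mono) auto
  have "(\<lambda>k. \<integral>\<^sup>+t\<in>{r<..<s k}. \<psi> t \<partial>lebesgue) \<longlonglongrightarrow> (\<integral>\<^sup>+t\<in>{r<..<1}. \<psi> t \<partial>lebesgue)"
  proof (rule nn_integral_LIMSEQ)
    show "incseq (\<lambda>k t. \<psi> t * indicator {r<..<s k} t)"
      unfolding incseq_def le_fun_def
    proof (intro allI impI)
      fix j k :: nat and t assume "j \<le> k"
      then have "s j \<le> s k" by (rule mono_s)
      then show "\<psi> t * indicator {r<..<s j} t \<le> \<psi> t * indicator {r<..<s k} t"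
        by (auto simp: indicator_def)
    qed
    show "(\<lambda>t. \<psi> t * indicator {r<..<s k} t) \<in> borel_measurable lebesgue" for k
      using r by (intro meas) auto
    show "(\<lambda>k. \<psi> t * indicator {r<..<s k} t) \<longlonglongrightarrow> \<psi> t * indicator {r<..<1} t" for t
    proof (cases "t < 1")
      case True
      have "\<forall>\<^sub>F k in sequentially. t < s k" using lim_s True by (rule order_tendstoD(1))
      then have "\<forall>\<^sub>F k in sequentially. \<psi> t * indicator {r<..<s k} t = \<psi> t * indicator {r<..<1} t"
        by eventually_elim (use True in \<open>auto simp: indicator_def\<close>)
      then show ?thesis by (rule tendsto_eventually)
    next
      case False
      have "\<psi> t * indicator {r<..<s k} t = \<psi> t * indicator {r<..<1} t" for k
        using False s1[of k] by (auto simp: indicator_def)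
      then show ?thesis by simp
    qed
  qed
  also have "(\<integral>\<^sup>+t\<in>{r<..<1}. \<psi> t \<partial>lebesgue) = (\<integral>\<^sup>+t\<in>{r..1}. \<psi> t \<partial>lebesgue)"
  proof (rule nn_integral_cong_AE)
    have "AE t in lebesgue. t \<notin> {r, 1}"
      by (intro AE_not_in) (simp add: null_sets_completionI finite_imp_null_set_lborel)
    then show "AE t in lebesgue. \<psi> t * indicator {r<..<1} t = \<psi> t * indicator {r..1} t"
      by eventually_elim (auto simp: indicator_def)
  qed
  finally show "(\<lambda>k. \<integral>\<^sup>+t\<in>{r<..<s k}. \<psi> t \<partial>lebesgue) \<longlonglongrightarrow> (\<integral>\<^sup>+t\<in>{r..1}. \<psi> t \<partial>lebesgue)" .
qed

section \<open>Solving for the volume\<close>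

text \<open>\<open>m\<close> will be n * \<Omega>, the constant of the capacity bound. It is first
  lowered to \<omega>; then multiplying by the reciprocal powers of N / k and j and taking the root
  of order p - 1 isolates k / N.\<close>

lemma powr_root_le:
  fixes \<omega> c j \<alpha> p N k m :: real
  assumes "0 \<le> \<omega>" "\<omega> \<le> m" "c > 0" "j > 0" "p > 1" "k > 0" "N > 0"
    and le: "m * (N / k) powr (p - 1) \<le> j powr (- p) * (c * j powr \<alpha>)"
  shows "(\<omega> / c) powr (1 / (p - 1)) * j powr ((p - \<alpha>) / (p - 1)) \<le> k / N"
proof -
  have "\<omega> * (N / k) powr (p - 1) \<le> c * j powr (\<alpha> - p)"
    using le mult_right_mono[OF assms(2), of "(N / k) powr (p - 1)"] by (simp add: powr_diff powr_minus_divide field_simps)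
  then have "\<omega> * (N / k) powr (p - 1) * ((k / N) powr (p - 1) * j powr (p - \<alpha>) / c)
     \<le> c * j powr (\<alpha> - p) * ((k / N) powr (p - 1) * j powr (p - \<alpha>) / c)"
    using assms by (intro mult_right_mono) auto
  moreover have "(N / k) powr (p - 1) * (k / N) powr (p - 1) = 1" using assms by (simp flip: powr_mult)
  moreover have "j powr (\<alpha> - p) * j powr (p - \<alpha>) = 1" using assms by (simp flip: powr_add)
  ultimately have "\<omega> / c * j powr (p - \<alpha>) \<le> (k / N) powr (p - 1)"
    using assms(3) by (simp add: ac_simps) (metis (no_types, opaque_lifting) mult.assoc mult.commute mult.right_neutral nonzero_mult_div_cancel_left less_irrefl times_divide_eq_right)
  then have "(\<omega> / c * j powr (p - \<alpha>)) powr (1 / (p - 1)) \<le> ((k / N) powr (p - 1)) powr (1 / (p - 1))"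
    using assms by (intro powr_mono2) auto
  moreover have "(\<omega> / c * j powr (p - \<alpha>)) powr (1 / (p - 1)) = (\<omega> / c) powr (1 / (p - 1)) * j powr ((p - \<alpha>) / (p - 1))"
    by (subst powr_mult) (use assms in \<open>simp_all add: powr_powr\<close>)
  moreover have "((k / N) powr (p - 1)) powr (1 / (p - 1)) = k / N"
    using assms by (simp add: powr_powr)
  ultimately show ?thesis by simp
qed

text \<open>Here v is V / \<Omega> and A the left side of \<open>powr_root_le\<close>. The
  hypothesis reads 1 + (N - p) / (p - 1) * A \<le> v powr (- e), and the negative power -1 / e
  reverses the inequality.\<close>

lemma volume_le_powr:
  fixes v N p A :: real
  assumes "0 < v" "1 < p" "p < N" "A \<ge> 0"
    and A: "A \<le> N * (p - 1) / (N - p) * (v powr (- ((N - p) / (N * (p - 1)))) - 1) / N"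
  shows "v \<le> (1 + (N - p) / (p - 1) * A) powr (- (N * (p - 1) / (N - p)))"
proof -
  define e where "e = (N - p) / (N * (p - 1))"
  have e: "e > 0" using assms by (simp add: e_def)
  have inv: "N * (p - 1) / (N - p) = 1 / e" by (simp add: e_def)
  have "(N - p) / (p - 1) * A \<le> (N - p) / (p - 1) * (N * (p - 1) / (N - p) * (v powr (- e) - 1) / N)"
    using A assms unfolding e_def by (intro mult_left_mono) auto
  also have "\<dots> = v powr (- e) - 1"
  proof -
    have "a / b * (N * b / a * x / N) = x" if "a \<noteq> 0" "b \<noteq> 0" for a b x using that assms by simp
    then show ?thesis using assms by simp
  qed
  finally have "1 + (N - p) / (p - 1) * A \<le> v powr (- e)" by simp
  then have "(v powr (- e)) powr (- (1 / e)) \<le> (1 + (N - p) / (p - 1) * A) powr (- (1 / e))"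
    using assms e by (intro powr_mono2') (auto intro: add_pos_nonneg)
  then show ?thesis unfolding inv using assms e by (simp add: powr_powr)
qed

theorem lemma3:
  fixes f :: "real ^ 'n \<Rightarrow> real ^ 'n"
    and Q :: "real ^ 'n \<Rightarrow> ennreal"
    and \<psi> J :: "real \<Rightarrow> ennreal"
    and p \<alpha> c \<omega> \<Omega> :: real
    and n :: nat
  assumes n: "n = CARD('n)" "n \<ge> 2"
    and \<omega>: "\<omega> = unit_sphere_area TYPE(real ^ 'n)"
    and \<Omega>: "\<Omega> = measure lebesgue (ball (0 :: real ^ 'n) 1)"
    and p: "p \<ge> 1"
    and Q: "Q \<in> borel_measurable (lebesgue_on (ball 0 1))"
    and f_cont: "continuous_on (ball 0 1) f"
    and f_into: "f ` ball 0 1 \<subseteq> ball 0 1"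
    and f_open: "open_map (top_of_set (ball 0 1)) euclidean f"
    and f_discrete: "discrete_map (ball 0 1) f"
    and f_ring: "ring_mapping p Q (ball 0 1) f"
    and q0_finite: "AE r in lebesgue. r \<in> {0<..<1} \<longrightarrow> spherical_mean Q r \<noteq> \<infinity>"
    and c: "c > 0"
    and \<alpha>: "\<alpha> \<le> p"
    and \<psi>: "\<psi> \<in> borel_measurable (lebesgue_on {0<..})"
    and J: "\<And>r. J r = (\<integral>\<^sup>+t \<in> {r..1}. \<psi> t \<partial>lebesgue)"
    and J_bounds: "\<And>r. r \<in> {0<..<1} \<Longrightarrow> 0 < J r \<and> J r < \<infinity>"
    and growth: "\<And>r. r \<in> {0<..<1} \<Longrightarrow>
      (\<integral>\<^sup>+x \<in> annulus r 1 0. Q x * \<psi> (norm x) epowr p \<partial>lebesgue)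
        \<le> ennreal (c * enn2real (J r) powr \<alpha>)"
    and r: "r \<in> {0<..<1}"
  shows "(1 < p \<and> p < real n \<longrightarrow>
      (let \<beta> = (real n - p) / (p - 1) * (\<omega> / c) powr (1 / (p - 1)) in
        emeasure lebesgue (f ` ball 0 r)
          \<le> ennreal (\<Omega> * (1 + \<beta> * enn2real (J r) powr ((p - \<alpha>) / (p - 1)))
                          powr (- (real n * (p - 1) / (real n - p)))))) \<and>
    (p = real n \<longrightarrow>
      (let \<gamma> = real n * (\<omega> / c) powr (1 / (real n - 1)) in
        emeasure lebesgue (f ` ball 0 r)
          \<le> ennreal (\<Omega> * exp (- \<gamma> * enn2real (J r) powr ((real n - \<alpha>) / (real n - 1))))))"
proof -
  have odm: "open_discrete_map f (ball 0 1)"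
  proof
    show "open (f ` V)" if "open V" "V \<subseteq> ball 0 1" for V
      using f_open that unfolding open_map_def by (simp add: openin_open_eq)
    show "discrete {x \<in> ball 0 1. f x = y}" for y
      using f_discrete unfolding discrete_map_def by simp
  qed (use f_cont in auto)
  have N: "real DIM(real ^ 'n) = real n" using n by simp
  have \<Omega>_eq: "\<Omega> = unit_ball_vol n"
    using content_ball[of 1 "0 :: real ^ 'n"] n(1) by (simp add: \<Omega>)
  have \<Omega>_pos: "\<Omega> > 0" by (simp add: \<Omega>_eq)
  have \<omega>_le: "\<omega> \<le> n * \<Omega>" using unit_sphere_area_le[where 'n = 'n] by (simp add: \<omega> \<Omega>_eq n(1))
  have \<omega>_nonneg: "\<omega> \<ge> 0" by (simp add: \<omega> unit_sphere_area_def)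
  define j where "j = enn2real (J r)"
  have j: "j > 0" "J r = ennreal j"
    using J_bounds[OF r] by (auto simp: j_def enn2real_positive_iff less_top)
  have ring: "ring_mapping_at p Q (ball 0 1) f 0" using f_ring by (simp add: ring_mapping_def)
  have r01: "0 < r" "r < 1" using r by auto
  let ?e = "- (p / (p - 1) * (real n - 1) / real n)"
  \<comment> \<open>The core has radius \<open>r\<^sub>0\<close> below r, and the ring runs from r
    to \<open>s i\<close>. The lower and upper estimates of its modulus are compared as the
    integrals of \<psi> over (r, \<open>s i\<close>) tend to j.\<close>
  have key: "(\<omega> / c) powr (1 / (p - 1)) * j powr ((p - \<alpha>) / (p - 1)) \<le> k / n"
    if p1: "p > 1" and r0: "0 < r\<^sub>0" "r\<^sub>0 < r" and V: "V > 0" "ennreal V < emeasure lborel (f ` cball 0 r\<^sub>0)" and k: "k > 0"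
      and K: "(\<integral>\<^sup>+W\<in>{V..<\<Omega>}. ennreal ((W / \<Omega>) powr ?e) \<partial>lborel) \<le> ennreal (\<Omega> * k)"
    for V r\<^sub>0 k
  proof -
    define s where "s i = 1 - (1 - r) / real (i + 2)" for i :: nat
    define I where "I i = (\<integral>\<^sup>+t\<in>{r<..<s i}. \<psi> t \<partial>lebesgue)" for i
    note tail = nn_integral_tail_LIMSEQ[OF \<psi> r01, folded s_def]
    have I_lim: "I \<longlonglongrightarrow> ennreal j" using tail(1) unfolding I_def j(2)[symmetric] J .
    have I_le: "I i \<le> ennreal j" for i
      unfolding I_def j(2)[symmetric] J using tail(3)[of i]
      by (intro nn_integral_mono) (auto simp: indicator_def)
    then have I_eq: "I i = ennreal (enn2real (I i))" for i
      by (metis ennreal_enn2real ennreal_less_top order_le_less_trans)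
    have lim: "(\<lambda>i. enn2real (I i)) \<longlonglongrightarrow> j"
      using tendsto_enn2real[OF I_lim] j(1) by simp
    \<comment> \<open>Over a short ring the integral of \<psi> may vanish, and then \<psi> cannot be
      normalised. Positivity holds eventually because the limit j is positive.\<close>
    have bound: "real n * \<Omega> * (real n / k) powr (p - 1) \<le> enn2real (I i) powr (- p) * (c * j powr \<alpha>)" if Ii: "enn2real (I i) > 0" for i
    proof -
      let ?\<Gamma> = "image_curves f (joining_curves (sphere 0 r) (sphere 0 (s i)) (annulus r (s i) 0))"
      have "ennreal (real n * \<Omega> * (real n / k) powr (p - 1)) \<le> modulus p ?\<Gamma>"
        using modulus_image_ring_ge[OF odm f_into r0 tail(2,3) p1 V k] K unfolding N \<Omega>_eq by simp
      also have "\<dots> \<le> ennreal (enn2real (I i) powr (- p) * (c * j powr \<alpha>))"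
      proof (rule ring_modulus_le[OF ring r01(1) tail(2,3) \<psi> _ Ii])
        show "(\<integral>\<^sup>+t\<in>{r<..<s i}. \<psi> t \<partial>lebesgue) = ennreal (enn2real (I i))"
          using I_eq[of i] by (simp add: I_def)
      qed (use growth[OF r] c in \<open>simp_all add: j_def\<close>)
      finally show ?thesis using c by (subst (asm) ennreal_le_iff) auto
    qed
    have "real n * \<Omega> * (real n / k) powr (p - 1) \<le> j powr (- p) * (c * j powr \<alpha>)"
    proof (rule tendsto_lowerbound)
      show "(\<lambda>i. enn2real (I i) powr (- p) * (c * j powr \<alpha>)) \<longlonglongrightarrow> j powr (- p) * (c * j powr \<alpha>)"
        using j(1) by (intro tendsto_intros lim) auto
      show "\<forall>\<^sub>F i in sequentially. real n * \<Omega> * (real n / k) powr (p - 1) \<le> enn2real (I i) powr (- p) * (c * j powr \<alpha>)"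
        using order_tendstoD(1)[OF lim j(1)] by eventually_elim (rule bound)
    qed simp
    then show ?thesis
      using \<omega>_nonneg \<omega>_le c j(1) p1 k n by (intro powr_root_le[where m = "real n * \<Omega>"]) auto
  qed
  have V_less: "V < \<Omega>" if "0 < V" "0 < r\<^sub>0" "r\<^sub>0 < r" "ennreal V < emeasure lborel (f ` cball 0 r\<^sub>0)" for V r\<^sub>0
  proof -
    have "f ` cball 0 r\<^sub>0 \<subseteq> f ` ball 0 1" using that r01 by (intro image_mono) auto
    then have "f ` cball 0 r\<^sub>0 \<subseteq> ball 0 1" using f_into by blast
    then have "emeasure lborel (f ` cball 0 r\<^sub>0) \<le> emeasure lborel (ball (0 :: real ^ 'n) 1)"
      by (intro emeasure_mono) auto
    also have "\<dots> = ennreal \<Omega>" by (simp add: emeasure_ball \<Omega>_eq n(1))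
    finally have "ennreal V < ennreal \<Omega>" using that by order
    then show ?thesis using that by (simp add: ennreal_less_iff)
  qed
  \<comment> \<open>The key estimate concerns positive V strictly below the volume of the image of a
    compact core. Density handles all such V, and the cores then exhaust the open ball.\<close>
  have reduce: "emeasure lebesgue (f ` ball 0 r) \<le> ennreal (\<Omega> * X)"
    if X: "\<And>V r\<^sub>0. 0 < V \<Longrightarrow> 0 < r\<^sub>0 \<Longrightarrow> r\<^sub>0 < r \<Longrightarrow> ennreal V < emeasure lborel (f ` cball 0 r\<^sub>0) \<Longrightarrow> V / \<Omega> \<le> X"
    for X
  proof -
    have le: "emeasure lborel (f ` cball 0 r\<^sub>0) \<le> ennreal (\<Omega> * X)" if r0: "0 < r\<^sub>0" "r\<^sub>0 < r" for r\<^sub>0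
    proof (rule dense_le)
      fix y assume y: "y < emeasure lborel (f ` cball 0 r\<^sub>0)"
      then obtain V where V: "y = ennreal V" "V \<ge> 0" by (cases y) auto
      show "y \<le> ennreal (\<Omega> * X)"
      proof (cases "V = 0")
        case False
        then have "V / \<Omega> \<le> X" using X[OF _ r0, of V] V y by simp
        then show ?thesis using V \<Omega>_pos by (simp add: ennreal_leI field_simps)
      qed (simp add: V)
    qed
    \<comment> \<open>The shift by 2 makes even \<open>t 0\<close> positive.\<close>
    define t where "t i = r * (1 - 1 / real (i + 2))" for i :: nat
    have t: "0 < t i" "t i < r" for i
      using r01 by (auto simp: t_def)
    have comp: "compact (f ` cball 0 (t i))" for i
      using t(2)[of i] r01 by (intro compact_continuous_image continuous_on_subset[OF f_cont]) auto
    have lim_t: "t \<longlonglongrightarrow> r"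
    proof -
      have "(\<lambda>i. 1 / real (i + 2)) \<longlonglongrightarrow> 0"
        by (rule LIMSEQ_ignore_initial_segment[OF lim_const_over_n])
      then have "(\<lambda>i. r * (1 - 1 / real (i + 2))) \<longlonglongrightarrow> r * (1 - 0)" by (intro tendsto_intros)
      then show ?thesis by (simp add: t_def[abs_def])
    qed
    have "f ` ball 0 r = (\<Union>i. f ` cball 0 (t i))"
    proof (intro equalityI subsetI)
      fix y assume "y \<in> f ` ball 0 r"
      then obtain x where x: "norm x < r" "y = f x" by auto
      have "\<forall>\<^sub>F i in sequentially. norm x < t i" using lim_t x(1) by (rule order_tendstoD(1))
      then obtain i where "norm x < t i" by (metis eventually_happens trivial_limit_sequentially)
      then have "y \<in> f ` cball 0 (t i)" using x by auto
      then show "y \<in> (\<Union>i. f ` cball 0 (t i))" by blast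
    next
      fix y assume "y \<in> (\<Union>i. f ` cball 0 (t i))"
      then obtain i x where "norm x \<le> t i" "y = f x" by auto
      then have "norm x < r" using t(2)[of i] by simp
      then show "y \<in> f ` ball 0 r" using \<open>y = f x\<close> by auto
    qed
    moreover have "emeasure lborel (\<Union>i. f ` cball 0 (t i)) = (SUP i. emeasure lborel (f ` cball 0 (t i)))"
    proof (rule SUP_emeasure_incseq[symmetric])
      show "range (\<lambda>i. f ` cball 0 (t i)) \<subseteq> sets lborel" using comp by (auto intro: borel_compact)
      show "incseq (\<lambda>i. f ` cball 0 (t i))"
        unfolding incseq_def
      proof (intro allI impI image_mono)
        fix i i' :: nat assume "i \<le> i'"
        then have "t i \<le> t i'" unfolding t_def using r01
          by (intro mult_left_mono diff_left_mono divide_left_mono) auto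
        then show "cball 0 (t i) \<subseteq> (cball 0 (t i') :: (real ^ 'n) set)" by auto
      qed
    qed
    moreover have "(\<Union>i. f ` cball 0 (t i)) \<in> sets lborel"
      using comp by (intro sets.countable_UN) (auto intro: borel_compact)
    ultimately have "emeasure lebesgue (f ` ball 0 r) = (SUP i. emeasure lborel (f ` cball 0 (t i)))" by simp
    also have "\<dots> \<le> ennreal (\<Omega> * X)" by (intro SUP_least le t)
    finally show ?thesis .
  qed
  have main1: "emeasure lebesgue (f ` ball 0 r)
      \<le> ennreal (\<Omega> * (1 + (real n - p) / (p - 1) * (\<omega> / c) powr (1 / (p - 1)) * j powr ((p - \<alpha>) / (p - 1)))
             powr (- (real n * (p - 1) / (real n - p))))" if p1: "1 < p" "p < real n"
  proof (rule reduce)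
    fix V r\<^sub>0 assume V: "0 < V" "0 < r\<^sub>0" "r\<^sub>0 < r" "ennreal V < emeasure lborel (f ` cball 0 r\<^sub>0)"
    have V\<Omega>: "V < \<Omega>" by (rule V_less[OF V])
    define k where "k = real n * (p - 1) / (real n - p) * ((V / \<Omega>) powr (- ((real n - p) / (real n * (p - 1)))) - 1)"
    \<comment> \<open>As V < \<Omega>, the base is below one and its negative power above one, which
      makes k positive.\<close>
    have "(V / \<Omega>) powr (- ((real n - p) / (real n * (p - 1)))) > 1 powr (- ((real n - p) / (real n * (p - 1))))"
      using V V\<Omega> p1 by (intro powr_less_mono2_neg) auto
    then have k: "k > 0" using p1 by (simp add: k_def)
    have "(\<integral>\<^sup>+W\<in>{V..<\<Omega>}. ennreal ((W / \<Omega>) powr ?e) \<partial>lborel) \<le> ennreal (\<Omega> * k)"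
      unfolding k_def using V V\<Omega> p1 by (intro nn_integral_ball_profile_le) auto
    from key[OF p1(1) V(2,3,1,4) k this]
    have "V / \<Omega> \<le> (1 + (real n - p) / (p - 1) * ((\<omega> / c) powr (1 / (p - 1)) * j powr ((p - \<alpha>) / (p - 1))))
       powr (- (real n * (p - 1) / (real n - p)))"
      using V V\<Omega> \<Omega>_pos p1 unfolding k_def by (intro volume_le_powr) auto
    then show "V / \<Omega> \<le> (1 + (real n - p) / (p - 1) * (\<omega> / c) powr (1 / (p - 1)) * j powr ((p - \<alpha>) / (p - 1)))
       powr (- (real n * (p - 1) / (real n - p)))" by (simp add: mult.assoc)
  qed
  have main2: "emeasure lebesgue (f ` ball 0 r)
      \<le> ennreal (\<Omega> * exp (- (real n * (\<omega> / c) powr (1 / (real n - 1))) * j powr ((real n - \<alpha>) / (real n - 1))))"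
    if pn: "p = real n"
  proof (rule reduce)
    fix V r\<^sub>0 assume V: "0 < V" "0 < r\<^sub>0" "r\<^sub>0 < r" "ennreal V < emeasure lborel (f ` cball 0 r\<^sub>0)"
    have V\<Omega>: "V < \<Omega>" by (rule V_less[OF V])
    have k: "ln (\<Omega> / V) > 0" using V V\<Omega> by simp
    have p1: "p > 1" using pn n by simp
    have "(\<integral>\<^sup>+W\<in>{V..<\<Omega>}. ennreal ((W / \<Omega>) powr ?e) \<partial>lborel) \<le> ennreal (\<Omega> * ln (\<Omega> / V))"
      unfolding pn using V V\<Omega> n by (intro nn_integral_ball_profile_log) auto
    from key[OF p1 V(2,3,1,4) k this]
    have "real n * (\<omega> / c) powr (1 / (real n - 1)) * j powr ((real n - \<alpha>) / (real n - 1)) \<le> ln (\<Omega> / V)"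
      using n unfolding pn by (simp add: field_simps)
    then have "exp (- ln (\<Omega> / V)) \<le> exp (- (real n * (\<omega> / c) powr (1 / (real n - 1))) * j powr ((real n - \<alpha>) / (real n - 1)))"
      by simp
    then show "V / \<Omega> \<le> exp (- (real n * (\<omega> / c) powr (1 / (real n - 1))) * j powr ((real n - \<alpha>) / (real n - 1)))"
      using V V\<Omega> by (simp add: exp_minus)
  qed
  show ?thesis using main1 main2 unfolding Let_def j_def[symmetric] by blast
qed

end
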